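(* Let $\kappa\in\mathbb{R}$ be a constant and let $u:\mathbb{R}^2_+\to\mathbb{R}$ be a solution, bounded from above, of $$\begin{cases}\Delta u+e^{2u}=0 & \text{in }\mathbb{R}^2_+,\\[2pt] \dfrac{\partial u}{\partial x_2}(x_1,0)=-\kappa e^{u(x_1,0)} & \text{on }x_2=0.\end{cases}$$ Then, up to a normalization (that is, after replacing $u$ by $u_{\lambda,a}$ for some $\lambda>0$ and $a\in\mathbb{R}$), $u$ is one of the following: either $$u=\ln\left(\frac{2}{1+x_1^2+(x_2+\kappa)^2}\right),$$ or $$u=\ln\left(\frac{2e^{x_2}}{\sqrt{\kappa^2+t^2+1}-\kappa+2t\cos(x_1)e^{x_2}+(\sqrt{\kappa^2+t^2+1}+\kappa)e^{2x_2}}\right)\quad\text{for some }t\ge0,$$ or $$u=\ln\left(\frac{2e^{x_1}}{(1+t^2)+2te^{x_1}\cos(x_2-b)+e^{2x_1}}\right)$$ for some $t\ge 0$ and $b\in\mathbb{R}$ with $t\sin b=\kappa$.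
   Context: $\mathbb{R}^2_+=\mathbb{R}\times(0,\infty)$ is the upper half plane with coordinates $(x_1,x_2)$ and boundary $\{x_2=0\}$. A normalization of a solution $u$ is a function of the form $u_{\lambda,a}(x_1,x_2):=u(\lambda x_1+a,\lambda x_2)+\ln\lambda$ with $\lambda>0$, $a\in\mathbb{R}$; it is again a solution of the same boundary value problem. *)

theory Defs
  imports "HOL-Analysis.Analysis"
begin

definition half_plane :: "(real \<times> real) set" where
  "half_plane = UNIV \<times> {0<..}"

definition closed_half_plane :: "(real \<times> real) set" where
  "closed_half_plane = UNIV \<times> {0..}"

text \<open>Derivatives are taken within \<open>S\<close>, so on a closed half plane the boundary derivatives are
  one-sided and the values of the function outside \<open>S\<close> play no role.\<close>

definition C1_on :: "'a::real_normed_vector set \<Rightarrow> ('a \<Rightarrow> 'b::real_normed_vector) \<Rightarrow> bool" where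
  "C1_on S f \<longleftrightarrow> (\<exists>f' :: 'a \<Rightarrow> 'a \<Rightarrow>\<^sub>L 'b.
     (\<forall>x\<in>S. (f has_derivative blinfun_apply (f' x)) (at x within S)) \<and> continuous_on S f')"

definition C2_on :: "'a::real_normed_vector set \<Rightarrow> ('a \<Rightarrow> 'b::real_normed_vector) \<Rightarrow> bool" where
  "C2_on S f \<longleftrightarrow> (\<exists>f' :: 'a \<Rightarrow> 'a \<Rightarrow>\<^sub>L 'b.
     (\<forall>x\<in>S. (f has_derivative blinfun_apply (f' x)) (at x within S)) \<and> C1_on S f')"

definition partial_deriv :: "'a::real_normed_vector \<Rightarrow> ('a \<Rightarrow> real) \<Rightarrow> 'a \<Rightarrow> real" where
  "partial_deriv v f x = deriv (\<lambda>h. f (x + h *\<^sub>R v)) 0"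

definition laplacian :: "('a::euclidean_space \<Rightarrow> real) \<Rightarrow> 'a \<Rightarrow> real" where
  "laplacian f x = (\<Sum>b\<in>Basis. partial_deriv b (partial_deriv b f) x)"

text \<open>Classical solutions: \<open>C\<^sup>2\<close> in the open half plane and \<open>C\<^sup>1\<close> up to its boundary.\<close>

definition liouville_neumann_solution :: "real \<Rightarrow> (real \<times> real \<Rightarrow> real) \<Rightarrow> bool" where
  "liouville_neumann_solution \<kappa> u \<longleftrightarrow>
     C2_on half_plane u \<and> C1_on closed_half_plane u \<and>
     (\<forall>x\<in>half_plane. laplacian u x + exp (2 * u x) = 0) \<and>
     (\<forall>x1. ((\<lambda>s. u (x1, s)) has_real_derivative - \<kappa> * exp (u (x1, 0))) (at 0 within {0..}))"

definition normalization :: "real \<Rightarrow> real \<Rightarrow> (real \<times> real \<Rightarrow> real) \<Rightarrow> real \<times> real \<Rightarrow> real" where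
  "normalization l a u = (\<lambda>(x1, x2). u (l * x1 + a, l * x2) + ln l)"

end

theory Submission
  imports Defs "HOL-Complex_Analysis.Complex_Analysis"
begin

text \<open>Identify the half plane with \<open>{z. 0 < Im z}\<close>, let \<open>D\<close> be the Wirtinger derivative of \<open>u\<close> in \<open>z\<close> and \<open>E\<close>
  that of \<open>D\<close>. The equation says that the derivative of \<open>D\<close> in \<open>cnj z\<close> is \<open>- exp (2 * u) / 4\<close>, and it makes
  \<open>f = E - D\<^sup>2\<close> (half the Schwarzian derivative of a developing map) holomorphic. The Neumann condition makes
  \<open>f\<close> real on the boundary, so \<open>f\<close> extends to an entire function by Schwarz reflection. As \<open>u\<close> is only \<open>C\<^sup>1\<close> up to
  the boundary and \<open>C\<^sup>2\<close> inside, neither step can be done on \<open>f\<close> itself; both are done on a primitive \<open>F\<close>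
  of \<open>f\<close>. The 1-form \<open>- D\<^sup>2 dz + exp (2 * u) / 4 d(cnj z)\<close> involves first derivatives only and is closed; if \<open>P\<close>
  is a potential of it, then \<open>F = D + P\<close> is holomorphic, continuous up to the boundary, and has constant
  imaginary part there (lemma \<open>schwarzian_extends_entire\<close>).

  The function \<open>exp (- u)\<close> is killed by the second \<open>z\<close>-derivative plus \<open>f\<close>, hence it is a Hermitian form, with constant coefficients
  and determinant \<open>1/4\<close>, in any two solutions \<open>\<phi>\<close>, \<open>\<psi>\<close> of the oscillator equation
  \<open>\<phi>'' = - f \<phi>\<close> with Wronskian \<open>1\<close> (lemma \<open>exp_minus_U_hermitian_form\<close>). For entire solutions that are
  real on the real axis, \<open>|\<phi>|\<^sup>2 + |\<psi>|\<^sup>2\<close> is symmetric under conjugation. The upper bound on \<open>u\<close> therefore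
  bounds \<open>|\<phi>|\<^sup>2 + |\<psi>|\<^sup>2\<close> below by a positive constant on the whole plane, and the boundary has disappeared from
  the problem.

  The heart of the proof is that such a pair exists only if \<open>f\<close> is constant (theorem \<open>coefficient_constant\<close>).
  Put \<open>v = ln (|\<phi>|\<^sup>2 + |\<psi>|\<^sup>2)\<close>, so that the Laplacian of \<open>v\<close> is \<open>4 exp (- 2 v)\<close>, which is bounded. In a disc of
  fixed radius around any point, a unitary change of the pair makes the first function dominate the second, so
  \<open>v\<close> is within \<open>ln 2\<close> of \<open>ln |\<phi>|\<^sup>2\<close>, a harmonic function bounded below. Harnack-type bounds for the logarithm of \<open>\<phi>\<close>
  show that \<open>v\<close> cannot drop quickly and that \<open>|f|\<close> is at most of order \<open>v\<^sup>2\<close>. The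
  mean of \<open>v\<close> over the circle of radius \<open>r\<close> grows at most like \<open>r\<^sup>2\<close> because the Laplacian is bounded; with the
  Harnack bound \<open>v\<close>, and hence \<open>f\<close>, grows polynomially, so \<open>f\<close> is a polynomial. If it were not constant, \<open>|f|\<close> would
  grow at least linearly and \<open>v\<close> at least like the square root of \<open>r\<close>; then \<open>exp (- 2 v)\<close> is integrable and the
  circle means of \<open>v\<close> grow only logarithmically, a contradiction.

  Once \<open>f\<close> is a real constant \<open>c\<close>, the oscillator equation is solved by \<open>1, z\<close> or by exponentials, and the
  Hermitian form together with the Neumann condition gives the first family for \<open>c = 0\<close>, the second for \<open>c > 0\<close> and
  the third for \<open>c < 0\<close>.\<close>

section \<open>Two local estimates for holomorphic functions\<close>

definition sqnorm2 :: "(complex \<Rightarrow> complex) \<Rightarrow> (complex \<Rightarrow> complex) \<Rightarrow> complex \<Rightarrow> real" where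
  "sqnorm2 p q z = (cmod (p z))\<^sup>2 + (cmod (q z))\<^sup>2"

text \<open>With Wronskian \<open>1\<close>, the map \<open>q / p\<close> to the Riemann sphere has spherical derivative \<open>1 / (|p|\<^sup>2 + |q|\<^sup>2)\<close>. A lower
  bound on the denominator makes the map Lipschitz, so starting at \<open>0\<close> it stays in the hemisphere around \<open>0\<close> on a
  disc of fixed radius. The function \<open>S\<close> in the proof is the cosine of the spherical distance to \<open>0\<close>.\<close>

lemma wronskian_unit_ratio_less_one:
  assumes p: "p holomorphic_on UNIV" and q: "q holomorphic_on UNIV"
    and wronsk: "\<And>z. p z * deriv q z - deriv p z * q z = 1"
    and "0 < d" and lower: "\<And>z. d \<le> sqnorm2 p q z"
    and zero: "q z0 = 0" and near: "dist z z0 < d / 2"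
  shows "cmod (q z) < cmod (p z)"
proof -
  define e where "e = z - z0"
  define g where "g t = z0 + of_real t * e" for t :: real
  define S where "S t = ((cmod (p (g t)))\<^sup>2 - (cmod (q (g t)))\<^sup>2) / sqnorm2 p q (g t)" for t
  define S' where "S' t = - 4 * Re (e * cnj (p (g t)) * cnj (q (g t))) / (sqnorm2 p q (g t))\<^sup>2" for t
  have gder: "(g has_vector_derivative e) (at t)" for t
    unfolding g_def by (auto intro!: derivative_eq_intros simp: scaleR_conv_of_real)
  have chain: "((\<lambda>t. h (g t)) has_vector_derivative e * deriv h (g t)) (at t)"
    if "h holomorphic_on UNIV" for h t
    using field_vector_diff_chain_at[OF gder, of h "deriv h (g t)" t] that
    by (simp add: o_def holomorphic_derivI)
  have sq: "((\<lambda>t. (cmod (h (g t)))\<^sup>2) has_real_derivative 2 * Re (cnj (h (g t)) * (e * deriv h (g t)))) (at t)"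
    if "h holomorphic_on UNIV" for h t
  proof -
    have "((\<lambda>t. h (g t) \<bullet> h (g t)) has_derivative
        (\<lambda>x. h (g t) \<bullet> (x *\<^sub>R (e * deriv h (g t))) + (x *\<^sub>R (e * deriv h (g t))) \<bullet> h (g t))) (at t)"
      using chain[OF that, of t] unfolding has_vector_derivative_def
      by (intro has_derivative_inner)
    moreover have "(\<lambda>t. h (g t) \<bullet> h (g t)) = (\<lambda>t. (cmod (h (g t)))\<^sup>2)"
      by (simp add: dot_square_norm)
    ultimately show ?thesis
      unfolding has_field_derivative_def
      by (rule_tac has_derivative_eq_rhs) (auto simp: inner_complex_def algebra_simps fun_eq_iff)
  qed
  have pos: "0 < sqnorm2 p q z" for z using lower[of z] \<open>0 < d\<close> by linarith
  have Sder: "(S has_real_derivative S' t) (at t)" for t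
  proof -
    let ?p = "p (g t)" and ?q = "q (g t)" and ?p' = "deriv p (g t)" and ?q' = "deriv q (g t)"
    define A where "A = Re (cnj ?p * (e * ?p'))"
    define B where "B = Re (cnj ?q * (e * ?q'))"
    have "(S has_real_derivative
       ((2 * A - 2 * B) * sqnorm2 p q (g t) - ((cmod ?p)\<^sup>2 - (cmod ?q)\<^sup>2) * (2 * A + 2 * B))
         / (sqnorm2 p q (g t) * sqnorm2 p q (g t))) (at t)"
      unfolding S_def sqnorm2_def A_def B_def using pos[of "g t"]
      by (intro DERIV_divide DERIV_add DERIV_diff sq p q) (auto simp: sqnorm2_def)
    moreover have "A * (cmod ?q)\<^sup>2 - B * (cmod ?p)\<^sup>2 = - Re (e * cnj ?p * cnj ?q)"
    proof -
      have "A * (cmod ?q)\<^sup>2 - B * (cmod ?p)\<^sup>2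
          = Re (cnj ?p * (e * ?p') * of_real ((cmod ?q)\<^sup>2) - cnj ?q * (e * ?q') * of_real ((cmod ?p)\<^sup>2))"
        unfolding A_def B_def by simp
      also have "\<dots> = Re (cnj ?p * (e * ?p') * (?q * cnj ?q) - cnj ?q * (e * ?q') * (?p * cnj ?p))"
        by (simp only: complex_norm_square)
      also have "cnj ?p * (e * ?p') * (?q * cnj ?q) - cnj ?q * (e * ?q') * (?p * cnj ?p)
          = - (e * cnj ?p * cnj ?q * (?p * ?q' - ?p' * ?q))"
        by (simp add: algebra_simps)
      finally show ?thesis by (simp add: wronsk)
    qed
    hence "(2 * A - 2 * B) * sqnorm2 p q (g t) - ((cmod ?p)\<^sup>2 - (cmod ?q)\<^sup>2) * (2 * A + 2 * B)
        = - 4 * Re (e * cnj ?p * cnj ?q)"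
      unfolding sqnorm2_def by (simp add: algebra_simps)
    ultimately show ?thesis by (simp add: S'_def power2_eq_square)
  qed
  have bound: "\<bar>S' t\<bar> \<le> 2 * cmod e / d" for t
  proof -
    let ?p = "p (g t)" and ?q = "q (g t)" and ?w = "sqnorm2 p q (g t)"
    have "\<bar>Re (e * cnj ?p * cnj ?q)\<bar> \<le> cmod e * (cmod ?p * cmod ?q)"
      using abs_Re_le_cmod[of "e * cnj ?p * cnj ?q"] by (simp add: norm_mult mult.assoc)
    also have "\<dots> \<le> cmod e * (?w / 2)"
      using sum_squares_bound[of "cmod ?p" "cmod ?q"]
      by (intro mult_left_mono) (simp_all add: sqnorm2_def)
    finally have 1: "\<bar>Re (e * cnj ?p * cnj ?q)\<bar> * 4 \<le> 2 * cmod e * ?w" by simp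
    have "\<bar>S' t\<bar> = \<bar>Re (e * cnj ?p * cnj ?q)\<bar> * 4 / ?w\<^sup>2"
      unfolding S'_def abs_divide abs_mult by (simp only: abs_minus_cancel abs_numeral abs_power2 mult.commute)
    also have "\<dots> \<le> 2 * cmod e * ?w / ?w\<^sup>2" using 1 by (intro divide_right_mono) auto
    also have "\<dots> = 2 * cmod e / ?w" using pos[of "g t"] by (simp add: power2_eq_square)
    also have "\<dots> \<le> 2 * cmod e / d" using lower[of "g t"] \<open>0 < d\<close> by (intro divide_left_mono) auto
    finally show ?thesis .
  qed
  \<comment> \<open>The cosine starts at \<open>1\<close> and changes by less than \<open>1\<close> along the segment, so it stays positive.\<close>
  obtain t where "S 1 - S 0 = S' t"
    using MVT2[of 0 1 S S'] Sder by auto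
  moreover have "S 0 = 1"
    using pos[of z0] by (simp add: S_def g_def zero sqnorm2_def)
  moreover have "2 * cmod e / d < 1"
    using near \<open>0 < d\<close> by (simp add: e_def dist_norm)
  ultimately have "0 < S 1" using bound[of t] by linarith
  moreover have "g 1 = z" by (simp add: g_def e_def)
  ultimately have "0 < (cmod (p z))\<^sup>2 - (cmod (q z))\<^sup>2"
    using pos[of z] by (simp add: S_def zero_less_divide_iff)
  thus ?thesis by (simp add: power_less_imp_less_base)
qed

text \<open>A Borel-Caratheodory (or Harnack) estimate: the Moebius map that takes the half plane to the unit disc
  and \<open>L z0\<close> to \<open>0\<close> reduces it to the Schwarz lemma. The radius \<open>r / 5\<close> is chosen so that the
  bound is half the distance of \<open>L z0\<close> to the boundary line of the half plane, which keeps \<open>L\<close> away from that line.\<close>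

lemma holomorphic_Re_lower_bound_imp_near_center:
  assumes L: "L holomorphic_on ball z0 r" and "0 < r"
    and pos: "\<And>z. z \<in> ball z0 r \<Longrightarrow> - c < Re (L z)"
    and z: "dist z0 z \<le> r / 5"
  shows "cmod (L z - L z0) \<le> (Re (L z0) + c) / 2"
proof -
  define G where "G w = z0 + of_real r * w" for w
  define M where "M w = (L (G w) - L z0) / (L (G w) + cnj (L z0) + 2 * of_real c)" for w
  have Gball: "G w \<in> ball z0 r" if "cmod w < 1" for w
    using that \<open>0 < r\<close> by (simp add: G_def dist_norm norm_mult)
  have z0: "- c < Re (L z0)" using pos[of z0] \<open>0 < r\<close> by simp
  have denpos: "0 < Re (L (G w) + cnj (L z0) + 2 * of_real c)" if "cmod w < 1" for w
    using pos[OF Gball[OF that]] z0 by simp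
  hence den: "L (G w) + cnj (L z0) + 2 * of_real c \<noteq> 0" if "cmod w < 1" for w
    using that by fastforce
  have Mhol: "M holomorphic_on ball 0 1"
  proof -
    have "(\<lambda>w. L (G w)) holomorphic_on ball 0 1"
    proof (rule holomorphic_on_compose_gen[of G _ L "ball z0 r", unfolded o_def])
      show "G holomorphic_on ball 0 1" unfolding G_def by (intro holomorphic_intros)
    qed (use L Gball in auto)
    thus ?thesis unfolding M_def using den by (intro holomorphic_intros) auto
  qed
  have Mlt: "cmod (M w) < 1" if w: "cmod w < 1" for w
  proof -
    define A where "A = L (G w) + of_real c"
    define B where "B = L z0 + of_real c"
    have "0 < Re A" "0 < Re B" using pos[OF Gball[OF w]] z0 by (auto simp: A_def B_def)
    have "(cmod (A - B))\<^sup>2 = (cmod (A + cnj B))\<^sup>2 - 4 * (Re A * Re B)"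
      unfolding cmod_power2 by (simp add: power2_eq_square algebra_simps)
    also have "\<dots> < (cmod (A + cnj B))\<^sup>2" using \<open>0 < Re A\<close> \<open>0 < Re B\<close> by simp
    finally have "cmod (A - B) < cmod (A + cnj B)" by (simp add: power_less_imp_less_base)
    moreover have "M w = (A - B) / (A + cnj B)" by (simp add: M_def A_def B_def algebra_simps)
    ultimately show ?thesis
      by (simp add: norm_divide divide_less_eq)
  qed
  define w where "w = (z - z0) / of_real r"
  have Gw: "G w = z" using \<open>0 < r\<close> by (simp add: G_def w_def)
  have w5: "cmod w \<le> 1 / 5"
    using z \<open>0 < r\<close> by (simp add: w_def norm_divide dist_norm norm_minus_commute divide_simps)
  have "cmod (M w) \<le> cmod w"
    using Schwarz_Lemma(1)[OF Mhol _ Mlt, of w] w5 by (simp add: M_def G_def)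
  hence M5: "cmod (M w) \<le> 1 / 5" using w5 by linarith
  have "L z - L z0 = M w * (L z + cnj (L z0) + 2 * of_real c)"
    using den[of w] w5 by (simp add: M_def Gw)
  hence "cmod (L z - L z0) = cmod (M w) * cmod (L z + cnj (L z0) + 2 * of_real c)"
    by (simp add: norm_mult)
  also have "\<dots> \<le> 1 / 5 * cmod (L z + cnj (L z0) + 2 * of_real c)"
    using M5 by (intro mult_right_mono) auto
  also have "L z + cnj (L z0) + 2 * of_real c = (L z - L z0) + of_real (2 * (Re (L z0) + c))"
    by (simp add: complex_eq_iff)
  also have "cmod \<dots> \<le> cmod (L z - L z0) + 2 * (Re (L z0) + c)"
    using z0 norm_triangle_ineq[of "L z - L z0" "of_real (2 * (Re (L z0) + c))"]
    unfolding norm_of_real by simp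
  finally show ?thesis by simp
qed

section \<open>Means of the logarithm of a sum of two squared moduli over vertical segments\<close>

lemma has_derivative_along_imaginary:
  assumes "(g has_derivative g') (at (Complex s t))"
  shows "((\<lambda>t. g (Complex s t)) has_vector_derivative g' \<i>) (at t)"
proof -
  have "(Complex s has_derivative (\<lambda>x. x *\<^sub>R \<i>)) (at t)"
    unfolding Complex_eq
    by (auto intro!: derivative_eq_intros simp: scaleR_conv_of_real mult.commute)
  from has_derivative_compose[OF this assms] have "((\<lambda>t. g (Complex s t)) has_derivative (\<lambda>x. g' (x *\<^sub>R \<i>))) (at t)" .
  moreover have "g' (x *\<^sub>R \<i>) = x *\<^sub>R g' \<i>" for x
    using has_derivative_bounded_linear[OF assms] by (simp add: linear_simps)
  ultimately show ?thesis by (simp add: has_vector_derivative_def)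
qed

lemma has_derivative_along_real:
  assumes "(g has_derivative g') (at (Complex s t))"
  shows "((\<lambda>s. g (Complex s t)) has_vector_derivative g' 1) (at s)"
proof -
  have "((\<lambda>s. Complex s t) has_derivative (\<lambda>x. x *\<^sub>R 1)) (at s)"
    unfolding Complex_eq
    by (auto intro!: derivative_eq_intros simp: scaleR_conv_of_real)
  from has_derivative_compose[OF this assms] have "((\<lambda>s. g (Complex s t)) has_derivative (\<lambda>x. g' (x *\<^sub>R 1))) (at s)" .
  moreover have "g' (x *\<^sub>R 1) = x *\<^sub>R g' 1" for x
    using has_derivative_bounded_linear[OF assms] by (simp only: linear_simps)
  ultimately show ?thesis by (simp add: has_vector_derivative_def)
qed

text \<open>\<open>Q\<close> is the Wirtinger derivative of the logarithm in \<open>z\<close>, and \<open>T\<close>, the derivative of \<open>Q\<close> in \<open>cnj z\<close>, is a quarter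
  of its Laplacian: by the Lagrange identity it is the squared modulus of the Wronskian over the squared norm.
  The other derivative of \<open>Q\<close> drops out of the circle means, so only its existence and continuity are recorded.\<close>

lemma ln_sqnorm2_derivatives:
  fixes a b :: "complex \<Rightarrow> complex"
  assumes a: "a holomorphic_on UNIV" and b: "b holomorphic_on UNIV"
    and pos: "\<And>z. 0 < sqnorm2 a b z"
  defines "Q \<equiv> \<lambda>z. (deriv a z * cnj (a z) + deriv b z * cnj (b z)) / of_real (sqnorm2 a b z)"
  defines "T \<equiv> \<lambda>z. (cmod (a z * deriv b z - deriv a z * b z))\<^sup>2 / (sqnorm2 a b z)\<^sup>2"
  shows "((\<lambda>z. ln (sqnorm2 a b z)) has_derivative (\<lambda>h. 2 * Re (Q z * h))) (at z)"
    and "\<exists>Q'. continuous_on UNIV Q' \<and> (\<forall>z. (Q has_derivative (\<lambda>h. Q' z * h + of_real (T z) * cnj h)) (at z))"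
    and "continuous_on UNIV T"
proof -
  define w where "w z = a z * cnj (a z) + b z * cnj (b z)" for z
  have w: "of_real (sqnorm2 a b z) = w z" for z
    unfolding w_def sqnorm2_def of_real_add complex_norm_square ..
  hence sq: "sqnorm2 a b z = Re (w z)" for z by (metis Re_complex_of_real)
  have w0: "w z \<noteq> 0" for z using pos[of z] by (simp flip: w)
  have cnjw: "cnj (w z) = w z" for z by (simp flip: w)
  note hd = has_field_derivative_imp_has_derivative[OF holomorphic_derivI[OF _ open_UNIV UNIV_I]]
  have da: "(a has_derivative (\<lambda>h. deriv a z * h)) (at z)"
    and db: "(b has_derivative (\<lambda>h. deriv b z * h)) (at z)"
    and da': "(deriv a has_derivative (\<lambda>h. deriv (deriv a) z * h)) (at z)"
    and db': "(deriv b has_derivative (\<lambda>h. deriv (deriv b) z * h)) (at z)" for z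
    using a b holomorphic_deriv[OF a open_UNIV] holomorphic_deriv[OF b open_UNIV] by (auto intro!: hd)
  have cont: "continuous_on UNIV a" "continuous_on UNIV b" "continuous_on UNIV (deriv a)" "continuous_on UNIV (deriv b)"
    "continuous_on UNIV (deriv (deriv a))" "continuous_on UNIV (deriv (deriv b))"
    using a b by (auto intro!: holomorphic_on_imp_continuous_on holomorphic_deriv)
  have cw: "continuous_on UNIV w" unfolding w_def using cont by (intro continuous_intros)
  define n where "n z = deriv a z * cnj (a z) + deriv b z * cnj (b z)" for z
  have cn: "continuous_on UNIV n" unfolding n_def using cont by (intro continuous_intros)
  have Q: "Q z = n z / w z" for z by (simp add: Q_def n_def w)
  have dw: "(w has_derivative (\<lambda>h. n z * h + cnj (n z * h))) (at z)" for z
    unfolding w_def n_def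
    by (rule derivative_eq_intros da db refl)+ (simp add: fun_eq_iff algebra_simps)
  show "((\<lambda>z. ln (sqnorm2 a b z)) has_derivative (\<lambda>h. 2 * Re (Q z * h))) (at z)"
  proof -
    have "((\<lambda>z. Re (w z)) has_derivative (\<lambda>h. Re (n z * h + cnj (n z * h)))) (at z)"
      by (intro has_derivative_Re dw)
    hence "((\<lambda>z. sqnorm2 a b z) has_derivative (\<lambda>h. 2 * Re (n z * h))) (at z)"
      by (simp add: sq mult.commute)
    from has_derivative_compose[OF this has_field_derivative_imp_has_derivative[OF DERIV_ln[OF pos]]]
    have "((\<lambda>z. ln (sqnorm2 a b z)) has_derivative (\<lambda>h. inverse (sqnorm2 a b z) * (2 * Re (n z * h)))) (at z)" .
    moreover have "inverse (sqnorm2 a b z) * (2 * Re (n z * h)) = 2 * Re (Q z * h)" for h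
    proof -
      have "Q z * h = n z * h / of_real (sqnorm2 a b z)" by (simp add: Q w)
      thus ?thesis by (simp only: Re_divide_of_real) (simp add: field_simps)
    qed
    ultimately show ?thesis by simp
  qed
  have Tw: "of_real (T z) = (a z * deriv b z - deriv a z * b z) * cnj (a z * deriv b z - deriv a z * b z) / (w z * w z)" for z
    unfolding T_def of_real_divide complex_norm_square by (simp add: w power2_eq_square)
  define X where "X z = deriv (deriv a) z * cnj (a z) + deriv (deriv b) z * cnj (b z)" for z
  define Y where "Y z = deriv a z * cnj (deriv a z) + deriv b z * cnj (deriv b z)" for z
  have dn: "(n has_derivative (\<lambda>h. X z * h + Y z * cnj h)) (at z)" for z
    unfolding n_def X_def Y_def
    by (rule derivative_eq_intros da db da' db' refl)+ (simp add: fun_eq_iff algebra_simps)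
  have TY: "of_real (T z) = (Y z * w z - n z * cnj (n z)) / (w z * w z)" for z
    unfolding Tw by (simp add: Y_def w_def n_def algebra_simps)
  define Q' where "Q' z = (X z * w z - n z * n z) / (w z * w z)" for z
  have "(Q has_derivative (\<lambda>h. Q' z * h + of_real (T z) * cnj h)) (at z)" for z
  proof -
    have "((\<lambda>z. n z / w z) has_derivative
       (\<lambda>h. ((X z * h + Y z * cnj h) * w z - n z * (n z * h + cnj (n z * h))) / (w z * w z))) (at z)"
      by (intro has_derivative_divide' dn dw w0)
    moreover have "((X z * h + Y z * cnj h) * w z - n z * (n z * h + cnj (n z * h))) / (w z * w z)
        = Q' z * h + of_real (T z) * cnj h" for h
      unfolding TY Q'_def using w0[of z] by (simp add: field_simps)
    moreover have "Q = (\<lambda>z. n z / w z)" using Q by auto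
    ultimately show ?thesis by simp
  qed
  moreover have "continuous_on UNIV Q'"
    unfolding Q'_def X_def using cont cw cn w0 by (intro continuous_intros) auto
  ultimately show "\<exists>Q'. continuous_on UNIV Q' \<and> (\<forall>z. (Q has_derivative (\<lambda>h. Q' z * h + of_real (T z) * cnj h)) (at z))"
    by blast
  show "continuous_on UNIV T"
    unfolding T_def sqnorm2_def using cont pos[unfolded sqnorm2_def] by (intro continuous_intros) (auto simp: less_le)
qed

text \<open>In the logarithmic coordinate \<open>s + i t\<close>, circles around the origin become vertical segments of length \<open>2 \<pi>\<close>.
  The second \<open>s\<close>-derivative of the mean is the mean of the Laplacian, as the second \<open>t\<close>-derivative integrates to zero
  by periodicity. This replaces the divergence theorem on discs by differentiation under an integral in one variable.\<close>

lemma mean_ln_sqnorm2: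
  fixes a b :: "complex \<Rightarrow> complex"
  assumes a: "a holomorphic_on UNIV" and b: "b holomorphic_on UNIV"
    and pos: "\<And>z. 0 < sqnorm2 a b z"
    and per: "\<And>z. a (z + 2 * of_real pi * \<i>) = a z" "\<And>z. b (z + 2 * of_real pi * \<i>) = b z"
  defines "N \<equiv> \<lambda>s. integral {0..2 * pi} (\<lambda>t. ln (sqnorm2 a b (Complex s t)))"
  defines "T \<equiv> \<lambda>z. (cmod (a z * deriv b z - deriv a z * b z))\<^sup>2 / (sqnorm2 a b z)\<^sup>2"
  shows "\<exists>N'. (\<forall>s. (N has_real_derivative N' s) (at s)) \<and>
    (\<forall>s. (N' has_real_derivative 4 * integral {0..2 * pi} (\<lambda>t. T (Complex s t))) (at s))"
proof -
  define Q where "Q z = (deriv a z * cnj (a z) + deriv b z * cnj (b z)) / of_real (sqnorm2 a b z)" for z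
  have T_z: "T z = (cmod (a z * deriv b z - deriv a z * b z))\<^sup>2 / (sqnorm2 a b z)\<^sup>2" for z
    by (simp add: T_def)
  note D = ln_sqnorm2_derivatives[OF a b pos, folded Q_def T_z]
  obtain Q' where Q'c: "continuous_on UNIV Q'"
    and dQ: "\<And>z. (Q has_derivative (\<lambda>h. Q' z * h + of_real (T z) * cnj h)) (at z)"
    using D(2) by blast
  have Tc: "continuous_on UNIV T" by (rule D(3))
  have Qc: "continuous_on UNIV Q"
    using dQ by (intro continuous_at_imp_continuous_on ballI has_derivative_continuous)
  have Lc: "continuous_on UNIV (\<lambda>z. ln (sqnorm2 a b z))"
    using D(1) by (intro continuous_at_imp_continuous_on ballI has_derivative_continuous)
  have cC: "continuous_on S (\<lambda>t. Complex s t)" "continuous_on S' (\<lambda>x. Complex (fst x) (snd x))" for S S' and s :: real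
    unfolding Complex_eq by (intro continuous_intros)+
  have line: "continuous_on S (\<lambda>t. g (Complex s t))" if "continuous_on UNIV g" for g :: "complex \<Rightarrow> 'b::real_normed_vector" and S s
    by (rule continuous_on_compose2[OF that cC(1)]) simp
  have plane: "continuous_on S (\<lambda>(s, t). g (Complex s t))" if "continuous_on UNIV g" for g :: "complex \<Rightarrow> 'b::real_normed_vector" and S
    unfolding case_prod_beta by (rule continuous_on_compose2[OF that cC(2)]) simp
  define N' where "N' s = integral {0..2 * pi} (\<lambda>t. 2 * Re (Q (Complex s t)))" for s
  have reQc: "continuous_on UNIV (\<lambda>z. 2 * Re (Q z))" using Qc by (intro continuous_intros)
  define R where "R z = 2 * Re (Q' z + of_real (T z))" for z
  have Rc: "continuous_on UNIV R" unfolding R_def using Q'c Tc by (intro continuous_intros)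
  have "(N has_vector_derivative N' s) (at s within UNIV)" for s
    unfolding N_def N'_def interval_cbox
  proof (rule leibniz_rule_vector_derivative)
    show "((\<lambda>s. ln (sqnorm2 a b (Complex s t))) has_vector_derivative 2 * Re (Q (Complex s t))) (at s within UNIV)" for s t
      using has_derivative_along_real[OF D(1)] by simp
    show "(\<lambda>t. ln (sqnorm2 a b (Complex s t))) integrable_on cbox 0 (2 * pi)" for s
      by (intro integrable_continuous line[OF Lc])
    show "continuous_on (UNIV \<times> cbox 0 (2 * pi)) (\<lambda>(s, t). 2 * Re (Q (Complex s t)))"
      by (rule plane[OF reQc])
  qed auto
  moreover have "(N' has_vector_derivative integral {0..2 * pi} (\<lambda>t. R (Complex s t))) (at s within UNIV)" for s
    unfolding N'_def interval_cbox
  proof (rule leibniz_rule_vector_derivative)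
    show "((\<lambda>s. 2 * Re (Q (Complex s t))) has_vector_derivative R (Complex s t)) (at s within UNIV)" for s t
    proof -
      have "((\<lambda>z. 2 * Re (Q z)) has_derivative (\<lambda>h. 2 * Re (Q' z * h + of_real (T z) * cnj h))) (at z)" for z
        by (intro has_derivative_mult_right has_derivative_Re dQ)
      from has_derivative_along_real[OF this] show ?thesis by (simp add: R_def)
    qed
    show "(\<lambda>t. 2 * Re (Q (Complex s t))) integrable_on cbox 0 (2 * pi)" for s
      by (intro integrable_continuous line[OF reQc])
    show "continuous_on (UNIV \<times> cbox 0 (2 * pi)) (\<lambda>(s, t). R (Complex s t))"
      by (rule plane[OF Rc])
  qed auto
  moreover have "integral {0..2 * pi} (\<lambda>t. R (Complex s t)) = 4 * integral {0..2 * pi} (\<lambda>t. T (Complex s t))" for s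
  proof -
    \<comment> \<open>Up to the factor \<open>- 2\<close>, \<open>K\<close> is the \<open>t\<close>-derivative of the logarithm; it is periodic, so its derivative has integral zero.\<close>
    define K where "K t = Im (Q (Complex s t))" for t
    have "(K has_vector_derivative Re (Q' (Complex s t)) - T (Complex s t)) (at t)" for t
    proof -
      have "((\<lambda>z. Im (Q z)) has_derivative (\<lambda>h. Im (Q' z * h + of_real (T z) * cnj h))) (at z)" for z
        by (intro has_derivative_Im dQ)
      from has_derivative_along_imaginary[OF this] show ?thesis by (simp add: K_def[abs_def])
    qed
    hence "((\<lambda>t. Re (Q' (Complex s t)) - T (Complex s t)) has_integral (K (2 * pi) - K 0)) {0..2 * pi}"
      by (intro fundamental_theorem_of_calculus) (auto intro: has_vector_derivative_at_within)
    moreover have "K (2 * pi) = K 0"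
    proof -
      have shift: "Complex s (2 * pi) = Complex s 0 + 2 * of_real pi * \<i>" by (simp add: complex_eq_iff)
      have dper: "deriv g (z + 2 * of_real pi * \<i>) = deriv g z" 
        if "\<And>z. g (z + 2 * of_real pi * \<i>) = g z" "g holomorphic_on UNIV" for g z
      proof -
        have "((\<lambda>z. g (z + 2 * of_real pi * \<i>)) has_field_derivative deriv g (z + 2 * of_real pi * \<i>)) (at z)"
          unfolding DERIV_shift[symmetric] by (rule holomorphic_derivI[OF that(2) open_UNIV UNIV_I])
        thus ?thesis unfolding that(1) by (metis DERIV_imp_deriv)
      qed
      show ?thesis unfolding K_def Q_def shift sqnorm2_def
        by (simp add: per dper[OF per(1) a] dper[OF per(2) b])
    qed
    ultimately have z: "integral {0..2 * pi} (\<lambda>t. Re (Q' (Complex s t)) - T (Complex s t)) = 0"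
      by (simp add: integral_unique)
    have "integral {0..2 * pi} (\<lambda>t. R (Complex s t))
        = integral {0..2 * pi} (\<lambda>t. 2 * (Re (Q' (Complex s t)) - T (Complex s t)) + 4 * T (Complex s t))"
      by (simp add: R_def algebra_simps)
    also have "\<dots> = 2 * integral {0..2 * pi} (\<lambda>t. Re (Q' (Complex s t)) - T (Complex s t))
        + 4 * integral {0..2 * pi} (\<lambda>t. T (Complex s t))"
      by (subst Henstock_Kurzweil_Integration.integral_add)
        (auto simp only: Henstock_Kurzweil_Integration.integral_mult_right
          intro!: integrable_continuous_real continuous_intros line[OF Tc] line[OF Q'c])
    finally show ?thesis by (simp add: z)
  qed
  ultimately show ?thesis
    by (intro exI[of _ N']) (auto simp: has_real_derivative_iff_has_vector_derivative)
qed

section \<open>Pairs of oscillator solutions bounded away from zero\<close>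

text \<open>Equivalently, \<open>q / p\<close> is a locally univalent meromorphic function with bounded spherical derivative; \<open>f\<close> is half
  its Schwarzian derivative.\<close>

locale bounded_below_pair =
  fixes p q f :: "complex \<Rightarrow> complex" and d :: real
  assumes p: "p holomorphic_on UNIV" and q: "q holomorphic_on UNIV"
    and ode_p: "\<And>z. deriv (deriv p) z = - f z * p z"
    and ode_q: "\<And>z. deriv (deriv q) z = - f z * q z"
    and wronsk: "\<And>z. p z * deriv q z - deriv p z * q z = 1"
    and d_pos: "0 < d" and lower: "\<And>z. d \<le> sqnorm2 p q z"
begin

text \<open>Half of \<open>ln (|p|\<^sup>2 + |q|\<^sup>2)\<close>, shifted so that it has a positive lower bound: the shift is exactly what the lower bound
  \<open>d / 2\<close> for the dominant function in \<open>local_estimates\<close> requires.\<close>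

definition height :: "complex \<Rightarrow> real" where
  "height z = ln (2 * sqnorm2 p q z / d) / 2"

lemma height_lower_bound: "ln 2 / 2 \<le> height z"
proof -
  have "2 \<le> 2 * sqnorm2 p q z / d" using lower[of z] d_pos by (simp add: le_divide_eq)
  thus ?thesis unfolding height_def by simp
qed

text \<open>The special unitary group acts on the pairs of solutions and preserves the Wronskian and the norm; it can move
  any given value of the pair to a multiple of the first unit vector.\<close>

lemma rotated_pair:
  obtains p1 q1 where "p1 holomorphic_on UNIV" "q1 holomorphic_on UNIV"
    "\<And>z. p1 z * deriv q1 z - deriv p1 z * q1 z = 1"
    "\<And>z. sqnorm2 p1 q1 z = sqnorm2 p q z" "q1 z0 = 0"
    "\<And>z. deriv (deriv p1) z = - f z * p1 z"
proof -
  define n where "n = sqrt (sqnorm2 p q z0)"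
  have npos: "0 < n" using lower[of z0] d_pos by (simp add: n_def)
  have n2: "n\<^sup>2 = (cmod (p z0))\<^sup>2 + (cmod (q z0))\<^sup>2" using lower[of z0] d_pos by (simp add: n_def sqnorm2_def)
  define a b where "a = p z0 / of_real n" and "b = q z0 / of_real n"
  have "(cmod a)\<^sup>2 + (cmod b)\<^sup>2 = ((cmod (p z0))\<^sup>2 + (cmod (q z0))\<^sup>2) / n\<^sup>2"
    by (simp add: a_def b_def norm_divide power_divide add_divide_distrib)
  also have "\<dots> = 1" using npos by (simp flip: n2)
  finally have "(cmod a)\<^sup>2 + (cmod b)\<^sup>2 = 1" .
  hence "complex_of_real ((cmod a)\<^sup>2 + (cmod b)\<^sup>2) = 1" by (simp only: of_real_1)
  hence ab: "a * cnj a + b * cnj b = 1" by (simp only: of_real_add complex_norm_square)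
  define p1 q1 where "p1 = (\<lambda>z. cnj a * p z + cnj b * q z)" and "q1 = (\<lambda>z. a * q z - b * p z)"
  have dp: "(p has_field_derivative deriv p z) (at z)" and dq: "(q has_field_derivative deriv q z) (at z)"
    and dp': "(deriv p has_field_derivative deriv (deriv p) z) (at z)"
    and dq': "(deriv q has_field_derivative deriv (deriv q) z) (at z)" for z
    using p q by (auto intro!: holomorphic_derivI[OF _ open_UNIV] holomorphic_deriv[OF _ open_UNIV])
  have d1: "deriv p1 = (\<lambda>z. cnj a * deriv p z + cnj b * deriv q z)"
    unfolding p1_def by (rule ext, rule DERIV_imp_deriv) (auto intro!: derivative_eq_intros dp dq)
  have d2: "deriv q1 = (\<lambda>z. a * deriv q z - b * deriv p z)"
    unfolding q1_def by (rule ext, rule DERIV_imp_deriv) (auto intro!: derivative_eq_intros dp dq)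
  have d3: "deriv (deriv p1) z = cnj a * deriv (deriv p) z + cnj b * deriv (deriv q) z" for z
    unfolding d1 by (rule DERIV_imp_deriv) (auto intro!: derivative_eq_intros dp' dq')
  show ?thesis
  proof (rule that[of p1 q1])
    show "p1 holomorphic_on UNIV" "q1 holomorphic_on UNIV"
      unfolding p1_def q1_def using p q by (intro holomorphic_intros; simp)+
    show "p1 z * deriv q1 z - deriv p1 z * q1 z = 1" for z
    proof -
      have "p1 z * deriv q1 z - deriv p1 z * q1 z
         = (a * cnj a + b * cnj b) * (p z * deriv q z - deriv p z * q z)"
        unfolding d1 d2 by (simp add: p1_def q1_def algebra_simps)
      thus ?thesis by (simp add: ab wronsk)
    qed
    show "sqnorm2 p1 q1 z = sqnorm2 p q z" for z
    proof -
      have "complex_of_real (sqnorm2 p1 q1 z) = (a * cnj a + b * cnj b) * of_real (sqnorm2 p q z)"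
        unfolding sqnorm2_def of_real_add complex_norm_square
        by (simp add: p1_def q1_def algebra_simps)
      thus ?thesis by (simp add: ab)
    qed
    show "q1 z0 = 0" by (simp add: q1_def a_def b_def)
    show "deriv (deriv p1) z = - f z * p1 z" for z
      unfolding d3 by (simp add: ode_p ode_q p1_def algebra_simps)
  qed
qed

text \<open>After a rotation at \<open>z0\<close> the first function \<open>p1\<close> dominates on the disc \<open>B\<close> and has a logarithm \<open>L\<close> there.
  The real part of \<open>L\<close> is bounded below on \<open>B\<close>, does not exceed the height up to the constant \<open>c\<close>, and agrees with it at
  \<open>z0\<close>. Thus the bound on \<open>L - L z0\<close> gives the first claim, and Cauchy's inequalities for it give the second, because
  \<open>f = - (L'' + L'\<^sup>2)\<close>.\<close>

lemma local_estimates: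
  shows Harnack: "dist z0 y \<le> d / 10 \<Longrightarrow> height z0 / 2 \<le> height y"
    and coefficient_bound: "cmod (f z0) \<le> (height z0 + (height z0)\<^sup>2) / (d / 10)\<^sup>2"
proof -
  obtain p1 q1 where hol: "p1 holomorphic_on UNIV" "q1 holomorphic_on UNIV"
    and w1: "\<And>z. p1 z * deriv q1 z - deriv p1 z * q1 z = 1"
    and sq: "\<And>z. sqnorm2 p1 q1 z = sqnorm2 p q z" and z0: "q1 z0 = 0"
    and ode: "\<And>z. deriv (deriv p1) z = - f z * p1 z"
    using rotated_pair by blast
  define B where "B = ball z0 (d / 2)"
  have lt: "cmod (q1 z) < cmod (p1 z)" if "z \<in> B" for z
    using wronskian_unit_ratio_less_one[OF hol w1 d_pos, of z0 z] lower z0 that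
    by (simp add: sq B_def dist_commute)
  have "p1 z \<noteq> 0" if "z \<in> B" for z using lt[OF that] by fastforce
  then obtain L where L: "L holomorphic_on B" and expL: "\<And>z. z \<in> B \<Longrightarrow> p1 z = exp (L z)"
    using contractible_imp_holomorphic_log[of p1 B] hol(1) convex_imp_contractible[of B]
    by (metis B_def convex_ball holomorphic_on_subset subset_UNIV)
  have ReL: "Re (L z) = ln ((cmod (p1 z))\<^sup>2) / 2" if "z \<in> B" for z
    using that by (simp add: expL ln_realpow)
  define c where "c = - ln (d / 2) / 2"
  have height_alt: "height z = (ln (sqnorm2 p q z)) / 2 + c" for z
    using lower[of z] d_pos by (simp add: height_def c_def ln_div ln_mult field_simps)
  have ReL_lower: "- c < Re (L z)" if "z \<in> B" for z
  proof -
    have "(cmod (q1 z))\<^sup>2 < (cmod (p1 z))\<^sup>2" using lt[OF that] by (simp add: power_strict_mono)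
    hence "d / 2 < (cmod (p1 z))\<^sup>2" using lower[of z] unfolding sq[symmetric] by (simp add: sqnorm2_def)
    hence "ln (d / 2) < ln ((cmod (p1 z))\<^sup>2)" using d_pos by (subst ln_less_cancel_iff) auto
    thus ?thesis using ReL[OF that] by (simp add: c_def)
  qed
  have ReL_upper: "Re (L z) + c \<le> height z" if "z \<in> B" for z
  proof -
    have "cmod (p1 z) > 0" using lt[OF that] by (smt (verit) norm_ge_zero)
    hence "ln ((cmod (p1 z))\<^sup>2) \<le> ln (sqnorm2 p1 q1 z)" 
      by (subst ln_le_cancel_iff) (auto simp: sqnorm2_def add_pos_nonneg)
    thus ?thesis by (simp add: ReL[OF that] height_alt sq)
  qed
  have z0B: "z0 \<in> B" using d_pos by (simp add: B_def)
  have H0: "height z0 = Re (L z0) + c"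
    by (simp add: ReL[OF z0B] height_alt sq[symmetric]) (simp add: sqnorm2_def z0)
  have osc: "cmod (L z - L z0) \<le> height z0 / 2" if "dist z0 z \<le> d / 10" for z
    using holomorphic_Re_lower_bound_imp_near_center[of L z0 "d / 2" c z] L ReL_lower that d_pos
    by (simp add: H0 B_def)
  have inB: "z \<in> B" if "dist z0 z \<le> d / 10" for z using that d_pos by (simp add: B_def)
  show "height z0 / 2 \<le> height y" if "dist z0 y \<le> d / 10"
  proof -
    have "Re (L z0) - Re (L y) \<le> height z0 / 2"
      using osc[OF that] complex_Re_le_cmod[of "L z0 - L y"] by (simp add: norm_minus_commute)
    thus ?thesis using ReL_upper[OF inB[OF that]] H0 by linarith
  qed
  define r where "r = d / 10"
  have rpos: "0 < r" using d_pos by (simp add: r_def)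
  define M where "M z = L z - L z0" for z
  have Lcont: "continuous_on B L" using L holomorphic_on_imp_continuous_on by blast
  have Mhol: "M holomorphic_on B" unfolding M_def using L by (intro holomorphic_intros)
  have Cauchy: "cmod ((deriv ^^ n) M z0) \<le> fact n * (height z0 / 2) / r ^ n" for n
  proof (rule Cauchy_inequality)
    show "M holomorphic_on ball z0 r"
      by (rule holomorphic_on_subset[OF Mhol]) (use inB r_def in force)
    show "continuous_on (cball z0 r) M" unfolding M_def
      using inB r_def by (intro continuous_intros continuous_on_subset[OF Lcont]) (force simp: dist_commute)
    show "0 < r" by fact
    show "\<And>x. cmod (z0 - x) = r \<Longrightarrow> cmod (M x) \<le> height z0 / 2"
      unfolding M_def using osc by (simp add: dist_norm r_def)
  qed
  have opB: "open B" by (simp add: B_def)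
  have Mder: "(M has_field_derivative deriv M z) (at z)" "(deriv M has_field_derivative deriv (deriv M) z) (at z)" if "z \<in> B" for z
    using that Mhol opB by (auto intro!: holomorphic_derivI holomorphic_deriv)
  have p1M: "p1 z = p1 z0 * exp (M z)" if "z \<in> B" for z
    using that z0B by (simp add: expL M_def exp_diff)
  have d1: "deriv p1 z = p1 z0 * (exp (M z) * deriv M z)" if "z \<in> B" for z
  proof -
    have "((\<lambda>z. p1 z0 * exp (M z)) has_field_derivative p1 z0 * (exp (M z) * deriv M z)) (at z)"
      by (auto intro!: derivative_eq_intros Mder that)
    hence "(p1 has_field_derivative p1 z0 * (exp (M z) * deriv M z)) (at z)"
      by (rule has_field_derivative_transform_within_open[OF _ opB that]) (simp add: p1M[symmetric])
    thus ?thesis by (rule DERIV_imp_deriv)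
  qed
  have "((\<lambda>z. p1 z0 * (exp (M z) * deriv M z)) has_field_derivative
      p1 z0 * (exp (M z0) * deriv M z0 * deriv M z0 + exp (M z0) * deriv (deriv M) z0)) (at z0)"
    by (auto intro!: derivative_eq_intros Mder z0B)
  hence "(deriv p1 has_field_derivative
      p1 z0 * (exp (M z0) * deriv M z0 * deriv M z0 + exp (M z0) * deriv (deriv M) z0)) (at z0)"
    by (rule has_field_derivative_transform_within_open[OF _ opB z0B]) (simp add: d1)
  hence "deriv (deriv p1) z0 = p1 z0 * ((deriv M z0)\<^sup>2 + deriv (deriv M) z0)"
    by (auto dest!: DERIV_imp_deriv simp: M_def power2_eq_square)
  hence "p1 z0 * ((deriv M z0)\<^sup>2 + deriv (deriv M) z0) - (- f z0 * p1 z0) = 0"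
    using ode[of z0] by (simp only: diff_self)
  hence "p1 z0 * (f z0 + ((deriv M z0)\<^sup>2 + deriv (deriv M) z0)) = 0"
    by (simp add: algebra_simps)
  moreover have "p1 z0 \<noteq> 0" using lt[OF z0B] by auto
  ultimately have "f z0 = - ((deriv M z0)\<^sup>2 + deriv (deriv M) z0)"
    by (simp only: mult_eq_0_iff add_eq_0_iff2 simp_thms)
  hence "cmod (f z0) \<le> (cmod (deriv M z0))\<^sup>2 + cmod (deriv (deriv M) z0)"
    using norm_triangle_ineq[of "(deriv M z0)\<^sup>2" "deriv (deriv M) z0"] 
    by (simp only: norm_minus_cancel norm_power)
  also have "\<dots> \<le> ((height z0 / 2) / r)\<^sup>2 + 2 * (height z0 / 2) / r\<^sup>2"
    using Cauchy[of 1] Cauchy[of 2] by (intro add_mono power_mono) (simp_all add: eval_nat_numeral)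
  also have "\<dots> \<le> (height z0 + (height z0)\<^sup>2) / r\<^sup>2"
    using rpos by (simp add: power_divide field_simps)
  finally show "cmod (f z0) \<le> (height z0 + (height z0)\<^sup>2) / (d / 10)\<^sup>2" unfolding r_def .
qed

end

text \<open>Used for circle means as functions of \<open>s = ln r\<close>: with \<open>c = 2\<close> it gives quadratic growth in \<open>r\<close>, with \<open>c = - 1\<close>
  logarithmic growth.\<close>

lemma second_derivative_exp_bound_imp_growth:
  fixes N N' N'' :: "real \<Rightarrow> real"
  assumes d1: "\<And>s. (N has_real_derivative N' s) (at s)"
    and d2: "\<And>s. (N' has_real_derivative N'' s) (at s)"
    and bound: "\<And>s. s0 \<le> s \<Longrightarrow> N'' s \<le> K * exp (c * s)" and "c \<noteq> 0"
  shows "\<exists>A B. \<forall>s\<ge>s0. N s \<le> A + B * s + K / c\<^sup>2 * exp (c * s)"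
proof -
  define B where "B = N' s0 - K / c * exp (c * s0)"
  define A where "A = N s0 - B * s0 - K / c\<^sup>2 * exp (c * s0)"
  have N': "N' s - K / c * exp (c * s) \<le> B" if "s0 \<le> s" for s
    unfolding B_def
  proof (rule DERIV_nonpos_imp_nonincreasing[OF that])
    fix x assume "s0 \<le> x"
    have "((\<lambda>s. N' s - K / c * exp (c * s)) has_real_derivative N'' x - K * exp (c * x)) (at x)"
      by (rule derivative_eq_intros d2 refl)+ (use \<open>c \<noteq> 0\<close> in simp)
    thus "\<exists>y. ((\<lambda>s. N' s - K / c * exp (c * s)) has_real_derivative y) (at x) \<and> y \<le> 0"
      using bound[OF \<open>s0 \<le> x\<close>] by auto
  qed
  have "N s - B * s - K / c\<^sup>2 * exp (c * s) \<le> A" if "s0 \<le> s" for s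
    unfolding A_def
  proof (rule DERIV_nonpos_imp_nonincreasing[OF that])
    fix x assume "s0 \<le> x"
    have "((\<lambda>s. N s - B * s - K / c\<^sup>2 * exp (c * s)) has_real_derivative N' x - B - K / c * exp (c * x)) (at x)"
      by (rule derivative_eq_intros d1 refl)+ (use \<open>c \<noteq> 0\<close> in \<open>simp add: power2_eq_square\<close>)
    thus "\<exists>y. ((\<lambda>s. N s - B * s - K / c\<^sup>2 * exp (c * s)) has_real_derivative y) (at x) \<and> y \<le> 0"
      using N'[OF \<open>s0 \<le> x\<close>] by auto
  qed
  thus ?thesis by (intro exI[of _ A] exI[of _ B]) (auto simp: algebra_simps)
qed

lemma linear_less_exp_half:
  fixes B c :: real
  assumes "0 < c"
  shows "\<exists>s0\<ge>0. \<forall>s\<ge>s0. B * (1 + s) < c * exp (s / 2)"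
proof -
  define D where "D = 8 * (\<bar>B\<bar> + 1) / c"
  have Dpos: "0 < D" using assms by (simp add: D_def)
  show ?thesis
  proof (intro exI[of _ "max 1 (4 * ln D)"] conjI allI impI)
    fix s :: real assume s: "max 1 (4 * ln D) \<le> s"
    have "D \<le> exp (s / 4)" using s Dpos exp_le_cancel_iff[of "ln D" "s / 4"] by simp
    moreover have "s / 4 \<le> exp (s / 4)" using exp_ge_add_one_self[of "s / 4"] by linarith
    ultimately have "D * (s / 4) \<le> exp (s / 4) * exp (s / 4)" using s Dpos by (intro mult_mono) auto
    also have "\<dots> = exp (s / 2)" by (simp flip: exp_add)
    finally have "c * (D * (s / 4)) \<le> c * exp (s / 2)" using assms by simp
    moreover have "c * (D * (s / 4)) = (\<bar>B\<bar> + 1) * (2 * s)" using assms by (simp add: D_def)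
    moreover have "B * (1 + s) \<le> \<bar>B\<bar> * (2 * s)"
      using s by (intro mult_mono) auto
    moreover have "(\<bar>B\<bar> + 1) * (2 * s) = \<bar>B\<bar> * (2 * s) + 2 * s" by (simp add: algebra_simps)
    ultimately show "B * (1 + s) < c * exp (s / 2)" using s by linarith
  qed auto
qed

text \<open>Split off one factor \<open>z\<close>: the quotient of the non-constant part by \<open>z\<close> is a polynomial that either tends to infinity or is
  a non-zero constant.\<close>

lemma nonconstant_polynomial_linear_lower_bound:
  fixes c :: "nat \<Rightarrow> complex"
  assumes "k \<noteq> 0" "k \<le> n" "c k \<noteq> 0"
  shows "\<exists>e>0. \<exists>R. \<forall>z. R \<le> cmod z \<longrightarrow> e * cmod z \<le> cmod (\<Sum>i\<le>n. c i * z ^ i)"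
proof -
  obtain m where n: "n = Suc m" using assms by (cases n) auto
  define g where "g z = (\<Sum>i\<le>m. c (Suc i) * z ^ i)" for z
  have f: "(\<Sum>i\<le>n. c i * z ^ i) = c 0 + z * g z" for z
    unfolding n g_def sum.atMost_Suc_shift by (simp add: sum_distrib_left mult_ac)
  have "\<exists>e>0. \<exists>b. \<forall>z. b \<le> cmod z \<longrightarrow> e \<le> cmod (g z)"
  proof (cases "\<exists>i. i \<noteq> 0 \<and> i \<le> m \<and> c (Suc i) \<noteq> 0")
    case True
    from polyfun_extremal[OF this, of 1] obtain b where "\<And>z. b \<le> cmod z \<Longrightarrow> 1 \<le> cmod (g z)"
      by (auto simp: eventually_at_infinity g_def)
    thus ?thesis by (intro exI[of _ 1]) auto
  next
    case False
    hence "k = 1" using assms n by (cases k) auto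
    have "g z = (\<Sum>i\<in>{0}. c (Suc i) * z ^ i)" for z
      unfolding g_def by (rule sum.mono_neutral_right) (use False in auto)
    thus ?thesis using assms \<open>k = 1\<close> by (intro exI[of _ "cmod (c 1)"]) auto
  qed
  then obtain e b where e: "0 < e" and b: "\<And>z. b \<le> cmod z \<Longrightarrow> e \<le> cmod (g z)" by blast
  show ?thesis
  proof (rule exI[of _ "e / 2"], intro conjI exI[of _ "max b (2 * cmod (c 0) / e)"] allI impI)
    fix z :: complex assume z: "max b (2 * cmod (c 0) / e) \<le> cmod z"
    have "cmod z * e \<le> cmod z * cmod (g z)" using b[of z] z by (intro mult_left_mono) auto
    also have "\<dots> \<le> cmod (c 0 + z * g z) + cmod (c 0)"
      by (metis norm_mult add.commute add_diff_cancel_left' norm_triangle_ineq4)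
    finally have 1: "cmod z * e \<le> cmod (c 0 + z * g z) + cmod (c 0)" .
    have "2 * cmod (c 0) \<le> cmod z * e" using z e by (simp add: divide_le_eq)
    with 1 show "e / 2 * cmod z \<le> cmod (\<Sum>i\<le>n. c i * z ^ i)"
      unfolding f by (simp add: algebra_simps)
  qed (use e in simp)
qed

context bounded_below_pair
begin

definition circle_integral :: "real \<Rightarrow> real" where
  "circle_integral s = integral {0..2 * pi} (\<lambda>t. ln (sqnorm2 p q (exp (Complex s t))))"

lemma height_nonneg: "0 \<le> height z"
  using height_lower_bound[of z] ln2_ge_two_thirds by linarith

lemma sqnorm2_eq: "sqnorm2 p q z = d / 2 * exp (2 * height z)"
  using lower[of z] d_pos by (simp add: height_def)

lemma cmod_exp_Complex: "cmod (exp (Complex s t)) = exp s"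
  by simp

lemma continuous_on_sqnorm2_circle: "continuous_on S (\<lambda>t. sqnorm2 p q (exp (Complex s t)))"
proof -
  have "continuous_on UNIV (sqnorm2 p q)"
    unfolding sqnorm2_def[abs_def] using p q
    by (intro continuous_on_add continuous_on_power continuous_on_norm holomorphic_on_imp_continuous_on)
  moreover have "continuous_on S (\<lambda>t. exp (Complex s t))"
    unfolding Complex_eq by (intro continuous_intros)
  ultimately show ?thesis by (rule continuous_on_compose2) simp
qed

text \<open>\<open>N''\<close> is \<open>4 exp (2 * s)\<close> times the integral of \<open>1 / (|p|\<^sup>2 + |q|\<^sup>2)\<^sup>2\<close> over the circle, and
  \<open>|p|\<^sup>2 + |q|\<^sup>2 = d / 2 * exp (2 * height)\<close>. The bound with a free \<open>M\<close> serves twice: with \<open>M = 0\<close> for the crude growth,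
  and with \<open>M\<close> proportional to \<open>s\<close> when the height is known to be large.\<close>

lemma circle_integral_derivatives:
  obtains N' N'' where "\<And>s. (circle_integral has_real_derivative N' s) (at s)"
    "\<And>s. (N' has_real_derivative N'' s) (at s)"
    "\<And>s M. (\<And>z. cmod z = exp s \<Longrightarrow> M \<le> height z) \<Longrightarrow> N'' s \<le> 32 * pi / d\<^sup>2 * exp (2 * s - 4 * M)"
proof -
  define a b where "a z = p (exp z)" and "b z = q (exp z)" for z
  have hol: "a holomorphic_on UNIV" "b holomorphic_on UNIV"
    using holomorphic_on_compose_gen[OF holomorphic_on_exp p subset_UNIV]
      holomorphic_on_compose_gen[OF holomorphic_on_exp q subset_UNIV]
    by (simp_all add: a_def[abs_def] b_def[abs_def] o_def)
  have sq: "sqnorm2 a b z = sqnorm2 p q (exp z)" for z by (simp add: sqnorm2_def a_def b_def)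
  have pos: "0 < sqnorm2 a b z" for z using lower[of "exp z"] d_pos by (simp add: sq)
  define T where "T z = (cmod (a z * deriv b z - deriv a z * b z))\<^sup>2 / (sqnorm2 a b z)\<^sup>2" for z
  have per: "a (z + 2 * of_real pi * \<i>) = a z" "b (z + 2 * of_real pi * \<i>) = b z" for z
    by (simp_all add: a_def b_def exp_add)
  have ci: "circle_integral = (\<lambda>s. integral {0..2 * pi} (\<lambda>t. ln (sqnorm2 a b (Complex s t))))"
    by (simp add: fun_eq_iff circle_integral_def sq)
  obtain N' where N: "\<And>s. (circle_integral has_real_derivative N' s) (at s)"
      "\<And>s. (N' has_real_derivative 4 * integral {0..2 * pi} (\<lambda>t. T (Complex s t))) (at s)"
    using mean_ln_sqnorm2[of a b, OF hol pos per] unfolding ci T_def by blast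
  have da: "deriv a z = exp z * deriv p (exp z)" "deriv b z = exp z * deriv q (exp z)" for z
    using DERIV_imp_deriv[OF DERIV_chain2[OF holomorphic_derivI[OF p open_UNIV UNIV_I] DERIV_exp[of z]]]
      DERIV_imp_deriv[OF DERIV_chain2[OF holomorphic_derivI[OF q open_UNIV UNIV_I] DERIV_exp[of z]]]
    by (simp_all add: a_def[abs_def] b_def[abs_def])
  have Tz: "T z = (cmod (exp z))\<^sup>2 / (sqnorm2 p q (exp z))\<^sup>2" for z
  proof -
    have "a z * deriv b z - deriv a z * b z = exp z * (p (exp z) * deriv q (exp z) - deriv p (exp z) * q (exp z))"
      by (simp add: da a_def b_def algebra_simps)
    thus ?thesis by (simp add: T_def sq wronsk)
  qed
  have "4 * integral {0..2 * pi} (\<lambda>t. T (Complex s t)) \<le> 32 * pi / d\<^sup>2 * exp (2 * s - 4 * M)"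
    if M: "\<And>z. cmod z = exp s \<Longrightarrow> M \<le> height z" for s M
  proof -
    have "T (Complex s t) \<le> 4 / d\<^sup>2 * exp (2 * s - 4 * M)" for t
    proof -
      have "d / 2 * exp (2 * M) \<le> sqnorm2 p q (exp (Complex s t))"
        unfolding sqnorm2_eq using M[of "exp (Complex s t)"] d_pos by simp
      hence "T (Complex s t) \<le> (exp s)\<^sup>2 / (d / 2 * exp (2 * M))\<^sup>2"
        unfolding Tz cmod_exp_Complex using d_pos 
        by (intro frac_le power_mono zero_less_power) simp_all
      also have "\<dots> = 4 / d\<^sup>2 * exp (2 * s - 4 * M)"
        by (simp add: power_mult_distrib power_divide exp_diff flip: exp_double)
      finally show ?thesis .
    qed
    moreover have "continuous_on {0..2 * pi} (\<lambda>t. T (Complex s t))"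
    proof -
      have "sqnorm2 p q z \<noteq> 0" for z using lower[of z] d_pos by auto
      thus ?thesis unfolding Tz cmod_exp_Complex
        by (intro continuous_on_divide continuous_on_power continuous_on_const continuous_on_sqnorm2_circle) auto
    qed
    ultimately have "integral {0..2 * pi} (\<lambda>t. T (Complex s t)) \<le> integral {0..2 * pi} (\<lambda>t. 4 / d\<^sup>2 * exp (2 * s - 4 * M))"
      by (intro integral_le integrable_continuous_real continuous_intros) auto
    thus ?thesis by simp
  qed
  thus ?thesis using that[OF N] by blast
qed

lemma circle_integral_height:
  shows "((\<lambda>t. height (exp (Complex s t))) has_integral (circle_integral s - 2 * pi * ln (d / 2)) / 2) {0..2 * pi}"
    and "continuous_on S (\<lambda>t. height (exp (Complex s t)))"
proof -
  have pos: "0 < sqnorm2 p q z" for z using lower[of z] d_pos by simp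
  hence cl: "continuous_on S (\<lambda>t. ln (sqnorm2 p q (exp (Complex s t))))" for S
    by (intro continuous_on_ln continuous_on_sqnorm2_circle) (auto simp: less_le)
  have eq: "height z = (ln (sqnorm2 p q z) - ln (d / 2)) / 2" for z
    using pos[of z] d_pos by (simp add: height_def ln_div ln_mult)
  show "continuous_on S (\<lambda>t. height (exp (Complex s t)))" unfolding eq by (intro continuous_on_divide continuous_on_diff cl continuous_on_const) auto
  have "((\<lambda>t. ln (sqnorm2 p q (exp (Complex s t)))) has_integral circle_integral s) {0..2 * pi}"
    unfolding circle_integral_def by (intro integrable_integral integrable_continuous_real cl)
  moreover have "((\<lambda>t. ln (d / 2)) has_integral (2 * pi - 0) *\<^sub>R ln (d / 2)) {0..2 * pi}"
    using has_integral_const_real[of "ln (d / 2)" 0 "2 * pi"] by simp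
  ultimately have "((\<lambda>t. (ln (sqnorm2 p q (exp (Complex s t))) - ln (d / 2)) / 2) has_integral 
      (circle_integral s - (2 * pi - 0) *\<^sub>R ln (d / 2)) / 2) {0..2 * pi}"
    by (intro has_integral_divide has_integral_diff)
  thus "((\<lambda>t. height (exp (Complex s t))) has_integral (circle_integral s - 2 * pi * ln (d / 2)) / 2) {0..2 * pi}"
    unfolding eq by simp
qed

text \<open>The height is non-negative, and by the Harnack estimate it is at least \<open>height y / 2\<close> on an arc around \<open>y\<close> whose angle is of
  order \<open>exp (- s)\<close>; so the circle mean controls it up to a factor of order \<open>exp s\<close>.\<close>

lemma height_le_circle_integral:
  assumes "0 \<le> s" "cmod y = exp s"
  shows "height y \<le> (1 + 20 / d) * exp s * (circle_integral s - 2 * pi * ln (d / 2))"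
proof -
  define r where "r = d / 10"
  have rpos: "0 < r" using d_pos by (simp add: r_def)
  define I where "I = (circle_integral s - 2 * pi * ln (d / 2)) / 2"
  have int: "((\<lambda>t. height (exp (Complex s t))) has_integral I) {0..2 * pi}"
    unfolding I_def by (rule circle_integral_height)
  note Hp = height_nonneg
  define t0 where "t0 = Arg2pi y"
  have t0: "0 \<le> t0" "t0 < 2 * pi" using Arg2pi[of y] by (auto simp: t0_def)
  have y: "y = exp (Complex s t0)"
    using Arg2pi_eq[of y] assms(2)
    by (simp add: t0_def Complex_eq exp_add flip: exp_of_real)
  define e where "e = min (r * exp (- s)) pi"
  have epos: "0 < e" using rpos by (simp add: e_def)
  have near: "height y / 2 \<le> height (exp (Complex s t))" if "\<bar>t - t0\<bar> \<le> e" for t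
  proof (rule Harnack)
    have "exp (Complex s t0) - exp (Complex s t) = exp (of_real s) * (exp (\<i> * of_real t0) - exp (\<i> * of_real t))"
      by (simp add: Complex_eq exp_add algebra_simps)
    hence "dist y (exp (Complex s t)) = exp s * cmod (exp (\<i> * of_real t0) - exp (\<i> * of_real t))"
      unfolding y dist_norm by (simp add: norm_mult)
    also have "cmod (exp (\<i> * of_real t0) - exp (\<i> * of_real t)) \<le> \<bar>t0 - t\<bar>"
    proof -
      have "exp (\<i> * of_real t0) - exp (\<i> * of_real t) = exp (\<i> * of_real t) * (exp (\<i> * of_real (t0 - t)) - 1)"
        by (simp add: algebra_simps flip: exp_add)
      hence "cmod (exp (\<i> * of_real t0) - exp (\<i> * of_real t)) = cmod (exp (\<i> * of_real (t0 - t)) - 1)"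
        by (simp only: norm_mult norm_exp_i_times mult_1)
      also have "\<dots> \<le> \<bar>t0 - t\<bar>"
        using abs_sin_x_le_abs_x[of "(t0 - t) / 2"] by (simp add: dist_exp_i_1 del: of_real_diff)
      finally show ?thesis .
    qed
    also have "exp s * \<bar>t0 - t\<bar> \<le> exp s * (r * exp (- s))"
      using that by (intro mult_left_mono) (auto simp: e_def)
    also have "\<dots> = d / 10" by (simp add: r_def exp_minus)
    finally show "dist y (exp (Complex s t)) \<le> d / 10" by simp
  qed
  \<comment> \<open>The arc on one side of \<open>y\<close> suffices; the side is chosen so that it stays inside the parameter interval.\<close>
  obtain l where l: "0 \<le> l" "l + e \<le> 2 * pi" "\<And>t. t \<in> {l..l + e} \<Longrightarrow> \<bar>t - t0\<bar> \<le> e"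
  proof (cases "t0 \<le> pi")
    case True
    have "e \<le> pi" by (simp add: e_def)
    thus ?thesis using True t0 by (intro that[of t0]) auto
  next
    case False
    have "e \<le> pi" by (simp add: e_def)
    thus ?thesis using False t0 by (intro that[of "t0 - e"]) auto
  qed
  have "e * (height y / 2) = integral {l..l + e} (\<lambda>t. height y / 2)" using epos by simp
  also have "\<dots> \<le> integral {l..l + e} (\<lambda>t. height (exp (Complex s t)))"
    using near l(3) by (intro integral_le integrable_continuous_real continuous_intros circle_integral_height) auto
  also have "\<dots> \<le> integral {0..2 * pi} (\<lambda>t. height (exp (Complex s t)))"
    using l Hp by (intro integral_subset_le integrable_continuous_real circle_integral_height) auto
  also have "\<dots> = I" using int by (rule integral_unique)
  finally have eH: "e * height y \<le> 2 * I" by simp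
  hence Ipos: "0 \<le> I" using Hp[of y] epos by (smt (verit) mult_nonneg_nonneg)
  have "1 \<le> (1 + 2 / r) * exp s * e"
  proof (cases "r * exp (- s) \<le> pi")
    case True
    hence "(1 + 2 / r) * exp s * e = r + 2" using rpos by (simp add: e_def exp_minus field_simps)
    thus ?thesis using rpos by simp
  next
    case False
    hence "e = pi" by (simp add: e_def)
    have "1 * 1 * 1 \<le> (1 + 2 / r) * exp s * pi"
      using rpos assms pi_gt3 by (intro mult_mono) auto
    thus ?thesis using \<open>e = pi\<close> by simp
  qed
  hence "1 * height y \<le> (1 + 2 / r) * exp s * e * height y" using Hp by (intro mult_right_mono) auto
  also have "\<dots> = (1 + 2 / r) * exp s * (e * height y)" by simp
  also have "\<dots> \<le> (1 + 2 / r) * exp s * (2 * I)" using eH rpos by (intro mult_left_mono) auto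
  also have "2 * I = circle_integral s - 2 * pi * ln (d / 2)" by (simp add: I_def)
  also have "2 / r = 20 / d" by (simp add: r_def)
  finally show ?thesis by simp
qed

lemma height_polynomial_growth: "\<exists>C\<ge>0. \<forall>z. 1 \<le> cmod z \<longrightarrow> height z \<le> C * cmod z ^ 3"
proof -
  obtain N' N'' where N: "\<And>s. (circle_integral has_real_derivative N' s) (at s)"
    "\<And>s. (N' has_real_derivative N'' s) (at s)"
    "\<And>s M. (\<And>z. cmod z = exp s \<Longrightarrow> M \<le> height z) \<Longrightarrow> N'' s \<le> 32 * pi / d\<^sup>2 * exp (2 * s - 4 * M)"
    using circle_integral_derivatives by blast
  note Hp = height_nonneg
  define K where "K = 32 * pi / d\<^sup>2"
  have "N'' s \<le> K * exp (2 * s)" for s using N(3)[of s 0] Hp by (simp add: K_def)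
  from second_derivative_exp_bound_imp_growth[OF N(1,2) this, of 0]
  obtain A B where AB: "\<And>s. 0 \<le> s \<Longrightarrow> circle_integral s \<le> A + B * s + K / 4 * exp (2 * s)" by auto
  define C1 where "C1 = \<bar>A\<bar> + \<bar>B\<bar> + K / 4 + \<bar>2 * pi * ln (d / 2)\<bar>"
  define C where "C = (1 + 20 / d) * C1"
  have Kp: "0 \<le> K" by (simp add: K_def)
  have C0: "0 \<le> C" using d_pos Kp by (auto simp: C_def C1_def intro!: mult_nonneg_nonneg add_nonneg_nonneg)
  have "height z \<le> C * cmod z ^ 3" if "1 \<le> cmod z" for z
  proof -
    define s where "s = ln (cmod z)"
    have "0 < cmod z" using that by linarith
    hence s: "0 \<le> s" "cmod z = exp s" using that by (simp_all add: s_def del: zero_less_norm_iff)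
    have 1: "1 \<le> exp (2 * s)" and 2: "s \<le> exp (2 * s)"
      using s(1) exp_ge_add_one_self[of "2 * s"] by linarith+
    have "A \<le> \<bar>A\<bar> * exp (2 * s)" "B * s \<le> \<bar>B\<bar> * exp (2 * s)"
      "- (2 * pi * ln (d / 2)) \<le> \<bar>2 * pi * ln (d / 2)\<bar> * exp (2 * s)"
      using mult_mono[of "\<bar>A\<bar>" "\<bar>A\<bar>" 1 "exp (2 * s)"] mult_mono[of B "\<bar>B\<bar>" s "exp (2 * s)"]
        mult_mono[of "\<bar>2 * pi * ln (d / 2)\<bar>" "\<bar>2 * pi * ln (d / 2)\<bar>" 1 "exp (2 * s)"] 1 2 s by auto
    hence "circle_integral s - 2 * pi * ln (d / 2) \<le> C1 * exp (2 * s)"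
      using AB[OF s(1)] unfolding C1_def distrib_right by linarith
    hence "(1 + 20 / d) * exp s * (circle_integral s - 2 * pi * ln (d / 2)) \<le> (1 + 20 / d) * exp s * (C1 * exp (2 * s))"
      using d_pos by (intro mult_left_mono) auto
    with height_le_circle_integral[OF s] have "height z \<le> (1 + 20 / d) * exp s * (C1 * exp (2 * s))" by (rule order.trans)
    also have "\<dots> = C * (exp s * exp (2 * s))" by (simp add: C_def)
    also have "exp s * exp (2 * s) = cmod z ^ 3" by (simp add: s(2) flip: exp_add exp_of_nat_mult)
    finally show ?thesis .
  qed
  with C0 show ?thesis by blast
qed

text \<open>If \<open>|f|\<close> grows at least linearly, then the height is at least of order \<open>exp (s / 2)\<close> on the circle of
  radius \<open>exp s\<close>. In particular it exceeds \<open>3 / 4 * s\<close> eventually, which turns the bound on \<open>N''\<close> into \<open>K * exp (- s)\<close>. Then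
  the circle means grow at most linearly in \<open>s\<close>, which contradicts the first bound.\<close>

lemma no_linear_lower_bound:
  assumes "0 < e"
  shows "\<exists>z. R \<le> cmod z \<and> cmod (f z) < e * cmod z"
proof (rule ccontr)
  assume "\<not> ?thesis"
  hence f: "e * cmod z \<le> cmod (f z)" if "R \<le> cmod z" for z using that by force
  define r where "r = d / 10"
  have rpos: "0 < r" using d_pos by (simp add: r_def)
  define k where "k = sqrt (e * r\<^sup>2 / 5)"
  have kpos: "0 < k" using assms rpos by (simp add: k_def)
  \<comment> \<open>The positive lower bound absorbs the linear term: \<open>height + height\<^sup>2 \<le> 5 * height\<^sup>2\<close>.\<close>
  have quarter: "1 / 4 \<le> height z" for z using height_lower_bound[of z] ln2_ge_two_thirds by linarith
  have Hlow: "k * exp (s / 2) \<le> height z" if "ln (max R 1) \<le> s" "cmod z = exp s" for s z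
  proof -
    have "max R 1 \<le> exp s" using that(1) exp_le_cancel_iff[of "ln (max R 1)" s] by simp
    hence "e * exp s \<le> (height z + (height z)\<^sup>2) / r\<^sup>2"
      using f[of z] that(2) coefficient_bound[of z] by (simp add: r_def)
    hence "e * exp s * r\<^sup>2 \<le> height z + (height z)\<^sup>2" using rpos by (simp add: le_divide_eq)
    moreover have "height z \<le> 4 * (height z)\<^sup>2" using quarter[of z] by (simp add: power2_eq_square)
    ultimately have "e * exp s * r\<^sup>2 \<le> 5 * (height z)\<^sup>2" by linarith
    hence "e * r\<^sup>2 / 5 * exp s \<le> (height z)\<^sup>2" by (simp add: mult_ac)
    moreover have "(k * exp (s / 2))\<^sup>2 = e * r\<^sup>2 / 5 * exp s"
      using assms by (simp add: k_def power_mult_distrib flip: exp_double)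
    ultimately have "(k * exp (s / 2))\<^sup>2 \<le> (height z)\<^sup>2" by simp
    thus ?thesis by (rule power2_le_imp_le) (use quarter[of z] in linarith)
  qed
  obtain s1 where s1: "0 \<le> s1" "\<And>s. s1 \<le> s \<Longrightarrow> 3 / 4 * (1 + s) < k * exp (s / 2)"
    using linear_less_exp_half[OF kpos] by blast
  define s0 where "s0 = max s1 (ln (max R 1))"
  obtain N' N'' where N: "\<And>s. (circle_integral has_real_derivative N' s) (at s)"
    "\<And>s. (N' has_real_derivative N'' s) (at s)"
    "\<And>s M. (\<And>z. cmod z = exp s \<Longrightarrow> M \<le> height z) \<Longrightarrow> N'' s \<le> 32 * pi / d\<^sup>2 * exp (2 * s - 4 * M)"
    using circle_integral_derivatives by blast
  define K where "K = 32 * pi / d\<^sup>2"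
  have K0: "0 \<le> K" by (simp add: K_def)
  have "N'' s \<le> K * exp (- 1 * s)" if "s0 \<le> s" for s
  proof -
    have "3 / 4 * s \<le> height z" if "cmod z = exp s" for z
      using Hlow[of s z] s1(2)[of s] \<open>s0 \<le> s\<close> that by (simp add: s0_def)
    from N(3)[of s "3 / 4 * s", OF this] show ?thesis by (simp add: K_def)
  qed
  from second_derivative_exp_bound_imp_growth[OF N(1,2) this, of s0]
  obtain A B where AB: "\<And>s. s0 \<le> s \<Longrightarrow> circle_integral s \<le> A + B * s + K * exp (- s)" by auto
  define D where "D = \<bar>A\<bar> + \<bar>B\<bar> + K + \<bar>2 * pi * ln (d / 2)\<bar>"
  have "0 < 4 * pi * k" using kpos by simp
  from linear_less_exp_half[OF this, of D] obtain s2 where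
    s2: "0 \<le> s2" "\<And>s. s2 \<le> s \<Longrightarrow> D * (1 + s) < 4 * pi * k * exp (s / 2)" by blast
  define s where "s = max s0 s2"
  have sge: "s0 \<le> s" "s2 \<le> s" "0 \<le> s" "ln (max R 1) \<le> s" using s2 by (auto simp: s_def s0_def)
  have "2 * pi * (k * exp (s / 2)) = integral {0..2 * pi} (\<lambda>t. k * exp (s / 2))" by simp
  also have "\<dots> \<le> integral {0..2 * pi} (\<lambda>t. height (exp (Complex s t)))"
    using Hlow[OF sge(4)] by (intro integral_le integrable_continuous_real continuous_intros circle_integral_height) auto
  also have "\<dots> = (circle_integral s - 2 * pi * ln (d / 2)) / 2" using circle_integral_height(1) by (rule integral_unique)
  finally have "4 * pi * k * exp (s / 2) \<le> circle_integral s - 2 * pi * ln (d / 2)" by simp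
  also have "\<dots> \<le> A + B * s + K * exp (- s) - 2 * pi * ln (d / 2)" using AB[OF sge(1)] by simp
  also have "\<dots> \<le> D * (1 + s)"
  proof -
    have "K * exp (- s) \<le> K * 1" using K0 sge by (intro mult_left_mono) auto
    moreover have "B * s \<le> \<bar>B\<bar> * s" using sge by (intro mult_right_mono) auto
    moreover have "0 \<le> (\<bar>A\<bar> + K + \<bar>2 * pi * ln (d / 2)\<bar>) * s" using sge K0 by simp
    moreover have "D * (1 + s) = \<bar>A\<bar> + \<bar>B\<bar> + K + \<bar>2 * pi * ln (d / 2)\<bar> + (\<bar>A\<bar> + K + \<bar>2 * pi * ln (d / 2)\<bar>) * s + \<bar>B\<bar> * s"
      by (simp add: D_def algebra_simps)
    ultimately show ?thesis by linarith
  qed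
  finally show False using s2(2)[OF sge(2)] by linarith
qed

theorem coefficient_constant:
  assumes "f holomorphic_on UNIV"
  shows "f z = f 0"
proof -
  obtain C where C: "0 \<le> C" "\<And>z. 1 \<le> cmod z \<Longrightarrow> height z \<le> C * cmod z ^ 3"
    using height_polynomial_growth by blast
  define B where "B = (C + C\<^sup>2) / (d / 10)\<^sup>2"
  have bd: "cmod (f z) \<le> B * cmod z ^ 6" if "1 \<le> cmod z" for z
  proof -
    note H0 = height_nonneg[of z]
    have "(height z)\<^sup>2 \<le> (C * cmod z ^ 3)\<^sup>2" using C(2)[OF that] H0 by (intro power_mono)
    hence "(height z)\<^sup>2 \<le> C\<^sup>2 * cmod z ^ 6" by (simp add: power_mult_distrib flip: power_mult)
    moreover have "C * cmod z ^ 3 \<le> C * cmod z ^ 6" using that C by (intro mult_left_mono power_increasing) auto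
    ultimately have "height z + (height z)\<^sup>2 \<le> (C + C\<^sup>2) * cmod z ^ 6" using C(2)[OF that] by (simp add: distrib_right)
    hence "(height z + (height z)\<^sup>2) / (d / 10)\<^sup>2 \<le> (C + C\<^sup>2) * cmod z ^ 6 / (d / 10)\<^sup>2" by (intro divide_right_mono) auto
    with coefficient_bound[of z] show ?thesis by (simp add: B_def)
  qed
  define c where "c k = (deriv ^^ k) f 0 / fact k" for k
  have poly: "f z = (\<Sum>k\<le>6. c k * z ^ k)" for z
    unfolding c_def by (rule Liouville_polynomial[OF assms bd])
  have "c k = 0" if k: "k \<noteq> 0" "k \<le> 6" for k
  proof (rule ccontr)
    assume "c k \<noteq> 0"
    from nonconstant_polynomial_linear_lower_bound[of k 6 c, OF k this]
    obtain e R where "0 < e" "\<And>z. R \<le> cmod z \<Longrightarrow> e * cmod z \<le> cmod (f z)"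
      by (auto simp: poly)
    with no_linear_lower_bound[of e R] show False by force
  qed
  hence "(\<Sum>k\<le>6. c k * z ^ k) = (\<Sum>k\<in>{0}. c k * z ^ k)" for z
    by (intro sum.mono_neutral_right) auto
  thus ?thesis by (simp add: poly)
qed

end

section \<open>Entire solutions of the oscillator equation\<close>

text \<open>The power series coefficients of the solution of \<open>\<phi>'' = - f \<phi>\<close> with \<open>\<phi> 0 = c0\<close> and \<open>\<phi>' 0 = c1\<close>, where \<open>a\<close> are the
  coefficients of \<open>f\<close>.\<close>

fun oscillator_coeff :: "(nat \<Rightarrow> complex) \<Rightarrow> complex \<Rightarrow> complex \<Rightarrow> nat \<Rightarrow> complex" where
  "oscillator_coeff a c0 c1 0 = c0"
| "oscillator_coeff a c0 c1 (Suc 0) = c1"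
| "oscillator_coeff a c0 c1 (Suc (Suc n)) =
     - (\<Sum>k\<le>n. a (n - k) * oscillator_coeff a c0 c1 k) / (of_nat (Suc n) * of_nat (Suc (Suc n)))"

text \<open>If the coefficients of \<open>f\<close> are bounded geometrically with ratio \<open>1 / (2 r)\<close>, the convolution with a sequence of
  size \<open>K / r ^ n\<close> loses only a factor \<open>2\<close>. The denominators of the recursion beat every constant from some index \<open>n0\<close> on; \<open>K\<close> covers the
  indices before.\<close>

lemma oscillator_coeff_bound:
  assumes "0 < r" and "0 \<le> M" and a: "\<And>k. cmod (a k) \<le> M / (2 * r) ^ k"
  shows "\<exists>K. \<forall>n. cmod (oscillator_coeff a c0 c1 n) \<le> K / r ^ n"
proof -
  let ?c = "oscillator_coeff a c0 c1"
  obtain n0 :: nat where n0: "2 * M * r\<^sup>2 \<le> of_nat n0" using real_arch_simple by blast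
  define K where "K = (\<Sum>k\<le>n0 + 1. cmod (?c k) * r ^ k)"
  have K0: "0 \<le> K" using \<open>0 < r\<close> unfolding K_def by (intro sum_nonneg) simp
  have "cmod (?c n) \<le> K / r ^ n" for n
  proof (induction n rule: less_induct)
    case (less n)
    show ?case
    proof (cases "n \<le> n0 + 1")
      case True
      have "cmod (?c n) * r ^ n \<le> K" unfolding K_def
        by (rule member_le_sum) (use True \<open>0 < r\<close> in auto)
      thus ?thesis using \<open>0 < r\<close> by (simp add: le_divide_eq)
    next
      case False
      define m where "m = n - 2"
      have n: "n = Suc (Suc m)" and m: "n0 \<le> m" using False by (auto simp: m_def)
      have "cmod (\<Sum>k\<le>m. a (m - k) * ?c k) \<le> (\<Sum>k\<le>m. M * K / r ^ m * (1 / 2) ^ (m - k))"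
      proof (rule sum_norm_le)
        fix k assume "k \<in> {..m}"
        hence k: "k \<le> m" by simp
        have "cmod (a (m - k) * ?c k) \<le> M / (2 * r) ^ (m - k) * (K / r ^ k)"
          unfolding norm_mult using k n \<open>0 < r\<close> \<open>0 \<le> M\<close> by (intro mult_mono a less.IH) auto
        also have "\<dots> = M * K / (r ^ (m - k) * r ^ k) * (1 / 2) ^ (m - k)"
          by (simp add: power_mult_distrib power_divide)
        also have "r ^ (m - k) * r ^ k = r ^ m" using k by (simp flip: power_add)
        finally show "cmod (a (m - k) * ?c k) \<le> M * K / r ^ m * (1 / 2) ^ (m - k)" .
      qed
      also have "\<dots> = M * K / r ^ m * (\<Sum>k\<le>m. (1 / 2) ^ (m - k))" by (simp add: sum_distrib_left)
      also have "(\<Sum>k\<le>m. (1 / 2 :: real) ^ (m - k)) = (\<Sum>k\<le>m. (1 / 2) ^ k)"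
        by (rule sum.reindex_bij_witness[of _ "\<lambda>k. m - k" "\<lambda>k. m - k"]) auto
      also have "M * K / r ^ m * (\<Sum>k\<le>m. (1 / 2) ^ k) \<le> M * K / r ^ m * 2"
      proof (rule mult_left_mono)
        show "(\<Sum>k\<le>m. (1 / 2 :: real) ^ k) \<le> 2" by (simp add: sum_gp0)
      qed (use K0 \<open>0 < r\<close> \<open>0 \<le> M\<close> in simp)
      finally have S: "cmod (\<Sum>k\<le>m. a (m - k) * ?c k) \<le> M * K / r ^ m * 2" .
      have den: "0 < real (Suc m) * real (Suc (Suc m))" by simp
      have "cmod (?c n) = cmod (\<Sum>k\<le>m. a (m - k) * ?c k) / (real (Suc m) * real (Suc (Suc m)))"
        unfolding n by (simp add: norm_divide norm_mult del: of_nat_Suc)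
      also have "\<dots> \<le> M * K / r ^ m * 2 / (real (Suc m) * real (Suc (Suc m)))"
        using S by (intro divide_right_mono) auto
      also have "\<dots> = (2 * M * r\<^sup>2) * (K / r ^ n) / (real (Suc m) * real (Suc (Suc m)))"
        using \<open>0 < r\<close> by (simp add: n power2_eq_square)
      also have "\<dots> \<le> (real (Suc m) * real (Suc (Suc m))) * (K / r ^ n) / (real (Suc m) * real (Suc (Suc m)))"
      proof (intro divide_right_mono mult_right_mono)
        have "2 * M * r\<^sup>2 \<le> real (Suc m) * 1" using n0 m by simp
        also have "\<dots> \<le> real (Suc m) * real (Suc (Suc m))" by (intro mult_left_mono) auto
        finally show "2 * M * r\<^sup>2 \<le> real (Suc m) * real (Suc (Suc m))" .
      qed (use K0 \<open>0 < r\<close> in auto)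
      also have "\<dots> = K / r ^ n" using den by simp
      finally show ?thesis .
    qed
  qed
  thus ?thesis by blast
qed

lemma entire_coeff_bound:
  assumes "f holomorphic_on UNIV" "0 < r"
  shows "\<exists>M\<ge>0. \<forall>k. cmod (fps_nth (fps_expansion f 0) k) \<le> M / r ^ k"
proof -
  have c: "continuous_on (sphere 0 r) (\<lambda>x. cmod (f x))"
    by (rule continuous_on_norm, rule continuous_on_subset[OF holomorphic_on_imp_continuous_on[OF assms(1)]]) simp
  obtain M where M: "\<forall>x\<in>sphere 0 r. cmod (f x) \<le> M"
    using compact_imp_bounded[OF compact_continuous_image[OF c compact_sphere]] unfolding bounded_iff by auto
  have "cmod ((deriv ^^ k) f 0) \<le> fact k * max M 0 / r ^ k" for k
  proof (rule Cauchy_inequality)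
    show "f holomorphic_on ball 0 r" using assms(1) by (rule holomorphic_on_subset) simp
    show "continuous_on (cball 0 r) f"
      using holomorphic_on_imp_continuous_on[OF assms(1)] by (rule continuous_on_subset) simp
    show "cmod (f x) \<le> max M 0" if "cmod (0 - x) = r" for x
      using bspec[OF M, of x] that by simp
  qed (rule assms)
  hence "cmod (fps_nth (fps_expansion f 0) k) \<le> max M 0 / r ^ k" for k
    by (simp add: fps_expansion_def norm_divide divide_le_eq mult_ac)
  thus ?thesis by (intro exI[of _ "max M 0"]) auto
qed

lemma entire_oscillator_solution:
  fixes f :: "complex \<Rightarrow> complex"
  assumes f: "f holomorphic_on UNIV"
  obtains \<phi> where "\<phi> holomorphic_on UNIV" "\<And>z. deriv (deriv \<phi>) z = - f z * \<phi> z"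
    "\<phi> 0 = c0" "deriv \<phi> 0 = c1"
proof -
  define A where "A = fps_expansion f 0"
  define P where "P = Abs_fps (oscillator_coeff (fps_nth A) c0 c1)"
  have P_nth: "fps_nth P n = oscillator_coeff (fps_nth A) c0 c1 n" for n by (simp add: P_def)
  have A_rad: "fps_conv_radius A = \<infinity>"
    using conv_radius_fps_expansion[of f 0 \<infinity>] f by (simp add: A_def)
  have P_rad: "fps_conv_radius P = \<infinity>"
  proof -
    have "conv_radius (fps_nth P) \<ge> \<infinity>"
    proof (rule conv_radius_geI_ex)
      fix r :: real assume "0 < r"
      obtain M where "0 \<le> M" "\<And>k. cmod (fps_nth A k) \<le> M / (2 * (2 * r)) ^ k"
        using entire_coeff_bound[OF f, of "2 * (2 * r)"] \<open>0 < r\<close> by (auto simp: A_def)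
      from oscillator_coeff_bound[OF _ this, of c0 c1] \<open>0 < r\<close>
      obtain K where K: "\<And>n. cmod (fps_nth P n) \<le> K / (2 * r) ^ n" by (auto simp: P_nth)
      have "summable (\<lambda>n. fps_nth P n * of_real r ^ n)"
      proof (rule summable_comparison_test)
        have "norm (fps_nth P n * of_real r ^ n) \<le> K * (1 / 2) ^ n" for n
        proof -
          have "norm (fps_nth P n * of_real r ^ n) \<le> K / (2 * r) ^ n * r ^ n"
            using mult_right_mono[OF K[of n], of "r ^ n"] \<open>0 < r\<close> by (simp add: norm_mult norm_power)
          thus ?thesis using \<open>0 < r\<close> by (simp add: power_mult_distrib power_divide)
        qed
        thus "\<exists>N. \<forall>n\<ge>N. norm (fps_nth P n * of_real r ^ n) \<le> K * (1 / 2) ^ n" by blast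
        show "summable (\<lambda>n. K * (1 / 2) ^ n :: real)" by (intro summable_mult summable_geometric) auto
      qed
      thus "\<exists>z. norm z = r \<and> summable (\<lambda>n. fps_nth P n * z ^ n)"
        using \<open>0 < r\<close> by (intro exI[of _ "of_real r"]) auto
    qed
    thus ?thesis by (simp add: fps_conv_radius_def)
  qed
  have dP_rad: "fps_conv_radius (fps_deriv P) = \<infinity>"
    using fps_conv_radius_deriv[of P] P_rad by simp
  have ode: "fps_deriv (fps_deriv P) = - (A * P)"
  proof (rule fps_ext)
    fix n
    have "fps_nth (fps_deriv (fps_deriv P)) n = of_nat (Suc n) * of_nat (Suc (Suc n)) * fps_nth P (Suc (Suc n))"
      by (simp add: fps_deriv_def algebra_simps)
    also have "\<dots> = - (\<Sum>k\<le>n. fps_nth A (n - k) * fps_nth P k)"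
      by (simp add: P_nth del: of_nat_Suc)
    also have "(\<Sum>k\<le>n. fps_nth A (n - k) * fps_nth P k) = fps_nth (P * A) n"
      unfolding fps_mult_nth atLeast0AtMost by (intro sum.cong refl mult.commute)
    finally show "fps_nth (fps_deriv (fps_deriv P)) n = fps_nth (- (A * P)) n"
      by (simp add: mult.commute)
  qed
  have evA: "eval_fps A z = f z" for z
    using eval_fps_expansion'[of f 0 \<infinity> z] f by (simp add: A_def)
  have d1: "deriv (eval_fps P) z = eval_fps (fps_deriv P) z" for z
    using eval_fps_deriv[of z P] P_rad by simp
  have d2: "deriv (deriv (eval_fps P)) z = - f z * eval_fps P z" for z
  proof -
    have "deriv (deriv (eval_fps P)) z = deriv (eval_fps (fps_deriv P)) z" using d1 by presburger
    also have "\<dots> = eval_fps (- (A * P)) z"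
      using eval_fps_deriv[of z "fps_deriv P"] dP_rad by (simp add: ode)
    also have "\<dots> = - (eval_fps A z * eval_fps P z)"
      using A_rad P_rad fps_conv_radius_mult[of A P] by (simp add: eval_fps_minus eval_fps_mult)
    finally show ?thesis by (simp add: evA)
  qed
  show ?thesis
  proof (rule that)
    show "eval_fps P holomorphic_on UNIV"
      by (rule holomorphic_on_eval_fps) (simp add: P_rad)
    show "eval_fps P 0 = c0" by (simp add: eval_fps_at_0 P_nth)
    show "deriv (eval_fps P) 0 = c1" unfolding d1 by (simp add: eval_fps_at_0 P_nth)
  qed (rule d2)
qed

lemma oscillator_wronskian_constant:
  fixes f :: "complex \<Rightarrow> complex"
  assumes hol: "\<phi> holomorphic_on UNIV" "\<psi> holomorphic_on UNIV"
    and ode: "\<And>z. deriv (deriv \<phi>) z = - f z * \<phi> z" "\<And>z. deriv (deriv \<psi>) z = - f z * \<psi> z"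
  shows "\<phi> z * deriv \<psi> z - deriv \<phi> z * \<psi> z = \<phi> 0 * deriv \<psi> 0 - deriv \<phi> 0 * \<psi> 0"
proof -
  note D = holomorphic_derivI[OF _ open_UNIV UNIV_I]
  have "((\<lambda>z. \<phi> z * deriv \<psi> z - deriv \<phi> z * \<psi> z) has_field_derivative
     (deriv \<phi> z * deriv \<psi> z + deriv (deriv \<psi>) z * \<phi> z) - (deriv (deriv \<phi>) z * \<psi> z + deriv \<psi> z * deriv \<phi> z)) (at z)" for z
    by (intro DERIV_diff DERIV_mult D hol holomorphic_deriv open_UNIV)
  hence "((\<lambda>z. \<phi> z * deriv \<psi> z - deriv \<phi> z * \<psi> z) has_field_derivative 0) (at z within UNIV)" for z
    by (simp add: ode algebra_simps)
  from has_field_derivative_zero_constant[OF convex_UNIV this] show ?thesis by auto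
qed

text \<open>Conjugating a solution on both sides gives a solution with the conjugate initial values, and Wronskians with the
  basis \<open>\<phi>, \<psi>\<close> show that the initial values determine a solution.\<close>

lemma oscillator_solution_cnj:
  fixes f :: "complex \<Rightarrow> complex"
  assumes hol: "\<phi> holomorphic_on UNIV" "\<psi> holomorphic_on UNIV"
    and ode: "\<And>z. deriv (deriv \<phi>) z = - f z * \<phi> z" "\<And>z. deriv (deriv \<psi>) z = - f z * \<psi> z"
    and sym: "\<And>z. f (cnj z) = cnj (f z)"
    and init: "\<phi> 0 = 1" "deriv \<phi> 0 = 0" "\<psi> 0 = 0" "deriv \<psi> 0 = 1"
  shows "\<phi> (cnj z) = cnj (\<phi> z)" "\<psi> (cnj z) = cnj (\<psi> z)"
proof -
  have W: "\<phi> z * deriv \<psi> z - deriv \<phi> z * \<psi> z = 1" for z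
    using oscillator_wronskian_constant[OF hol ode] by (simp add: init)
  have rep: "\<zeta> z = \<zeta> 0 * \<phi> z + deriv \<zeta> 0 * \<psi> z"
    if "\<zeta> holomorphic_on UNIV" "\<And>z. deriv (deriv \<zeta>) z = - f z * \<zeta> z" for \<zeta> z
  proof -
    have 1: "\<zeta> z * deriv \<psi> z - deriv \<zeta> z * \<psi> z = \<zeta> 0"
      using oscillator_wronskian_constant[OF that(1) hol(2) that(2) ode(2)] by (simp add: init)
    have 2: "\<phi> z * deriv \<zeta> z - deriv \<phi> z * \<zeta> z = deriv \<zeta> 0"
      using oscillator_wronskian_constant[OF hol(1) that(1) ode(1) that(2)] by (simp add: init)
    have "\<zeta> z * 1 = \<zeta> 0 * \<phi> z + deriv \<zeta> 0 * \<psi> z"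
      unfolding W[of z, symmetric] 1[symmetric] 2[symmetric] by (simp add: algebra_simps)
    thus ?thesis by simp
  qed
  have conj: "(\<lambda>z. cnj (\<zeta> (cnj z))) holomorphic_on UNIV" "deriv (\<lambda>z. cnj (\<zeta> (cnj z))) = (\<lambda>z. cnj (deriv \<zeta> (cnj z)))"
    if "\<zeta> holomorphic_on UNIV" for \<zeta>
  proof -
    have d: "((\<lambda>z. cnj (\<zeta> (cnj z))) has_field_derivative cnj (deriv \<zeta> (cnj z))) (at z)" for z
      using has_field_derivative_cnj_cnj[of \<zeta> "deriv \<zeta> (cnj z)" z] holomorphic_derivI[OF that open_UNIV UNIV_I]
      by (simp add: o_def)
    thus "(\<lambda>z. cnj (\<zeta> (cnj z))) holomorphic_on UNIV" by (subst holomorphic_on_open) auto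
    show "deriv (\<lambda>z. cnj (\<zeta> (cnj z))) = (\<lambda>z. cnj (deriv \<zeta> (cnj z)))"
      using d DERIV_imp_deriv by blast
  qed
  have conj_ode: "deriv (deriv (\<lambda>z. cnj (\<zeta> (cnj z)))) z = - f z * cnj (\<zeta> (cnj z))"
    if "\<zeta> holomorphic_on UNIV" "\<And>z. deriv (deriv \<zeta>) z = - f z * \<zeta> z" for \<zeta> z
    unfolding conj(2)[OF that(1)] conj(2)[OF holomorphic_deriv[OF that(1) open_UNIV]]
    by (simp add: that(2) sym)
  have "cnj (\<phi> (cnj z)) = \<phi> z"
    using rep[OF conj(1)[OF hol(1)] conj_ode[OF hol(1) ode(1)]] by (simp add: conj(2)[OF hol(1)] init)
  thus "\<phi> (cnj z) = cnj (\<phi> z)" by (metis complex_cnj_cnj)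
  have "cnj (\<psi> (cnj z)) = \<psi> z"
    using rep[OF conj(1)[OF hol(2)] conj_ode[OF hol(2) ode(2)]] by (simp add: conj(2)[OF hol(2)] init)
  thus "\<psi> (cnj z) = cnj (\<psi> z)" by (metis complex_cnj_cnj)
qed


section \<open>The boundary value problem in Wirtinger form\<close>

text \<open>Symmetry of second derivatives: differentiate the integral of \<open>uy\<close> over a vertical segment under the
  integral sign to express \<open>ux\<close>, and then in the upper end point. The segment starts at \<open>y / 2\<close> to stay inside the half plane.\<close>

lemma mixed_partial_derivatives_eq:
  fixes u ux uy uyx :: "real \<Rightarrow> real \<Rightarrow> real"
  assumes dy: "\<And>x y. 0 < y \<Longrightarrow> (u x has_real_derivative uy x y) (at y)"
    and dx: "\<And>x y. 0 < y \<Longrightarrow> ((\<lambda>x. u x y) has_real_derivative ux x y) (at x)"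
    and dyx: "\<And>x y. 0 < y \<Longrightarrow> ((\<lambda>x. uy x y) has_real_derivative uyx x y) (at x)"
    and cont: "continuous_on (UNIV \<times> {0<..}) (\<lambda>(x, y). uyx x y)"
    and dxy: "(ux x has_real_derivative m) (at y)" and "0 < y"
  shows "m = uyx x y"
proof -
  define a where "a = y / 2"
  define b where "b = 2 * y"
  have ab: "0 < a" "a < y" "y < b" using \<open>0 < y\<close> by (auto simp: a_def b_def)
  have int_uy: "(uy x has_integral u x t - u x a) {a..t}" if "a \<le> t" for x t
  proof (rule fundamental_theorem_of_calculus[OF that])
    fix s assume "s \<in> {a..t}"
    thus "(u x has_vector_derivative uy x s) (at s within {a..t})"
      using dy[of s x] ab by (auto simp: has_real_derivative_iff_has_vector_derivative intro: has_vector_derivative_at_within)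
  qed
  have key: "ux x t - ux x a = integral {a..t} (uyx x)" if "a \<le> t" for t
  proof -
    have "((\<lambda>x. integral (cbox a t) (uy x)) has_vector_derivative integral (cbox a t) (uyx x)) (at x within UNIV)"
    proof (rule leibniz_rule_vector_derivative)
      show "((\<lambda>x. uy x s) has_vector_derivative uyx x s) (at x within UNIV)" if "s \<in> cbox a t" for x s
        using dyx[of s x] that ab by (auto simp: has_real_derivative_iff_has_vector_derivative)
      show "uy x integrable_on cbox a t" for x
        using int_uy[OF \<open>a \<le> t\<close>, of x] by (auto simp: has_integral_integrable)
      show "continuous_on (UNIV \<times> cbox a t) (\<lambda>(x, y). uyx x y)"
        by (rule continuous_on_subset[OF cont]) (use ab in auto)
    qed auto
    moreover have "integral (cbox a t) (uy x) = u x t - u x a" for x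
      using int_uy[OF \<open>a \<le> t\<close>, of x] by (auto dest: integral_unique)
    ultimately have "((\<lambda>x. u x t - u x a) has_real_derivative integral {a..t} (uyx x)) (at x)"
      by (simp add: has_real_derivative_iff_has_vector_derivative)
    moreover have "((\<lambda>x. u x t - u x a) has_real_derivative ux x t - ux x a) (at x)"
      using that ab by (intro DERIV_diff dx) auto
    ultimately show ?thesis by (rule DERIV_unique[symmetric])
  qed
  have "continuous_on {a..b} (\<lambda>t. case (x, t) of (x, y) \<Rightarrow> uyx x y)"
    by (rule continuous_on_compose2[OF cont]) (use ab in \<open>auto intro!: continuous_intros\<close>)
  hence "continuous_on {a..b} (uyx x)" by simp
  hence "((\<lambda>t. integral {a..t} (uyx x)) has_real_derivative uyx x y) (at y within {a..b})"
    by (rule integral_has_real_derivative) (use ab in auto)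
  hence "((\<lambda>t. integral {a..t} (uyx x)) has_real_derivative uyx x y) (at y)"
    using at_within_interior[of y "{a..b}"] ab by simp
  moreover have "((\<lambda>t. ux x t - ux x a) has_real_derivative m) (at y)"
    using DERIV_diff[OF dxy DERIV_const] by simp
  hence "((\<lambda>t. integral {a..t} (uyx x)) has_real_derivative m) (at y)"
    by (rule has_field_derivative_transform_within_open[of _ _ _ "{a<..}"]) (use ab key in auto)
  ultimately show ?thesis by (rule DERIV_unique[symmetric])
qed

lemma partial_deriv_eq:
  assumes "(f has_derivative f') (at x)"
  shows "partial_deriv v f x = f' v"
proof -
  have "((\<lambda>h::real. x + h *\<^sub>R v) has_derivative (\<lambda>h. h *\<^sub>R v)) (at 0)"
    by (auto intro!: derivative_eq_intros)
  from has_derivative_compose[OF this, of f f'] assms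
  have "((\<lambda>h. f (x + h *\<^sub>R v)) has_derivative (\<lambda>h. f' (h *\<^sub>R v))) (at 0)" by simp
  moreover have "f' (h *\<^sub>R v) = f' v * h" for h
    using has_derivative_bounded_linear[OF assms] by (simp add: linear_simps)
  ultimately show ?thesis
    unfolding partial_deriv_def by (intro DERIV_imp_deriv) (simp add: has_field_derivative_def)
qed

lemma partial_deriv_cong_open:
  assumes "open S" "x \<in> S" "\<And>y. y \<in> S \<Longrightarrow> f y = g y"
  shows "partial_deriv v f x = partial_deriv v g x"
proof -
  have "isCont (\<lambda>h::real. x + h *\<^sub>R v) 0" by (intro continuous_intros)
  hence "((\<lambda>h::real. x + h *\<^sub>R v) \<longlongrightarrow> x + 0 *\<^sub>R v) (nhds 0)"
    unfolding isCont_def by (subst (asm) tendsto_at_iff_tendsto_nhds)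
  from topological_tendstoD[OF this assms(1)] assms(2)
  have "eventually (\<lambda>h. x + h *\<^sub>R v \<in> S) (nhds 0)" by simp
  hence "eventually (\<lambda>h. f (x + h *\<^sub>R v) = g (x + h *\<^sub>R v)) (nhds 0)"
    by eventually_elim (rule assms(3))
  thus ?thesis unfolding partial_deriv_def by (intro deriv_cong_ev refl)
qed

lemma open_half_plane: "open half_plane"
  unfolding half_plane_def by (intro open_Times) auto

lemma laplacian_plane_eq:
  assumes df: "\<And>x. x \<in> half_plane \<Longrightarrow> (f has_derivative f' x) (at x)"
    and d1: "((\<lambda>y. f' y (1, 0)) has_derivative g1) (at x)"
    and d2: "((\<lambda>y. f' y (0, 1)) has_derivative g2) (at x)"
    and x: "x \<in> half_plane"
  shows "laplacian f x = g1 (1, 0) + g2 (0, 1)"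
proof -
  have "partial_deriv b (partial_deriv b f) x = partial_deriv b (\<lambda>y. f' y b) x" for b
    by (rule partial_deriv_cong_open[OF open_half_plane x]) (rule partial_deriv_eq[OF df])
  hence "laplacian f x = (\<Sum>b\<in>Basis. partial_deriv b (\<lambda>y. f' y b) x)"
    by (simp add: laplacian_def)
  also have "\<dots> = partial_deriv (1, 0) (\<lambda>y. f' y (1, 0)) x + partial_deriv (0, 1) (\<lambda>y. f' y (0, 1)) x"
    by (simp add: Basis_prod_def sum.union_disjoint)
  finally show ?thesis by (simp add: partial_deriv_eq[OF d1] partial_deriv_eq[OF d2])
qed

text \<open>The boundary value problem in complex coordinates. \<open>D\<close> and \<open>E\<close> are the first and second Wirtinger derivatives of \<open>U\<close> in \<open>z\<close>;
  the coefficient of \<open>cnj h\<close> in the derivative of \<open>D\<close> is a quarter of the Laplacian of \<open>U\<close>. Only \<open>U\<close> and \<open>D\<close> are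
  assumed to be continuous up to the boundary.\<close>

locale wirtinger_solution =
  fixes \<kappa> :: real and U :: "complex \<Rightarrow> real" and D E :: "complex \<Rightarrow> complex"
  assumes U_cont: "continuous_on {z. 0 \<le> Im z} U" and D_cont: "continuous_on {z. 0 \<le> Im z} D"
    and E_cont: "continuous_on {z. 0 < Im z} E"
    and U_deriv: "\<And>z. 0 < Im z \<Longrightarrow> (U has_derivative (\<lambda>h. 2 * Re (D z * h))) (at z)"
    and D_deriv: "\<And>z. 0 < Im z \<Longrightarrow>
      (D has_derivative (\<lambda>h. E z * h - of_real (exp (2 * U z) / 4) * cnj h)) (at z)"
    and U_tangential: "\<And>x. ((\<lambda>x. U (of_real x)) has_real_derivative 2 * Re (D (of_real x))) (at x)"
    and U_normal: "\<And>x. ((\<lambda>s. U (Complex x s)) has_real_derivative - \<kappa> * exp (U (of_real x))) (at 0 within {0..})"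
    and D_boundary: "\<And>x. Im (D (of_real x)) = \<kappa> / 2 * exp (U (of_real x))"

text \<open>\<open>D\<close> is built from the derivative up to the boundary (\<open>g'\<close>), which agrees with the interior derivative (\<open>f'\<close>) in the open
  half plane. That its derivative in \<open>cnj z\<close> is real uses the symmetry of second derivatives.\<close>

lemma liouville_neumann_solution_imp_wirtinger_solution:
  assumes sol: "liouville_neumann_solution \<kappa> u"
  shows "\<exists>D E. wirtinger_solution \<kappa> (\<lambda>z. u (Re z, Im z)) D E"
proof -
  obtain f' where df: "\<And>x. x \<in> half_plane \<Longrightarrow> (u has_derivative blinfun_apply (f' x)) (at x within half_plane)"
    and "C1_on half_plane f'"
    using sol unfolding liouville_neumann_solution_def C2_on_def by blast
  then obtain f'' where df': "\<And>x. x \<in> half_plane \<Longrightarrow> (f' has_derivative blinfun_apply (f'' x)) (at x within half_plane)"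
    and cf'': "continuous_on half_plane f''"
    unfolding C1_on_def by blast
  obtain g' where dg: "\<And>x. x \<in> closed_half_plane \<Longrightarrow> (u has_derivative blinfun_apply (g' x)) (at x within closed_half_plane)"
    and cg': "continuous_on closed_half_plane g'"
    using sol unfolding liouville_neumann_solution_def C1_on_def by blast
  have lap: "laplacian u x + exp (2 * u x) = 0" if "x \<in> half_plane" for x
    using sol that unfolding liouville_neumann_solution_def by blast
  have neumann: "((\<lambda>s. u (x1, s)) has_real_derivative - \<kappa> * exp (u (x1, 0))) (at 0 within {0..})" for x1
    using sol unfolding liouville_neumann_solution_def by blast
  have at_open: "at x within half_plane = at x" if "x \<in> half_plane" for x
    using at_within_open[OF that open_half_plane] .
  have sub: "half_plane \<subseteq> closed_half_plane" by (auto simp: half_plane_def closed_half_plane_def)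
  have fg: "f' x = g' x" if "x \<in> half_plane" for x
  proof -
    have "x \<in> closed_half_plane" using that sub by blast
    from has_derivative_subset[OF dg[OF this] sub]
    have "(u has_derivative blinfun_apply (g' x)) (at x)" unfolding at_open[OF that] .
    hence "blinfun_apply (f' x) = blinfun_apply (g' x)"
      using df[OF that] unfolding at_open[OF that] by (rule has_derivative_unique[rotated])
    thus ?thesis by (simp add: blinfun_apply_inject)
  qed
  define \<iota> where "\<iota> z = (Re z, Im z)" for z
  have \<iota>_open: "\<iota> z \<in> half_plane \<longleftrightarrow> 0 < Im z" and \<iota>_closed: "\<iota> z \<in> closed_half_plane \<longleftrightarrow> 0 \<le> Im z" for z
    by (auto simp: \<iota>_def half_plane_def closed_half_plane_def)
  have d\<iota>: "(\<iota> has_derivative \<iota>) (at z within S)" for z S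
    unfolding \<iota>_def by (intro has_derivative_Pair has_derivative_Re has_derivative_Im has_derivative_ident)
  have c\<iota>: "continuous_on S \<iota>" for S
    unfolding \<iota>_def by (intro continuous_intros)
  define D where "D z = Complex (g' (\<iota> z) (1, 0) / 2) (- g' (\<iota> z) (0, 1) / 2)" for z
  define a where "a v w z = f'' (\<iota> z) v w" for v w z
  define E where "E z = Complex ((a (1, 0) (1, 0) z - a (0, 1) (0, 1) z) / 4) (- a (1, 0) (0, 1) z / 2)" for z
  have pair: "blinfun_apply L (s, t) = s * L (1, 0) + t * L (0, 1)" for L :: "(real \<times> real) \<Rightarrow>\<^sub>L real" and s t
  proof -
    have "(s, t) = s *\<^sub>R (1, 0) + t *\<^sub>R (0, 1 :: real)" by simp
    thus ?thesis by (simp only: blinfun.add_right blinfun.scaleR_right real_scaleR_def)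
  qed
  have pair2: "blinfun_apply (blinfun_apply L (s, t)) w = s * L (1, 0) w + t * L (0, 1) w"
    for L :: "(real \<times> real) \<Rightarrow>\<^sub>L ((real \<times> real) \<Rightarrow>\<^sub>L real)" and s t w
  proof -
    have "(s, t) = s *\<^sub>R (1, 0) + t *\<^sub>R (0, 1 :: real)" by simp
    thus ?thesis
      by (simp only: blinfun.add_right blinfun.scaleR_right blinfun.add_left blinfun.scaleR_left real_scaleR_def)
  qed
  have pair_fst: "s * L (1, 0) = L (s, 0)" and pair_snd: "s * L (0, 1) = L (0, s)"
    for L :: "(real \<times> real) \<Rightarrow>\<^sub>L real" and s
    using pair[of L s 0] pair[of L 0 s] by simp_all
  have pair2_fst: "s * L (1, 0) w = L (s, 0) w" and pair2_snd: "s * L (0, 1) w = L (0, s) w"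
    for L :: "(real \<times> real) \<Rightarrow>\<^sub>L ((real \<times> real) \<Rightarrow>\<^sub>L real)" and s w
    using pair2[of L s 0 w] pair2[of L 0 s w] by simp_all
  have df'v: "((\<lambda>x. f' x v) has_derivative (\<lambda>h. f'' x h v)) (at x)" if "x \<in> half_plane" for x v
    using df'[OF that] unfolding at_open[OF that]
    by (auto intro!: derivative_eq_intros)
  have dg'v: "((\<lambda>x. g' x v) has_derivative (\<lambda>h. f'' x h v)) (at x)" if "x \<in> half_plane" for x v
    by (rule has_derivative_transform_within_open[OF df'v[OF that] open_half_plane that]) (simp add: fg)
  have du: "(u has_derivative blinfun_apply (g' x)) (at x)" if "x \<in> half_plane" for x
    using df[OF that] unfolding at_open[OF that] by (simp add: fg[OF that])
  have sym: "f'' (x, y) (0, 1) (1, 0) = f'' (x, y) (1, 0) (0, 1)" if "0 < y" for x y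
  proof (rule mixed_partial_derivatives_eq[where u = "\<lambda>x y. u (x, y)"
        and uy = "\<lambda>x y. g' (x, y) (0, 1)" and ux = "\<lambda>x y. g' (x, y) (1, 0)" and x = x and y = y
        and uyx = "\<lambda>x y. f'' (x, y) (1, 0) (0, 1)"])
    have dpy: "((\<lambda>y. (x, y)) has_derivative (\<lambda>h. (0, h))) (at y)" and dpx: "((\<lambda>x. (x, y)) has_derivative (\<lambda>h. (h, 0))) (at x)" for x y :: real
      by (auto intro!: derivative_eq_intros)
    have mem: "(x, y) \<in> half_plane" if "0 < y" for x y :: real using that by (simp add: half_plane_def)
    show "((\<lambda>y. u (x, y)) has_real_derivative g' (x, y) (0, 1)) (at y)" if "0 < y" for x y
      by (rule has_derivative_imp_has_field_derivative[OF has_derivative_compose[OF dpy du[OF mem[OF that]]] pair_snd])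
    show "((\<lambda>x. u (x, y)) has_real_derivative g' (x, y) (1, 0)) (at x)" if "0 < y" for x y
      by (rule has_derivative_imp_has_field_derivative[OF has_derivative_compose[OF dpx du[OF mem[OF that]]] pair_fst])
    show "((\<lambda>x. g' (x, y) (0, 1)) has_real_derivative f'' (x, y) (1, 0) (0, 1)) (at x)" if "0 < y" for x y
      by (rule has_derivative_imp_has_field_derivative[OF has_derivative_compose[OF dpx dg'v[OF mem[OF that]]] pair2_fst])
    show "((\<lambda>y. g' (x, y) (1, 0)) has_real_derivative f'' (x, y) (0, 1) (1, 0)) (at y)"
      by (rule has_derivative_imp_has_field_derivative[OF has_derivative_compose[OF dpy dg'v[OF mem[OF that]]] pair2_snd])
    show "continuous_on (UNIV \<times> {0<..}) (\<lambda>(x, y). f'' (x, y) (1, 0) (0, 1))"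
      using cf'' unfolding half_plane_def case_prod_beta prod.collapse by (intro continuous_intros)
  qed (rule that)
  have lap': "a (1, 0) (1, 0) z + a (0, 1) (0, 1) z = - exp (2 * u (\<iota> z))" if "0 < Im z" for z
    using laplacian_plane_eq[OF du dg'v dg'v, of "\<iota> z"] lap[of "\<iota> z"] that \<iota>_open by (simp add: a_def)
  have sym': "a (0, 1) (1, 0) z = a (1, 0) (0, 1) z" if "0 < Im z" for z
    using sym[OF that] by (simp add: a_def \<iota>_def)
  have dDr: "((\<lambda>z. g' (\<iota> z) v) has_derivative (\<lambda>h. Re h * a (1, 0) v z + Im h * a (0, 1) v z)) (at z)" if "0 < Im z" for z v
  proof -
    have "((\<lambda>z. g' (\<iota> z) v) has_derivative (\<lambda>h. f'' (\<iota> z) (\<iota> h) v)) (at z)"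
      using has_derivative_compose[OF d\<iota> dg'v] that \<iota>_open by blast
    moreover have "f'' (\<iota> z) (\<iota> h) v = Re h * a (1, 0) v z + Im h * a (0, 1) v z" for h
      unfolding a_def using pair2[of "f'' (\<iota> z)" "Re h" "Im h" v] by (simp only: \<iota>_def[of h])
    ultimately show ?thesis by simp
  qed
  have "wirtinger_solution \<kappa> (\<lambda>z. u (\<iota> z)) D E"
  proof
    have "continuous_on closed_half_plane u"
      using dg by (rule has_derivative_continuous_on)
    thus "continuous_on {z. 0 \<le> Im z} (\<lambda>z. u (\<iota> z))"
      by (rule continuous_on_compose2[OF _ c\<iota>]) (auto simp: \<iota>_closed)
    have "continuous_on {z. 0 \<le> Im z} (\<lambda>z. g' (\<iota> z))"
      by (rule continuous_on_compose2[OF cg' c\<iota>]) (auto simp: \<iota>_closed)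
    thus "continuous_on {z. 0 \<le> Im z} D"
      unfolding D_def Complex_eq by (intro continuous_intros) auto
    have "continuous_on {z. 0 < Im z} (\<lambda>z. f'' (\<iota> z))"
      by (rule continuous_on_compose2[OF cf'' c\<iota>]) (auto simp: \<iota>_open)
    thus "continuous_on {z. 0 < Im z} E"
      unfolding E_def a_def Complex_eq by (intro continuous_intros) auto
  next
    fix z :: complex assume z: "0 < Im z"
    have "((\<lambda>z. u (\<iota> z)) has_derivative (\<lambda>h. g' (\<iota> z) (\<iota> h))) (at z)"
      using has_derivative_compose[OF d\<iota> du] z \<iota>_open by blast
    moreover have "g' (\<iota> z) (\<iota> h) = 2 * Re (D z * h)" for h
      using pair[of "g' (\<iota> z)" "Re h" "Im h"] by (simp add: \<iota>_def[of h] D_def algebra_simps)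
    ultimately show "((\<lambda>z. u (\<iota> z)) has_derivative (\<lambda>h. 2 * Re (D z * h))) (at z)" by simp
    have D_alt: "D = (\<lambda>z. of_real (g' (\<iota> z) (1, 0) / 2) - \<i> * of_real (g' (\<iota> z) (0, 1) / 2))"
      by (simp add: fun_eq_iff D_def complex_eq_iff)
    have lin: "((\<lambda>z. of_real (G z / 2) - \<i> * of_real (K z / 2)) has_derivative
        (\<lambda>h. of_real (G' h / 2) - \<i> * of_real (K' h / 2))) (at z)"
      if "(G has_derivative G') (at z)" "(K has_derivative K') (at z)" for G K G' K' :: "complex \<Rightarrow> real"
      by (intro has_derivative_diff has_derivative_mult_right has_derivative_of_real
          bounded_linear.has_derivative[OF bounded_linear_divide] that)
    have "(D has_derivative (\<lambda>h. of_real ((Re h * a (1, 0) (1, 0) z + Im h * a (0, 1) (1, 0) z) / 2)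
       - \<i> * of_real ((Re h * a (1, 0) (0, 1) z + Im h * a (0, 1) (0, 1) z) / 2))) (at z)"
      unfolding D_alt by (rule lin[OF dDr[OF z] dDr[OF z]])
    moreover have "of_real ((Re h * a (1, 0) (1, 0) z + Im h * a (0, 1) (1, 0) z) / 2)
       - \<i> * of_real ((Re h * a (1, 0) (0, 1) z + Im h * a (0, 1) (0, 1) z) / 2)
       = E z * h - of_real (exp (2 * u (\<iota> z)) / 4) * cnj h" for h
    proof -
      have "exp (2 * u (\<iota> z)) = - (a (1, 0) (1, 0) z + a (0, 1) (0, 1) z)" using lap'[OF z] by simp
      thus ?thesis by (simp only:) (simp add: E_def complex_eq_iff sym'[OF z] field_simps)
    qed
    ultimately show "(D has_derivative (\<lambda>h. E z * h - of_real (exp (2 * u (\<iota> z)) / 4) * cnj h)) (at z)" by simp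
  next
    fix x :: real
    have "((\<lambda>x. (x, 0::real)) has_derivative (\<lambda>h. (h, 0))) (at x)" by (auto intro!: derivative_eq_intros)
    hence "((\<lambda>x. u (x, 0)) has_derivative (\<lambda>h. g' (x, 0) (h, 0))) (at x)"
      by (intro has_derivative_in_compose2[of closed_half_plane u "\<lambda>p. blinfun_apply (g' p)" _ UNIV, OF dg])
        (auto simp: closed_half_plane_def)
    from has_derivative_imp_has_field_derivative[OF this pair_fst]
    show "((\<lambda>x. u (\<iota> (of_real x))) has_real_derivative 2 * Re (D (of_real x))) (at x)"
      by (simp add: \<iota>_def D_def)
    show N: "((\<lambda>s. u (\<iota> (Complex x s))) has_real_derivative - \<kappa> * exp (u (\<iota> (of_real x)))) (at 0 within {0..})"
      using neumann[of x] by (simp add: \<iota>_def)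
    have "((\<lambda>s. (x, s::real)) has_derivative (\<lambda>h. (0, h))) (at 0 within {0..})" by (auto intro!: derivative_eq_intros)
    hence "((\<lambda>s. u (x, s)) has_derivative (\<lambda>h. g' (x, 0) (0, h))) (at 0 within {0..})"
      by (intro has_derivative_in_compose2[of closed_half_plane u "\<lambda>p. blinfun_apply (g' p)" _ "{0..}", OF dg])
        (auto simp: closed_half_plane_def)
    from has_derivative_imp_has_field_derivative[OF this pair_snd]
    have "((\<lambda>s. u (x, s)) has_real_derivative g' (x, 0) (0, 1)) (at 0 within {0..})" .
    moreover have "{0::real..} - {0} = {0<..}" by auto
    hence "at (0::real) within {0..} \<noteq> bot" by (simp add: at_within_eq_bot_iff)
    ultimately have "g' (x, 0) (0, 1) = - \<kappa> * exp (u (x, 0))"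
      using neumann[of x] by (metis has_field_derivative_unique)
    thus "Im (D (of_real x)) = \<kappa> / 2 * exp (u (\<iota> (of_real x)))"
      by (simp add: D_def \<iota>_def)
  qed
  thus ?thesis unfolding \<iota>_def by blast
qed

section \<open>The coefficient of the oscillator equation\<close>

text \<open>The Poincare lemma for \<open>p dz + q d(cnj z)\<close>; the form is closed because the same \<open>m\<close> is the derivative of \<open>p\<close> in
  \<open>cnj z\<close> and of \<open>q\<close> in \<open>z\<close>. The potential is the integral along the segment from \<open>z0\<close>. As this integral involves
  no derivatives of \<open>p\<close> and \<open>q\<close>, it is continuous on the larger set \<open>C\<close>, where they are merely continuous.\<close>

lemma closed_wirtinger_form_potential:
  fixes p q :: "complex \<Rightarrow> complex"
  assumes "convex C" "convex S" "open S" "S \<subseteq> C" "z0 \<in> S"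
    and pc: "continuous_on C p" and qc: "continuous_on C q"
    and dp: "\<And>z. z \<in> S \<Longrightarrow> (p has_derivative (\<lambda>h. p1 z * h + m z * cnj h)) (at z)"
    and dq: "\<And>z. z \<in> S \<Longrightarrow> (q has_derivative (\<lambda>h. m z * h + q2 z * cnj h)) (at z)"
    and c1: "continuous_on S p1" and c2: "continuous_on S m" and c3: "continuous_on S q2"
  obtains P where "continuous_on C P"
    "\<And>z. z \<in> S \<Longrightarrow> (P has_derivative (\<lambda>h. p z * h + q z * cnj h)) (at z)"
proof -
  define g where "g z s = z0 + of_real s * (z - z0)" for z and s :: real
  have g_C: "g z s \<in> C" if "z \<in> C" "s \<in> {0..1}" for z s
    using convexD_alt[OF \<open>convex C\<close>, of z0 z s] that \<open>z0 \<in> S\<close> \<open>S \<subseteq> C\<close>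
    by (auto simp: g_def scaleR_conv_of_real algebra_simps)
  have g_S: "g z s \<in> S" if "z \<in> S" "s \<in> {0..1}" for z s
    using convexD_alt[OF \<open>convex S\<close>, of z0 z s] that \<open>z0 \<in> S\<close>
    by (auto simp: g_def scaleR_conv_of_real algebra_simps)
  have cg: "continuous_on T (\<lambda>x. g (fst x) (snd x))" for T unfolding g_def by (intro continuous_intros)
  have comp: "continuous_on (A \<times> {0..1}) (\<lambda>x. k (g (fst x) (snd x)))" if "continuous_on A k" "\<And>z s. z \<in> A \<Longrightarrow> s \<in> {0..1} \<Longrightarrow> g z s \<in> A"
    for A and k :: "complex \<Rightarrow> complex"
    by (rule continuous_on_compose2[OF that(1) cg]) (use that(2) in auto)
  define I where "I z s = p (g z s) * (z - z0) + q (g z s) * cnj (z - z0)" for z s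
  define P where "P z = integral (cbox 0 1) (I z)" for z
  have Ic: "continuous_on (C \<times> cbox 0 1) (\<lambda>(z, s). I z s)"
    unfolding I_def case_prod_beta interval_cbox[symmetric]
    by (intro continuous_intros comp pc qc g_C)
  show ?thesis
  proof (rule that)
    show "continuous_on C P" unfolding P_def by (rule integral_continuous_on_param[OF Ic])
    fix z assume z: "z \<in> S"
    define cnjL where "cnjL = Blinfun cnj"
    have cnjL: "blinfun_apply cnjL = cnj"
      unfolding cnjL_def by (rule bounded_linear_Blinfun_apply) (rule bounded_linear_cnj)
    define LL where "LL a b = blinfun_mult_right a + (blinfun_mult_right b o\<^sub>L cnjL)" for a b
    have LL: "blinfun_apply (LL a b) h = a * h + b * cnj h" for a b h
      by (simp add: LL_def blinfun.add_left cnjL)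
    \<comment> \<open>\<open>LL (\<alpha> z s) (\<beta> z s)\<close> is the derivative of the integrand in \<open>z\<close>; closedness makes \<open>\<alpha>\<close> and \<open>\<beta>\<close> the \<open>s\<close>-derivatives of \<open>s * p\<close> and \<open>s * q\<close> along the segment.\<close>
    define \<alpha> where "\<alpha> z s = of_real s * (p1 (g z s) * (z - z0) + m (g z s) * cnj (z - z0)) + p (g z s)" for z s
    define \<beta> where "\<beta> z s = of_real s * (m (g z s) * (z - z0) + q2 (g z s) * cnj (z - z0)) + q (g z s)" for z s
    have \<alpha>c: "continuous_on (S \<times> {0..1}) (\<lambda>x. \<alpha> (fst x) (snd x))"
      unfolding \<alpha>_def by (intro continuous_intros comp c1 c2 g_S continuous_on_subset[OF pc \<open>S \<subseteq> C\<close>])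
    have \<beta>c: "continuous_on (S \<times> {0..1}) (\<lambda>x. \<beta> (fst x) (snd x))"
      unfolding \<beta>_def by (intro continuous_intros comp c2 c3 g_S continuous_on_subset[OF qc \<open>S \<subseteq> C\<close>])
    have dI: "((\<lambda>z. I z s) has_derivative blinfun_apply (LL (\<alpha> z s) (\<beta> z s))) (at z within S)"
      if "z \<in> S" "s \<in> cbox 0 1" for z s
    proof -
      have dg: "((\<lambda>z. g z s) has_derivative (\<lambda>h. of_real s * h)) (at z)"
        unfolding g_def by (auto intro!: derivative_eq_intros)
      have gs: "g z s \<in> S" using g_S that by simp
      have "((\<lambda>z. I z s) has_derivative (\<lambda>h.
          p (g z s) * h + (p1 (g z s) * (of_real s * h) + m (g z s) * cnj (of_real s * h)) * (z - z0)
          + (q (g z s) * cnj h + (m (g z s) * (of_real s * h) + q2 (g z s) * cnj (of_real s * h)) * cnj (z - z0)))) (at z)"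
        unfolding I_def
        by (rule derivative_eq_intros has_derivative_compose[OF dg dp[OF gs]] has_derivative_compose[OF dg dq[OF gs]] refl)+ simp
      moreover have "p (g z s) * h + (p1 (g z s) * (of_real s * h) + m (g z s) * cnj (of_real s * h)) * (z - z0)
          + (q (g z s) * cnj h + (m (g z s) * (of_real s * h) + q2 (g z s) * cnj (of_real s * h)) * cnj (z - z0))
          = blinfun_apply (LL (\<alpha> z s) (\<beta> z s)) h" for h
        unfolding LL \<alpha>_def \<beta>_def by (simp add: algebra_simps)
      ultimately show ?thesis by (auto intro: has_derivative_at_withinI)
    qed
    have FTC: "(\<alpha> z has_integral p z) {0..1}" "(\<beta> z has_integral q z) {0..1}"
    proof -
      have dgs: "(g z has_derivative (\<lambda>h. of_real h * (z - z0))) (at s)" for s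
        unfolding g_def by (auto intro!: derivative_eq_intros)
      have "((\<lambda>s. of_real s * p (g z s)) has_vector_derivative \<alpha> z s) (at s within {0..1})" if "s \<in> {0..1}" for s
      proof -
        have "((\<lambda>s. of_real s * p (g z s)) has_derivative (\<lambda>h. of_real s * (p1 (g z s) * (of_real h * (z - z0))
            + m (g z s) * cnj (of_real h * (z - z0))) + of_real h * p (g z s))) (at s)"
          by (rule derivative_eq_intros has_derivative_compose[OF dgs dp[OF g_S[OF z that]]] refl)+
        thus ?thesis
          by (auto simp: has_vector_derivative_def \<alpha>_def scaleR_conv_of_real algebra_simps intro!: has_derivative_at_withinI
              elim!: has_derivative_eq_rhs)
      qed
      from fundamental_theorem_of_calculus[OF _ this] show "(\<alpha> z has_integral p z) {0..1}"
        by (simp add: g_def)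
      have "((\<lambda>s. of_real s * q (g z s)) has_vector_derivative \<beta> z s) (at s within {0..1})" if "s \<in> {0..1}" for s
      proof -
        have "((\<lambda>s. of_real s * q (g z s)) has_derivative (\<lambda>h. of_real s * (m (g z s) * (of_real h * (z - z0))
            + q2 (g z s) * cnj (of_real h * (z - z0))) + of_real h * q (g z s))) (at s)"
          by (rule derivative_eq_intros has_derivative_compose[OF dgs dq[OF g_S[OF z that]]] refl)+
        thus ?thesis
          by (auto simp: has_vector_derivative_def \<beta>_def scaleR_conv_of_real algebra_simps intro!: has_derivative_at_withinI
              elim!: has_derivative_eq_rhs)
      qed
      from fundamental_theorem_of_calculus[OF _ this] show "(\<beta> z has_integral q z) {0..1}"
        by (simp add: g_def)
    qed
    have bl1: "bounded_linear (blinfun_mult_right :: complex \<Rightarrow> _)" by (rule bounded_linear_blinfun_mult_right)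
    have bl2: "bounded_linear (\<lambda>b. blinfun_mult_right b o\<^sub>L cnjL)"
      by (rule bounded_linear_compose[OF bounded_bilinear.bounded_linear_left[OF bounded_bilinear_blinfun_compose] bl1])
    have "((\<lambda>s. LL (\<alpha> z s) (\<beta> z s)) has_integral LL (p z) (q z)) {0..1}"
      using has_integral_add[OF has_integral_linear[OF FTC(1) bl1] has_integral_linear[OF FTC(2) bl2]]
      by (simp add: o_def LL_def)
    hence int: "integral (cbox 0 1) (\<lambda>s. LL (\<alpha> z s) (\<beta> z s)) = LL (p z) (q z)"
      by (simp add: integral_unique)
    have "(P has_derivative blinfun_apply (integral (cbox 0 1) (\<lambda>s. LL (\<alpha> z s) (\<beta> z s)))) (at z within S)"
      unfolding P_def
    proof (rule leibniz_rule[OF dI])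
      show "I z integrable_on cbox 0 1" if "z \<in> S" for z
      proof -
        have "continuous_on (cbox 0 1) (\<lambda>s. case (z, s) of (z, s) \<Rightarrow> I z s)"
          by (rule continuous_on_compose2[OF Ic]) (use that \<open>S \<subseteq> C\<close> in \<open>auto intro!: continuous_intros\<close>)
        thus ?thesis by (intro integrable_continuous) simp
      qed
      show "continuous_on (S \<times> cbox 0 1) (\<lambda>(x, s). LL (\<alpha> x s) (\<beta> x s))"
        unfolding LL_def case_prod_beta interval_cbox[symmetric]
        by (intro continuous_on_add bounded_linear.continuous_on[OF bl1] bounded_linear.continuous_on[OF bl2] \<alpha>c \<beta>c)
    qed (use z \<open>convex S\<close> in auto)
    hence "(P has_derivative (\<lambda>h. p z * h + q z * cnj h)) (at z within S)"
      unfolding int LL[abs_def] .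
    thus "(P has_derivative (\<lambda>h. p z * h + q z * cnj h)) (at z)"
      using at_within_open[OF z \<open>open S\<close>] by simp
  qed
qed

lemma continuous_eq_zero_closed_upper_half_plane:
  fixes k :: "complex \<Rightarrow> 'a::real_normed_vector"
  assumes "continuous_on {z. 0 \<le> Im z} k" and "\<And>z. 0 < Im z \<Longrightarrow> k z = 0" and "0 \<le> Im z"
  shows "k z = 0"
proof -
  have "closure {z. 0 < Im z} = {z. 0 \<le> Im z}"
    using closure_halfspace_gt[of "\<i>" 0] by (simp add: inner_complex_def)
  thus ?thesis using continuous_constant_on_closure[of "{z. 0 < Im z}" k 0 z] assms by simp
qed

context wirtinger_solution
begin

text \<open>\<open>F = D + P\<close> is holomorphic since the derivatives of \<open>D\<close> and \<open>P\<close> in \<open>cnj z\<close> cancel, and its derivative is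
  \<open>E - D\<^sup>2\<close>. On the boundary, the imaginary part of \<open>D\<close> is \<open>\<kappa> / 2 * exp U\<close>, and that of \<open>P\<close> changes by the integral of
  \<open>- Im (D\<^sup>2) = - \<kappa> * exp U * Re D\<close>, which is the tangential derivative of \<open>- \<kappa> / 2 * exp U\<close>. So \<open>F\<close> minus an imaginary
  constant is real on the real axis and can be reflected.\<close>

lemma schwarzian_extends_entire:
  obtains f where "f holomorphic_on UNIV" "\<And>z. f (cnj z) = cnj (f z)"
    "\<And>z. 0 < Im z \<Longrightarrow> f z = E z - (D z)\<^sup>2"
proof -
  let ?C = "{z. 0 \<le> Im z}" and ?S = "{z. 0 < Im z}"
  define p where "p z = - (D z)\<^sup>2" for z
  define q where "q z = complex_of_real (exp (2 * U z) / 4)" for z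
  define m where "m z = D z * of_real (exp (2 * U z) / 2)" for z
  have sub: "?S \<subseteq> ?C" by auto
  have DcS: "continuous_on ?S D" and UcS: "continuous_on ?S U"
    by (rule continuous_on_subset[OF D_cont sub] continuous_on_subset[OF U_cont sub])+
  have pc: "continuous_on ?C p" unfolding p_def by (intro continuous_intros D_cont)
  have qc: "continuous_on ?C q" unfolding q_def by (intro continuous_intros U_cont) auto
  obtain P where Pc: "continuous_on ?C P"
    and dP: "\<And>z. z \<in> ?S \<Longrightarrow> (P has_derivative (\<lambda>h. p z * h + q z * cnj h)) (at z)"
  proof (rule closed_wirtinger_form_potential[of ?C ?S "\<i>" p q "\<lambda>z. - 2 * D z * E z" m "\<lambda>z. of_real (exp (2 * U z) / 2) * cnj (D z)"])
    show "(p has_derivative (\<lambda>h. - 2 * D z * E z * h + m z * cnj h)) (at z)" if "z \<in> ?S" for z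
    proof -
      have "(p has_derivative (\<lambda>h. - (2 * (E z * h - of_real (exp (2 * U z) / 4) * cnj h) * D z))) (at z)"
        unfolding p_def using that
        by (auto intro!: derivative_eq_intros D_deriv)
      thus ?thesis by (rule has_derivative_eq_rhs) (simp add: fun_eq_iff m_def algebra_simps)
    qed
    show "(q has_derivative (\<lambda>h. m z * h + of_real (exp (2 * U z) / 2) * cnj (D z) * cnj h)) (at z)" if "z \<in> ?S" for z
    proof -
      have "((\<lambda>z. exp (2 * U z)) has_derivative (\<lambda>h. (2 * (2 * Re (D z * h))) * exp (2 * U z))) (at z)"
        using that by (intro has_derivative_exp has_derivative_mult_right U_deriv) simp
      hence "(q has_derivative (\<lambda>h. of_real ((2 * (2 * Re (D z * h))) * exp (2 * U z) / 4))) (at z)"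
        unfolding q_def by (intro has_derivative_of_real bounded_linear.has_derivative[OF bounded_linear_divide])
      moreover have "of_real ((2 * (2 * Re (D z * h))) * exp (2 * U z) / 4)
          = m z * h + of_real (exp (2 * U z) / 2) * cnj (D z) * cnj h" for h
      proof -
        have "of_real ((2 * (2 * Re (D z * h))) * exp (2 * U z) / 4) = of_real (exp (2 * U z) / 2) * complex_of_real (2 * Re (D z * h))"
          by simp
        also have "complex_of_real (2 * Re (D z * h)) = D z * h + cnj (D z * h)" by (rule complex_add_cnj[symmetric])
        also have "of_real (exp (2 * U z) / 2) * (D z * h + cnj (D z * h))
            = m z * h + of_real (exp (2 * U z) / 2) * cnj (D z) * cnj h" by (simp add: m_def algebra_simps)
        finally show ?thesis .
      qed
      ultimately show ?thesis by (simp only:)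
    qed
    show "continuous_on ?S (\<lambda>z. - 2 * D z * E z)" "continuous_on ?S m"
      "continuous_on ?S (\<lambda>z. of_real (exp (2 * U z) / 2) * cnj (D z))"
      unfolding m_def by (intro continuous_intros DcS UcS E_cont; simp)+
  qed (auto intro: pc qc convex_halfspace_Im_ge convex_halfspace_Im_gt open_halfspace_Im_gt)
  \<comment> \<open>\<open>P\<close> is not known to be differentiable on the boundary, so its increments there are limits of increments on horizontal lines above.\<close>
  have boundary_integral: "((\<lambda>x. p (of_real x) + q (of_real x)) has_integral P (of_real b) - P (of_real a)) {a..b}"
    if "a \<le> b" for a b
  proof -
    have cline: "continuous_on T (\<lambda>x. k (Complex (g x) (h x)))"
      if "continuous_on ?C k" "continuous_on T g" "continuous_on T h" "\<And>x. x \<in> T \<Longrightarrow> 0 \<le> h x"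
      for k :: "complex \<Rightarrow> complex" and g h :: "'a::topological_space \<Rightarrow> real" and T
      by (rule continuous_on_compose2[OF that(1)]) (use that in \<open>auto simp: Complex_eq intro!: continuous_intros\<close>)
    have pqc: "continuous_on ?C (\<lambda>z. p z + q z)" using pc qc by (intro continuous_intros)
    define J where "J y = integral (cbox a b) (\<lambda>x. p (Complex x y) + q (Complex x y))" for y
    define L where "L y = P (Complex b y) - P (Complex a y)" for y
    have Jc: "continuous_on {0..} J"
      unfolding J_def
    proof (rule integral_continuous_on_param)
      show "continuous_on ({0..} \<times> cbox a b) (\<lambda>(y, x). p (Complex x y) + q (Complex x y))"
        unfolding case_prod_beta by (rule cline[OF pqc]) (auto intro!: continuous_intros)
    qed
    have Lc: "continuous_on {0..} L"
      unfolding L_def by (intro continuous_on_diff cline[OF Pc]) (auto intro!: continuous_intros)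
    have "J y = L y" if "0 < y" for y
    proof -
      have "((\<lambda>x. P (Complex x y)) has_vector_derivative p (Complex x y) + q (Complex x y)) (at x within {a..b})" for x
        using has_derivative_along_real[OF dP, of x y] that by (auto intro: has_vector_derivative_at_within)
      from fundamental_theorem_of_calculus[OF \<open>a \<le> b\<close> this] show ?thesis
        by (simp add: J_def L_def integral_unique)
    qed
    hence "J 0 - L 0 = 0"
      using continuous_constant_on_closure[of "{0<..}" "\<lambda>y. J y - L y" 0 0] Jc Lc by (auto intro!: continuous_intros)
    moreover have "continuous_on {a..b} (\<lambda>x. p (Complex x 0) + q (Complex x 0))"
      by (rule cline[OF pqc]) (auto intro!: continuous_intros)
    ultimately show ?thesis
      using integrable_integral[OF integrable_continuous_real, of a b "\<lambda>x. p (Complex x 0) + q (Complex x 0)"]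
      by (simp add: J_def L_def complex_of_real_def)
  qed
  define F where "F z = D z + P z" for z
  have Im_const: "Im (F (of_real b)) = Im (F (of_real a))" if "a \<le> b" for a b
  proof -
    have "((\<lambda>x. Im (p (of_real x) + q (of_real x))) has_integral Im (P (of_real b) - P (of_real a))) {a..b}"
      using has_integral_linear[OF boundary_integral[OF that] bounded_linear_Im] by (simp add: o_def)
    moreover have "((\<lambda>x. Im (p (of_real x) + q (of_real x))) has_integral
        - \<kappa> / 2 * exp (U (of_real b)) - (- \<kappa> / 2 * exp (U (of_real a)))) {a..b}"
    proof (rule fundamental_theorem_of_calculus[OF that])
      fix x :: real
      have "((\<lambda>x. - \<kappa> / 2 * exp (U (of_real x))) has_real_derivative - \<kappa> / 2 * (exp (U (of_real x)) * (2 * Re (D (of_real x))))) (at x)"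
        by (intro DERIV_cmult DERIV_fun_exp U_tangential)
      moreover have "Im (p (of_real x) + q (of_real x)) = - \<kappa> / 2 * (exp (U (of_real x)) * (2 * Re (D (of_real x))))"
        using D_boundary[of x] by (simp add: p_def q_def power2_eq_square)
      ultimately show "((\<lambda>x. - \<kappa> / 2 * exp (U (of_real x))) has_vector_derivative Im (p (of_real x) + q (of_real x))) (at x within {a..b})"
        by (simp add: has_real_derivative_iff_has_vector_derivative has_vector_derivative_at_within)
    qed
    ultimately have "Im (P (of_real b) - P (of_real a)) = - \<kappa> / 2 * exp (U (of_real b)) - (- \<kappa> / 2 * exp (U (of_real a)))"
      by (rule has_integral_unique)
    thus ?thesis by (simp add: F_def D_boundary)
  qed
  define c where "c = Im (F 0)"
  have ImF: "Im (F (of_real x)) = c" for x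
    using Im_const[of 0 x] Im_const[of x 0] by (cases "0 \<le> x") (auto simp: c_def)
  define F0 where "F0 z = F z - \<i> * of_real c" for z
  have dF0: "(F0 has_field_derivative E z - (D z)\<^sup>2) (at z)" if "0 < Im z" for z
  proof -
    have "(F0 has_derivative (\<lambda>h. (E z * h - of_real (exp (2 * U z) / 4) * cnj h) + (p z * h + q z * cnj h) - 0)) (at z)"
      unfolding F0_def F_def using that by (intro has_derivative_diff has_derivative_add D_deriv dP has_derivative_const) auto
    thus ?thesis unfolding has_field_derivative_def
      by (rule has_derivative_eq_rhs) (simp add: fun_eq_iff p_def q_def algebra_simps)
  qed
  define G where "G z = (if 0 \<le> Im z then F0 z else cnj (F0 (cnj z)))" for z
  have Ghol: "G holomorphic_on UNIV"
    unfolding G_def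
  proof (rule Schwarz_reflection)
    show "F0 holomorphic_on UNIV \<inter> ?S"
      using dF0 by (subst holomorphic_on_open) (auto simp: open_halfspace_Im_gt)
    show "continuous_on (UNIV \<inter> ?C) F0"
      unfolding F0_def F_def using D_cont Pc by (auto intro!: continuous_intros)
    show "F0 z \<in> \<real>" if "z \<in> \<real>" for z
    proof -
      from that obtain x where "z = of_real x" by (rule Reals_cases)
      thus ?thesis using ImF[of x] by (simp add: F0_def complex_is_Real_iff)
    qed
  qed auto
  have Gcnj: "G (cnj z) = cnj (G z)" for z
  proof (cases "Im z = 0")
    case True
    then obtain x where x: "z = of_real x" by (metis complex_is_Real_iff Reals_cases)
    show ?thesis unfolding x using ImF[of x] by (simp add: G_def F0_def complex_eq_iff)
  qed (auto simp: G_def)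
  show ?thesis
  proof (rule that[of "deriv G"])
    show "deriv G holomorphic_on UNIV" by (intro holomorphic_deriv Ghol open_UNIV)
    show "deriv G (cnj z) = cnj (deriv G z)" for z
    proof -
      have "((\<lambda>z. cnj (G (cnj z))) has_field_derivative cnj (deriv G z)) (at (cnj z))"
        using has_field_derivative_cnj_cnj[of G "deriv G z" "cnj z"] holomorphic_derivI[OF Ghol open_UNIV UNIV_I]
        by (simp add: o_def)
      moreover have "(\<lambda>z. cnj (G (cnj z))) = G" by (simp add: Gcnj)
      ultimately show ?thesis using DERIV_imp_deriv by force
    qed
    show "deriv G z = E z - (D z)\<^sup>2" if "0 < Im z" for z
    proof -
      have "(G has_field_derivative E z - (D z)\<^sup>2) (at z)"
        by (rule has_field_derivative_transform_within_open[OF dF0[OF that] open_halfspace_Im_gt[of 0]])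
          (use that in \<open>auto simp: G_def\<close>)
      thus ?thesis by (rule DERIV_imp_deriv)
    qed
  qed
qed

text \<open>The sesquilinear form is the Wronskian-type pairing of \<open>\<phi>\<close> and \<open>\<psi>\<close> with \<open>w = exp (- U)\<close> in both \<open>z\<close> and
  \<open>cnj z\<close>: written with the derivatives of \<open>w\<close> it is
  \<open>w \<phi>' cnj \<psi>' - w\<^sub>z \<phi> cnj \<psi>' - cnj w\<^sub>z \<phi>' cnj \<psi> + m \<phi> cnj \<psi>\<close>, where \<open>m\<close> is the mixed second derivative of \<open>w\<close>. The
  completed form stated here contains no second derivatives, so it can be differentiated.\<close>

lemma sesquilinear_constant:
  assumes f: "\<And>z. 0 < Im z \<Longrightarrow> f z = E z - (D z)\<^sup>2"
    and \<phi>: "\<And>z. (\<phi> has_field_derivative \<phi>' z) (at z)" "\<And>z. (\<phi>' has_field_derivative - f z * \<phi> z) (at z)"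
    and \<psi>: "\<And>z. (\<psi> has_field_derivative \<psi>' z) (at z)" "\<And>z. (\<psi>' has_field_derivative - f z * \<psi> z) (at z)"
  shows "\<exists>B. \<forall>z. 0 < Im z \<longrightarrow>
    of_real (exp (- U z)) * (\<phi>' z + D z * \<phi> z) * cnj (\<psi>' z + D z * \<psi> z)
      + of_real (exp (U z) / 4) * \<phi> z * cnj (\<psi> z) = B"
proof -
  define B where "B z = of_real (exp (- U z)) * ((\<phi>' z + D z * \<phi> z) * cnj (\<psi>' z + D z * \<psi> z))
      + of_real (exp (U z)) * (\<phi> z * cnj (\<psi> z) / 4)" for z
  have "(B has_derivative (\<lambda>h. 0)) (at z within {z. 0 < Im z})" if "z \<in> {z. 0 < Im z}" for z
  proof -
    from that have z: "0 < Im z" by simp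
    have real: "complex_of_real (2 * Re w * x) = (w + cnj w) * of_real x" for w x by (simp add: complex_add_cnj)
    define a b where "a = complex_of_real (exp (- U z))" and "b = complex_of_real (exp (U z))"
    have ab: "a * b = 1" by (simp add: a_def b_def flip: of_real_mult exp_add)
    have bb: "of_real (exp (2 * U z) / 4) = b * b / 4" by (simp add: b_def exp_double power2_eq_square)
    define X Y where "X = \<phi>' z + D z * \<phi> z" and "Y = \<psi>' z + D z * \<psi> z"
    have exp_minus: "((\<lambda>z. complex_of_real (exp (- U z))) has_derivative (\<lambda>h. - (D z * h + cnj (D z * h)) * a)) (at z)"
    proof -
      have "((\<lambda>z. complex_of_real (exp (- U z))) has_derivative (\<lambda>h. of_real (- (2 * Re (D z * h)) * exp (- U z)))) (at z)"
        by (intro has_derivative_of_real has_derivative_exp has_derivative_minus U_deriv z)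
      thus ?thesis unfolding mult_minus_left of_real_minus real a_def .
    qed
    have exp_plus: "((\<lambda>z. complex_of_real (exp (U z))) has_derivative (\<lambda>h. (D z * h + cnj (D z * h)) * b)) (at z)"
    proof -
      have "((\<lambda>z. complex_of_real (exp (U z))) has_derivative (\<lambda>h. of_real ((2 * Re (D z * h)) * exp (U z)))) (at z)"
        by (intro has_derivative_of_real has_derivative_exp U_deriv z)
      thus ?thesis unfolding real b_def .
    qed
    have dX: "((\<lambda>z. \<zeta>' z + D z * \<zeta> z) has_derivative (\<lambda>h. D z * (\<zeta>' z + D z * \<zeta> z) * h - b * b / 4 * \<zeta> z * cnj h)) (at z)"
      if "(\<zeta> has_field_derivative \<zeta>' z) (at z)" "(\<zeta>' has_field_derivative - f z * \<zeta> z) (at z)" for \<zeta> \<zeta>'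
    proof -
      have "((\<lambda>z. \<zeta>' z + D z * \<zeta> z) has_derivative
         (\<lambda>h. - f z * \<zeta> z * h + (D z * (\<zeta>' z * h) + (E z * h - of_real (exp (2 * U z) / 4) * cnj h) * \<zeta> z))) (at z)"
        by (intro has_derivative_add has_derivative_mult D_deriv z that[THEN has_field_derivative_imp_has_derivative])
      thus ?thesis
        by (rule has_derivative_eq_rhs) (unfold bb f[OF z], simp add: fun_eq_iff algebra_simps power2_eq_square)
    qed
    note imp = has_field_derivative_imp_has_derivative
    note d1 = has_derivative_mult[OF dX[OF \<phi>(1) \<phi>(2)] has_derivative_cnj[OF dX[OF \<psi>(1) \<psi>(2)]]]
    note d2 = bounded_linear.has_derivative[OF bounded_linear_divide
        has_derivative_mult[OF imp[OF \<phi>(1)] has_derivative_cnj[OF imp[OF \<psi>(1)]]], of 4]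
    have "(B has_derivative (\<lambda>h. (a * (X * cnj (D z * Y * h - b * b / 4 * \<psi> z * cnj h) + (D z * X * h - b * b / 4 * \<phi> z * cnj h) * cnj Y)
        + (- (D z * h + cnj (D z * h)) * a) * (X * cnj Y))
      + (b * ((\<phi> z * cnj (\<psi>' z * h) + \<phi>' z * h * cnj (\<psi> z)) / 4) + (D z * h + cnj (D z * h)) * b * (\<phi> z * cnj (\<psi> z) / 4)))) (at z)"
      using has_derivative_add[OF has_derivative_mult[OF exp_minus d1] has_derivative_mult[OF exp_plus d2]]
      unfolding B_def X_def Y_def a_def b_def .
    moreover have "(a * (X * cnj (D z * Y * h - b * b / 4 * \<psi> z * cnj h) + (D z * X * h - b * b / 4 * \<phi> z * cnj h) * cnj Y)
        + (- (D z * h + cnj (D z * h)) * a) * (X * cnj Y))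
      + (b * ((\<phi> z * cnj (\<psi>' z * h) + \<phi>' z * h * cnj (\<psi> z)) / 4) + (D z * h + cnj (D z * h)) * b * (\<phi> z * cnj (\<psi> z) / 4)) = 0" for h
    proof -
      have cb: "cnj b = b" by (simp add: b_def)
      have abb: "a * (b * b) = b" using ab by (simp flip: mult.assoc)
      have "(a * (X * cnj (D z * Y * h - b * b / 4 * \<psi> z * cnj h) + (D z * X * h - b * b / 4 * \<phi> z * cnj h) * cnj Y)
        + (- (D z * h + cnj (D z * h)) * a) * (X * cnj Y))
       = - (a * (b * b)) / 4 * (X * cnj (\<psi> z) * h + \<phi> z * cnj h * cnj Y)"
        by (simp add: cb algebra_simps)
      also have "\<dots> = - (b / 4 * (X * cnj (\<psi> z) * h + \<phi> z * cnj h * cnj Y))" by (simp add: abb)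
      finally have e1: "(a * (X * cnj (D z * Y * h - b * b / 4 * \<psi> z * cnj h) + (D z * X * h - b * b / 4 * \<phi> z * cnj h) * cnj Y)
        + (- (D z * h + cnj (D z * h)) * a) * (X * cnj Y))
          = - (b / 4 * (X * cnj (\<psi> z) * h + \<phi> z * cnj h * cnj Y))" .
      have e2: "b * ((\<phi> z * cnj (\<psi>' z * h) + \<phi>' z * h * cnj (\<psi> z)) / 4) + (D z * h + cnj (D z * h)) * b * (\<phi> z * cnj (\<psi> z) / 4)
          = b / 4 * (X * cnj (\<psi> z) * h + \<phi> z * cnj h * cnj Y)"
        by (simp add: X_def Y_def algebra_simps add_divide_distrib)
      show ?thesis unfolding e1 e2 by simp
    qed
    ultimately show ?thesis by (auto intro: has_derivative_at_withinI)
  qed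
  from has_derivative_zero_constant[OF convex_halfspace_Im_gt this]
  show ?thesis unfolding B_def by (auto simp: mult.assoc)
qed

text \<open>The four constants of \<open>sesquilinear_constant\<close> form the Gram matrix, at any point, of two vectors with
  determinant of modulus \<open>1/2\<close>; this gives the determinant \<open>1/4\<close> and positivity. The relations
  can be solved for \<open>exp (- U)\<close> because the Wronskian is \<open>1\<close>; the boundary is reached by continuity.\<close>

lemma exp_minus_U_hermitian_form:
  assumes f: "\<And>z. 0 < Im z \<Longrightarrow> f z = E z - (D z)\<^sup>2"
    and \<phi>: "\<And>z. (\<phi> has_field_derivative \<phi>' z) (at z)" "\<And>z. (\<phi>' has_field_derivative - f z * \<phi> z) (at z)"
    and \<psi>: "\<And>z. (\<psi> has_field_derivative \<psi>' z) (at z)" "\<And>z. (\<psi>' has_field_derivative - f z * \<psi> z) (at z)"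
    and W: "\<And>z. \<phi> z * \<psi>' z - \<phi>' z * \<psi> z = 1"
  shows "\<exists>a b g. 0 < a \<and> 0 < b \<and> a * b = 1 / 4 + (cmod g)\<^sup>2 \<and> (\<forall>z. 0 \<le> Im z \<longrightarrow>
    exp (- U z) = a * (cmod (\<psi> z))\<^sup>2 + b * (cmod (\<phi> z))\<^sup>2 + 2 * Re (g * \<psi> z * cnj (\<phi> z)))"
proof -
  define B where "B \<zeta> \<zeta>' \<eta> \<eta>' z = of_real (exp (- U z)) * (\<zeta>' z + D z * \<zeta> z) * cnj (\<eta>' z + D z * \<eta> z)
      + of_real (exp (U z) / 4) * \<zeta> z * cnj (\<eta> z)" for \<zeta> \<zeta>' \<eta> \<eta>' :: "complex \<Rightarrow> complex" and z
  note const = sesquilinear_constant[OF f, folded B_def]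
  obtain B11 where B11: "\<And>z. 0 < Im z \<Longrightarrow> B \<phi> \<phi>' \<phi> \<phi>' z = B11" using const[OF _ \<phi> \<phi>] by blast
  obtain B12 where B12: "\<And>z. 0 < Im z \<Longrightarrow> B \<phi> \<phi>' \<psi> \<psi>' z = B12" using const[OF _ \<phi> \<psi>] by blast
  obtain B22 where B22: "\<And>z. 0 < Im z \<Longrightarrow> B \<psi> \<psi>' \<psi> \<psi>' z = B22" using const[OF _ \<psi> \<psi>] by blast
  have diag: "B \<zeta> \<zeta>' \<zeta> \<zeta>' z = of_real (exp (- U z) * (cmod (\<zeta>' z + D z * \<zeta> z))\<^sup>2 + exp (U z) / 4 * (cmod (\<zeta> z))\<^sup>2)" for \<zeta> \<zeta>' z
    unfolding B_def of_real_add of_real_mult complex_norm_square by (simp add: mult_ac)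
  define a b where "a = Re B11" and "b = Re B22"
  have a: "B11 = of_real a" and a0: "0 \<le> a" using B11[of \<i>] diag[of \<phi> \<phi>' \<i>] by (auto simp: a_def)
  have b: "B22 = of_real b" and b0: "0 \<le> b" using B22[of \<i>] diag[of \<psi> \<psi>' \<i>] by (auto simp: b_def)
  have W': "(\<phi>' z + D z * \<phi> z) * \<psi> z - (\<psi>' z + D z * \<psi> z) * \<phi> z = - 1" for z
    using W[of z] by (simp add: algebra_simps)
  have ab: "a * b = 1 / 4 + (cmod B12)\<^sup>2"
  proof -
    define X Y where "X = \<phi>' \<i> + D \<i> * \<phi> \<i>" and "Y = \<psi>' \<i> + D \<i> * \<psi> \<i>"
    define s t where "s = complex_of_real (exp (- U \<i>))" and "t = complex_of_real (exp (U \<i>) / 4)"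
    have cs: "cnj s = s" "cnj t = t" by (simp_all add: s_def t_def)
    have e11: "B11 = s * X * cnj X + t * \<phi> \<i> * cnj (\<phi> \<i>)" and e12: "B12 = s * X * cnj Y + t * \<phi> \<i> * cnj (\<psi> \<i>)"
      and e22: "B22 = s * Y * cnj Y + t * \<psi> \<i> * cnj (\<psi> \<i>)"
      using B11[of \<i>] B12[of \<i>] B22[of \<i>] by (simp_all add: B_def X_def Y_def s_def t_def)
    have st: "s * t = 1 / 4" by (simp add: s_def t_def flip: of_real_mult exp_add)
    have "B11 * B22 - B12 * cnj B12 = s * t * ((X * \<psi> \<i> - Y * \<phi> \<i>) * cnj (X * \<psi> \<i> - Y * \<phi> \<i>))"
      unfolding e11 e12 e22 by (simp add: cs algebra_simps)
    also have "X * \<psi> \<i> - Y * \<phi> \<i> = - 1" unfolding X_def Y_def by (rule W')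
    finally have "B11 * B22 - B12 * cnj B12 = 1 / 4" by (simp add: st)
    hence "B11 * B22 = 1 / 4 + B12 * cnj B12" by (simp only: diff_eq_eq)
    hence "complex_of_real (a * b) = of_real (1 / 4 + (cmod B12)\<^sup>2)"
      unfolding of_real_add of_real_mult complex_norm_square by (simp add: a b)
    thus ?thesis by (simp only: of_real_eq_iff)
  qed
  have "0 < a * b" unfolding ab by (intro add_pos_nonneg) auto
  hence pos: "0 < a" "0 < b" using a0 b0 by (auto simp: zero_less_mult_iff)
  define R where "R z = exp (- U z) - (a * (cmod (\<psi> z))\<^sup>2 + b * (cmod (\<phi> z))\<^sup>2 + 2 * Re (- B12 * \<psi> z * cnj (\<phi> z)))" for z
  have "R z = 0" if "0 < Im z" for z
  proof -
    define X Y where "X = \<phi>' z + D z * \<phi> z" and "Y = \<psi>' z + D z * \<psi> z"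
    define s t where "s = complex_of_real (exp (- U z))" and "t = complex_of_real (exp (U z) / 4)"
    have e11: "B11 = s * X * cnj X + t * \<phi> z * cnj (\<phi> z)" and e12: "B12 = s * X * cnj Y + t * \<phi> z * cnj (\<psi> z)"
      and e22: "B22 = s * Y * cnj Y + t * \<psi> z * cnj (\<psi> z)"
      using B11[OF that] B12[OF that] B22[OF that] by (simp_all add: B_def X_def Y_def s_def t_def)
    have "of_real (2 * Re (- B12 * \<psi> z * cnj (\<phi> z))) = - B12 * \<psi> z * cnj (\<phi> z) - cnj B12 * \<phi> z * cnj (\<psi> z)"
      unfolding complex_add_cnj[symmetric] by (simp add: mult_ac)
    hence "complex_of_real (a * (cmod (\<psi> z))\<^sup>2 + b * (cmod (\<phi> z))\<^sup>2 + 2 * Re (- B12 * \<psi> z * cnj (\<phi> z)))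
       = B11 * (\<psi> z * cnj (\<psi> z)) + B22 * (\<phi> z * cnj (\<phi> z)) - B12 * \<psi> z * cnj (\<phi> z) - cnj B12 * \<phi> z * cnj (\<psi> z)"
      unfolding of_real_add of_real_mult[of a] of_real_mult[of b] complex_norm_square a b by simp
    also have "\<dots> = s * ((X * \<psi> z - Y * \<phi> z) * cnj (X * \<psi> z - Y * \<phi> z))"
      unfolding e11 e12 e22 by (simp add: s_def t_def algebra_simps)
    also have "X * \<psi> z - Y * \<phi> z = - 1" unfolding X_def Y_def by (rule W')
    finally show ?thesis unfolding R_def s_def by (simp del: of_real_add of_real_mult)
  qed
  moreover have "continuous_on {z. 0 \<le> Im z} R"
  proof -
    have "continuous_on T \<phi>" "continuous_on T \<psi>" for T
      using \<phi>(1) \<psi>(1) by (auto intro!: continuous_at_imp_continuous_on DERIV_isCont)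
    thus ?thesis unfolding R_def by (intro continuous_intros U_cont)
  qed
  ultimately have "R z = 0" if "0 \<le> Im z" for z
    using continuous_eq_zero_closed_upper_half_plane[of R z] that by blast
  thus ?thesis using pos ab by (intro exI[of _ a] exI[of _ b] exI[of _ "- B12"]) (simp add: R_def)
qed

text \<open>The Hermitian form bounds \<open>exp (- U)\<close> above by a multiple of \<open>|\<phi>|\<^sup>2 + |\<psi>|\<^sup>2\<close>, so the upper bound on \<open>U\<close> becomes a
  lower bound on that sum in the closed upper half plane; symmetry carries it to the lower one.\<close>

lemma bounded_above_imp_coefficient_constant:
  assumes bounded: "\<And>z. 0 < Im z \<Longrightarrow> U z \<le> M"
  obtains c :: real where "\<And>z. 0 < Im z \<Longrightarrow> of_real c = E z - (D z)\<^sup>2"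
proof -
  obtain f where f: "f holomorphic_on UNIV" "\<And>z. f (cnj z) = cnj (f z)"
    "\<And>z. 0 < Im z \<Longrightarrow> f z = E z - (D z)\<^sup>2"
    using schwarzian_extends_entire by blast
  obtain \<phi> where \<phi>: "\<phi> holomorphic_on UNIV" "\<And>z. deriv (deriv \<phi>) z = - f z * \<phi> z" "\<phi> 0 = 1" "deriv \<phi> 0 = 0"
    using entire_oscillator_solution[OF f(1)] by blast
  obtain \<psi> where \<psi>: "\<psi> holomorphic_on UNIV" "\<And>z. deriv (deriv \<psi>) z = - f z * \<psi> z" "\<psi> 0 = 0" "deriv \<psi> 0 = 1"
    using entire_oscillator_solution[OF f(1)] by blast
  have W: "\<phi> z * deriv \<psi> z - deriv \<phi> z * \<psi> z = 1" for z
    using oscillator_wronskian_constant[OF \<phi>(1) \<psi>(1) \<phi>(2) \<psi>(2)] by (simp add: \<phi> \<psi>)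
  have cnj: "\<phi> (cnj z) = cnj (\<phi> z)" "\<psi> (cnj z) = cnj (\<psi> z)" for z
    using oscillator_solution_cnj[OF \<phi>(1) \<psi>(1) \<phi>(2) \<psi>(2) f(2) \<phi>(3,4) \<psi>(3,4)] by blast+
  have ders: "(\<phi> has_field_derivative deriv \<phi> z) (at z)" "(deriv \<phi> has_field_derivative - f z * \<phi> z) (at z)"
    "(\<psi> has_field_derivative deriv \<psi> z) (at z)" "(deriv \<psi> has_field_derivative - f z * \<psi> z) (at z)" for z
    unfolding \<phi>(2)[symmetric] \<psi>(2)[symmetric]
    by (intro holomorphic_derivI[OF _ open_UNIV UNIV_I] holomorphic_deriv \<phi> \<psi> open_UNIV)+
  obtain a b g where ab: "0 < a" "0 < b" and form': "\<forall>z. 0 \<le> Im z \<longrightarrow>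
      exp (- U z) = a * (cmod (\<psi> z))\<^sup>2 + b * (cmod (\<phi> z))\<^sup>2 + 2 * Re (g * \<psi> z * cnj (\<phi> z))"
    using exp_minus_U_hermitian_form[OF f(3) ders W] by blast
  note form = form'[rule_format]
  define K where "K = a + b + cmod g"
  have Kpos: "0 < K" using ab by (simp add: K_def add_pos_nonneg)
  have UM: "U z \<le> M" if "0 \<le> Im z" for z
  proof -
    have "max (U z - M) 0 = 0"
      by (rule continuous_eq_zero_closed_upper_half_plane[of "\<lambda>z. max (U z - M) 0"])
        (use bounded that in \<open>auto intro!: continuous_intros U_cont\<close>)
    thus ?thesis by simp
  qed
  have upper: "exp (- M) / K \<le> sqnorm2 \<phi> \<psi> z" if "0 \<le> Im z" for z
  proof -
    have "2 * Re (g * \<psi> z * cnj (\<phi> z)) \<le> 2 * (cmod g * (cmod (\<psi> z) * cmod (\<phi> z)))"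
      using complex_Re_le_cmod[of "g * \<psi> z * cnj (\<phi> z)"] by (simp add: norm_mult mult.assoc)
    also have "\<dots> = cmod g * (2 * cmod (\<psi> z) * cmod (\<phi> z))" by simp
    also have "\<dots> \<le> cmod g * sqnorm2 \<phi> \<psi> z"
      using sum_squares_bound[of "cmod (\<psi> z)" "cmod (\<phi> z)"] by (intro mult_left_mono) (auto simp: sqnorm2_def)
    finally have 1: "2 * Re (g * \<psi> z * cnj (\<phi> z)) \<le> cmod g * sqnorm2 \<phi> \<psi> z" .
    have 2: "a * (cmod (\<psi> z))\<^sup>2 \<le> a * sqnorm2 \<phi> \<psi> z" "b * (cmod (\<phi> z))\<^sup>2 \<le> b * sqnorm2 \<phi> \<psi> z"
      using ab by (auto intro!: mult_left_mono simp: sqnorm2_def)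
    have "exp (- M) \<le> exp (- U z)" using UM[OF that] by simp
    also have "\<dots> \<le> K * sqnorm2 \<phi> \<psi> z" using 1 2 unfolding form[OF that] K_def distrib_right by linarith
    finally show ?thesis using Kpos by (simp add: divide_le_eq mult.commute)
  qed
  have lower: "exp (- M) / K \<le> sqnorm2 \<phi> \<psi> z" for z
    using upper[of z] upper[of "cnj z"] by (cases "0 \<le> Im z") (auto simp: sqnorm2_def cnj)
  interpret bounded_below_pair \<phi> \<psi> f "exp (- M) / K"
    by unfold_locales (use \<phi> \<psi> W lower Kpos in auto)
  have "f z = f 0" for z by (rule coefficient_constant[OF f(1)])
  moreover have "f 0 = of_real (Re (f 0))" using f(2)[of 0] by (simp add: complex_eq_iff)
  ultimately show ?thesis using that[of "Re (f 0)"] f(3) by metis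
qed

end

section \<open>Solutions with constant coefficient\<close>

lemma eq_ln_if_exp_minus_eq:
  fixes u l W :: real
  assumes "exp (- u) = l * W / 2" "0 < l"
  shows "u + ln l = ln (2 / W)"
proof -
  have "0 < l * W / 2" using assms(1) by (metis exp_gt_zero)
  hence W: "0 < W" using \<open>0 < l\<close> by (simp add: zero_less_mult_iff)
  have "- u = ln (l * W / 2)" using assms(1) by (metis ln_exp)
  thus ?thesis using W \<open>0 < l\<close> by (simp add: ln_mult ln_div)
qed

lemma complex_polar:
  obtains \<gamma> where "g = of_real (cmod g) * exp (\<i> * of_real \<gamma>)"
  using Arg2pi_eq[of g] by metis

lemma Re_polar_exp: "Re (of_real r * exp (\<i> * of_real \<gamma>) * exp (\<i> * of_real t)) = r * cos (t + \<gamma>)"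
proof -
  have *: "of_real r * exp (\<i> * of_real \<gamma>) * exp (\<i> * of_real t) = of_real r * exp (\<i> * of_real (t + \<gamma>))"
    by (simp add: mult.assoc algebra_simps flip: exp_add)
  show ?thesis unfolding * by (simp add: Re_exp del: of_real_add)
qed

context wirtinger_solution
begin

lemma neumann_condition:
  assumes R: "\<And>y. 0 \<le> y \<Longrightarrow> exp (- U (Complex 0 y)) = R y" and "(R has_real_derivative r) (at 0)"
  shows "r = \<kappa>"
proof -
  have "((\<lambda>s. exp (- U (Complex 0 s))) has_real_derivative
      exp (- U (Complex 0 0)) * (- (- \<kappa> * exp (U (of_real 0))))) (at 0 within {0..})"
    by (rule DERIV_chain2[OF DERIV_exp DERIV_minus[OF U_normal]])
  moreover have "exp (- U (Complex 0 0)) * (- (- \<kappa> * exp (U (of_real 0)))) = \<kappa>"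
    by (simp add: exp_minus complex_of_real_def)
  ultimately have "((\<lambda>s. exp (- U (Complex 0 s))) has_real_derivative \<kappa>) (at 0 within {0..})"
    by (simp only:)
  hence "(R has_real_derivative \<kappa>) (at 0 within {0..})"
    by (rule has_field_derivative_transform_within[where d = 1]) (simp_all add: R)
  moreover have "(R has_real_derivative r) (at 0 within {0..})"
    using assms(2) by (rule has_field_derivative_at_within)
  moreover have "{0::real..} - {0} = {0<..}" by auto
  hence "at (0::real) within {0..} \<noteq> bot" by (simp add: at_within_eq_bot_iff)
  ultimately show ?thesis using has_field_derivative_unique by blast
qed

text \<open>The form in \<open>1, z\<close> is a quadratic polynomial in the coordinates. Scaling by \<open>1 / (2 a)\<close> and a horizontal shift
  complete the square in \<open>x\<close>; the Neumann condition fixes the centre in \<open>y\<close>, and the determinant condition the constant term.\<close>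

lemma classification_zero:
  assumes c: "\<And>z. 0 < Im z \<Longrightarrow> of_real 0 = E z - (D z)\<^sup>2"
  shows "\<exists>l>0. \<exists>A. \<forall>x. \<forall>y\<ge>0. U (Complex (l * x + A) (l * y)) + ln l = ln (2 / (1 + x\<^sup>2 + (y + \<kappa>)\<^sup>2))"
proof -
  have "\<exists>a b g. 0 < a \<and> 0 < b \<and> a * b = 1 / 4 + (cmod g)\<^sup>2 \<and> (\<forall>z. 0 \<le> Im z \<longrightarrow>
      exp (- U z) = a * (cmod z)\<^sup>2 + b * (cmod 1)\<^sup>2 + 2 * Re (g * z * cnj 1))"
    by (rule exp_minus_U_hermitian_form[where f = "\<lambda>_. of_real 0" and \<phi> = "\<lambda>_. 1" and \<phi>' = "\<lambda>_. 0"
          and \<psi> = "\<lambda>z. z" and \<psi>' = "\<lambda>_. 1", OF c], auto intro!: derivative_eq_intros)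
  then obtain a b g where ab: "0 < a" "0 < b" "a * b = 1 / 4 + (cmod g)\<^sup>2" and form: "\<forall>z. 0 \<le> Im z \<longrightarrow>
      exp (- U z) = a * (cmod z)\<^sup>2 + b * (cmod 1)\<^sup>2 + 2 * Re (g * z * cnj 1)"
    by blast
  have w: "exp (- U (Complex x y)) = a * (x\<^sup>2 + y\<^sup>2) + b + 2 * (Re g * x - Im g * y)" if "0 \<le> y" for x y
    using form[rule_format, of "Complex x y"] that by (simp add: cmod_power2)
  have "- 2 * Im g = \<kappa>"
    by (rule neumann_condition[OF w[of _ 0]]) (auto intro!: derivative_eq_intros)
  hence \<kappa>: "Im g = - \<kappa> / 2" by simp
  define l A where "l = 1 / (2 * a)" and "A = - Re g / a"
  have lpos: "0 < l" using ab by (simp add: l_def)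
  have "U (Complex (l * x + A) (l * y)) + ln l = ln (2 / (1 + x\<^sup>2 + (y + \<kappa>)\<^sup>2))" if "0 \<le> y" for x y
  proof (rule eq_ln_if_exp_minus_eq[OF _ lpos])
    have "exp (- U (Complex (l * x + A) (l * y)))
        = a * ((l * x + A)\<^sup>2 + (l * y)\<^sup>2) + b + 2 * (Re g * (l * x + A) + \<kappa> / 2 * (l * y))"
      using w[of "l * y" "l * x + A"] that lpos by (simp add: \<kappa>)
    also have "\<dots> = ((2 * a * l * x + 2 * a * A)\<^sup>2 + (2 * a * l * y)\<^sup>2 + 4 * (a * b)
        + 4 * Re g * (2 * a * l * x + 2 * a * A) + 2 * \<kappa> * (2 * a * l * y)) / (4 * a)"
      using ab(1) by (simp add: field_simps power2_eq_square)
    also have "2 * a * l = 1" using ab by (simp add: l_def)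
    also have "2 * a * A = - 2 * Re g" using ab by (simp add: A_def)
    also have "4 * (a * b) = 1 + 4 * (Re g)\<^sup>2 + \<kappa>\<^sup>2" 
      unfolding ab(3) cmod_power2 \<kappa> by (simp add: power2_eq_square)
    also have "((1 * x + - 2 * Re g)\<^sup>2 + (1 * y)\<^sup>2 + (1 + 4 * (Re g)\<^sup>2 + \<kappa>\<^sup>2) + 4 * Re g * (1 * x + - 2 * Re g) + 2 * \<kappa> * (1 * y)) / (4 * a)
        = l * (1 + x\<^sup>2 + (y + \<kappa>)\<^sup>2) / 2"
      using ab(1) by (simp add: l_def power2_eq_square field_simps)
    finally show "exp (- U (Complex (l * x + A) (l * y))) = l * (1 + x\<^sup>2 + (y + \<kappa>)\<^sup>2) / 2" .
  qed
  thus ?thesis using lpos by blast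
qed

text \<open>Here the basis is \<open>exp (- i k z)\<close>, \<open>exp (i k z) / (2 i k)\<close>. The diagonal terms of the form are exponentials in \<open>y\<close> and the mixed term is
  a cosine in \<open>x\<close>, whose phase is removed by a shift. The determinant condition reads \<open>P * Q = 1 + t\<^sup>2\<close> and the Neumann
  condition \<open>Q - P = 2 * \<kappa>\<close>; as \<open>P\<close> and \<open>Q\<close> are positive, this determines both.\<close>

lemma classification_positive:
  assumes "0 < k" and c: "\<And>z. 0 < Im z \<Longrightarrow> of_real (k\<^sup>2) = E z - (D z)\<^sup>2"
  shows "\<exists>l>0. \<exists>A. \<exists>t\<ge>0. \<forall>x. \<forall>y\<ge>0. U (Complex (l * x + A) (l * y)) + ln l =
     ln (2 * exp y / (sqrt (\<kappa>\<^sup>2 + t\<^sup>2 + 1) - \<kappa> + 2 * t * cos x * exp y + (sqrt (\<kappa>\<^sup>2 + t\<^sup>2 + 1) + \<kappa>) * exp (2 * y)))"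
proof -
  define K where "K = \<i> * complex_of_real k"
  have K0: "K \<noteq> 0" using \<open>0 < k\<close> by (simp add: K_def)
  have KK: "K * K = - of_real (k\<^sup>2)" by (simp add: K_def power2_eq_square complex_eq_iff)
  have "\<exists>a b g. 0 < a \<and> 0 < b \<and> a * b = 1 / 4 + (cmod g)\<^sup>2 \<and> (\<forall>z. 0 \<le> Im z \<longrightarrow>
      exp (- U z) = a * (cmod (exp (K * z) / (2 * K)))\<^sup>2 + b * (cmod (exp (- K * z)))\<^sup>2
        + 2 * Re (g * (exp (K * z) / (2 * K)) * cnj (exp (- K * z))))"
  proof (rule exp_minus_U_hermitian_form[where f = "\<lambda>_. of_real (k\<^sup>2)" and \<phi> = "\<lambda>z. exp (- K * z)"
        and \<phi>' = "\<lambda>z. - K * exp (- K * z)" and \<psi> = "\<lambda>z. exp (K * z) / (2 * K)" and \<psi>' = "\<lambda>z. exp (K * z) / 2", OF c])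
    show "((\<lambda>z. - K * exp (- K * z)) has_field_derivative - of_real (k\<^sup>2) * exp (- K * z)) (at z)" for z
      unfolding KK[symmetric] by (auto intro!: derivative_eq_intros)
    show "((\<lambda>z. exp (K * z) / 2) has_field_derivative - of_real (k\<^sup>2) * (exp (K * z) / (2 * K))) (at z)" for z
      unfolding KK[symmetric] using K0 by (auto intro!: derivative_eq_intros)
    show "exp (- K * z) * (exp (K * z) / 2) - - K * exp (- K * z) * (exp (K * z) / (2 * K)) = 1" for z
      using K0 by (simp add: exp_minus field_simps)
  qed (use K0 in \<open>auto intro!: derivative_eq_intros\<close>)
  then obtain a b g where ab: "0 < a" "0 < b" "a * b = 1 / 4 + (cmod g)\<^sup>2" and form: "\<forall>z. 0 \<le> Im z \<longrightarrow>
      exp (- U z) = a * (cmod (exp (K * z) / (2 * K)))\<^sup>2 + b * (cmod (exp (- K * z)))\<^sup>2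
        + 2 * Re (g * (exp (K * z) / (2 * K)) * cnj (exp (- K * z)))"
    by blast
  obtain \<gamma> where \<gamma>: "g / \<i> = of_real (cmod (g / \<i>)) * exp (\<i> * of_real \<gamma>)" by (rule complex_polar)
  have w: "exp (- U (Complex x y)) = a / (4 * k\<^sup>2) * exp (- (2 * k * y)) + b * exp (2 * k * y) + cmod g / k * cos (2 * k * x + \<gamma>)"
    if "0 \<le> y" for x y
  proof -
    let ?z = "Complex x y"
    have n1: "(cmod (exp (K * ?z) / (2 * K)))\<^sup>2 = exp (- (2 * k * y)) / (4 * k\<^sup>2)"
      using \<open>0 < k\<close> by (simp add: K_def norm_divide norm_mult power_divide power_mult_distrib flip: exp_double)
    have n2: "(cmod (exp (- K * ?z)))\<^sup>2 = exp (2 * k * y)"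
      by (simp add: K_def flip: exp_double)
    have "K * ?z + cnj (- K * ?z) = \<i> * of_real (2 * k * x)" by (simp add: K_def complex_eq_iff)
    hence e: "exp (K * ?z) * cnj (exp (- K * ?z)) = exp (\<i> * of_real (2 * k * x))"
      by (metis exp_add exp_cnj)
    have "g * (exp (K * ?z) / (2 * K)) * cnj (exp (- K * ?z)) = g * (exp (K * ?z) * cnj (exp (- K * ?z))) / (2 * K)"
      by simp
    also have "\<dots> = g / \<i> * exp (\<i> * of_real (2 * k * x)) / of_real (2 * k)"
      unfolding e by (simp only: K_def of_real_mult of_real_numeral times_divide_eq_left divide_divide_eq_left mult_ac)
    finally have "2 * Re (g * (exp (K * ?z) / (2 * K)) * cnj (exp (- K * ?z))) = 2 * Re (g / \<i> * exp (\<i> * of_real (2 * k * x)) / of_real (2 * k))"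
      by (simp only:)
    also have "\<dots> = Re (g / \<i> * exp (\<i> * of_real (2 * k * x))) / k" 
      by (simp only: Re_divide_of_real)
    also have "\<dots> = cmod g / k * cos (2 * k * x + \<gamma>)"
      by (subst \<gamma>, subst Re_polar_exp) (simp add: norm_divide norm_mult)
    finally show ?thesis using form[rule_format, of ?z] that n1 n2 by simp
  qed
  have "((\<lambda>y. p * exp (- (2 * k * y)) + b * exp (2 * k * y) + q) has_real_derivative - (2 * k) * p + 2 * k * b) (at 0)" for p q
    by (auto intro!: derivative_eq_intros)
  from neumann_condition[OF w[of _ 0] this]
  have "- (2 * k) * (a / (4 * k\<^sup>2)) + 2 * k * b = \<kappa>" .
  hence \<kappa>: "4 * k * b - a / k = 2 * \<kappa>" using \<open>0 < k\<close> by (simp add: field_simps power2_eq_square)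
  define t where "t = 2 * cmod g"
  have t0: "0 \<le> t" by (simp add: t_def)
  define P Q where "P = a / k" and "Q = 4 * k * b"
  have PQ: "0 < P" "0 < Q" "P * Q = 1 + t\<^sup>2"
    using ab \<open>0 < k\<close> by (simp_all add: P_def Q_def t_def power_mult_distrib)
  have QP: "2 * \<kappa> = Q - P" using \<kappa> by (simp add: P_def Q_def)
  have "(P + \<kappa>)\<^sup>2 = \<kappa>\<^sup>2 + t\<^sup>2 + 1"
  proof -
    note QP
    moreover have "(P + \<kappa>)\<^sup>2 = P * (P + 2 * \<kappa>) + \<kappa>\<^sup>2" by (simp add: power2_eq_square algebra_simps)
    ultimately show ?thesis using PQ(3) by simp
  qed
  moreover have "0 \<le> P + \<kappa>" using QP PQ(1,2) by linarith
  ultimately have s: "sqrt (\<kappa>\<^sup>2 + t\<^sup>2 + 1) = P + \<kappa>" by (metis real_sqrt_unique)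
  have P: "sqrt (\<kappa>\<^sup>2 + t\<^sup>2 + 1) - \<kappa> = P" and Q: "sqrt (\<kappa>\<^sup>2 + t\<^sup>2 + 1) + \<kappa> = Q"
    using QP unfolding s by linarith+
  define l A where "l = 1 / (2 * k)" and "A = - \<gamma> / (2 * k)"
  have lpos: "0 < l" using \<open>0 < k\<close> by (simp add: l_def)
  have "U (Complex (l * x + A) (l * y)) + ln l
      = ln (2 * exp y / (P + 2 * t * cos x * exp y + Q * exp (2 * y)))" if "0 \<le> y" for x y
  proof -
    have kx: "2 * k * (l * x + A) + \<gamma> = x" and ky: "2 * k * (l * y) = y"
      using \<open>0 < k\<close> by (simp_all add: l_def A_def field_simps)
    have "exp (- U (Complex (l * x + A) (l * y)))
        = a / (4 * k\<^sup>2) * exp (- y) + b * exp y + cmod g / k * cos x"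
      using w[of "l * y" "l * x + A"] that lpos by (simp only: kx ky) simp
    also have "\<dots> = l * (P * exp (- y) + 2 * t * cos x + Q * exp y) / 2"
      using \<open>0 < k\<close> by (simp add: l_def P_def Q_def t_def field_simps power2_eq_square)
    finally have "U (Complex (l * x + A) (l * y)) + ln l = ln (2 / (P * exp (- y) + 2 * t * cos x + Q * exp y))"
      by (rule eq_ln_if_exp_minus_eq) (rule lpos)
    also have "2 / (P * exp (- y) + 2 * t * cos x + Q * exp y) = 2 * exp y / ((P * exp (- y) + 2 * t * cos x + Q * exp y) * exp y)"
      by simp
    also have "(P * exp (- y) + 2 * t * cos x + Q * exp y) * exp y = P + 2 * t * cos x * exp y + Q * exp (2 * y)"
      by (simp add: distrib_right exp_minus exp_double power2_eq_square)
    finally show ?thesis .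
  qed
  note family = this
  show ?thesis
    by (rule exI[of _ l], rule conjI[OF lpos], rule exI[of _ A], rule exI[of _ t], rule conjI[OF t0])
      (simp only: P Q, intro allI impI, erule family)
qed

text \<open>Now the basis is \<open>exp (- k z)\<close>, \<open>exp (k z) / (2 k)\<close>, and the roles of \<open>x\<close> and \<open>y\<close> are exchanged. The shift in \<open>x\<close>
  normalises the coefficient of \<open>exp x\<close>, and the phase of the cosine in \<open>y\<close> is tied to \<open>\<kappa>\<close> by the Neumann condition.\<close>

lemma classification_negative:
  assumes "0 < k" and c: "\<And>z. 0 < Im z \<Longrightarrow> of_real (- k\<^sup>2) = E z - (D z)\<^sup>2"
  shows "\<exists>l>0. \<exists>A. \<exists>t\<ge>0. \<exists>b. t * sin b = \<kappa> \<and> (\<forall>x. \<forall>y\<ge>0. U (Complex (l * x + A) (l * y)) + ln l =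
     ln (2 * exp x / ((1 + t\<^sup>2) + 2 * t * exp x * cos (y - b) + exp (2 * x))))"
proof -
  define K where "K = complex_of_real k"
  have K0: "K \<noteq> 0" using \<open>0 < k\<close> by (simp add: K_def)
  have KK: "K * K = - of_real (- k\<^sup>2)" by (simp add: K_def power2_eq_square)
  have "\<exists>a b g. 0 < a \<and> 0 < b \<and> a * b = 1 / 4 + (cmod g)\<^sup>2 \<and> (\<forall>z. 0 \<le> Im z \<longrightarrow>
      exp (- U z) = a * (cmod (exp (K * z) / (2 * K)))\<^sup>2 + b * (cmod (exp (- K * z)))\<^sup>2
        + 2 * Re (g * (exp (K * z) / (2 * K)) * cnj (exp (- K * z))))"
  proof (rule exp_minus_U_hermitian_form[where f = "\<lambda>_. of_real (- k\<^sup>2)" and \<phi> = "\<lambda>z. exp (- K * z)"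
        and \<phi>' = "\<lambda>z. - K * exp (- K * z)" and \<psi> = "\<lambda>z. exp (K * z) / (2 * K)" and \<psi>' = "\<lambda>z. exp (K * z) / 2", OF c])
    show "((\<lambda>z. - K * exp (- K * z)) has_field_derivative - of_real (- k\<^sup>2) * exp (- K * z)) (at z)" for z
      unfolding KK[symmetric] by (auto intro!: derivative_eq_intros)
    show "((\<lambda>z. exp (K * z) / 2) has_field_derivative - of_real (- k\<^sup>2) * (exp (K * z) / (2 * K))) (at z)" for z
      unfolding KK[symmetric] using K0 by (auto intro!: derivative_eq_intros)
    show "exp (- K * z) * (exp (K * z) / 2) - - K * exp (- K * z) * (exp (K * z) / (2 * K)) = 1" for z
      using K0 by (simp add: exp_minus field_simps)
  qed (use K0 in \<open>auto intro!: derivative_eq_intros\<close>)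
  then obtain a b g where ab: "0 < a" "0 < b" "a * b = 1 / 4 + (cmod g)\<^sup>2" and form: "\<forall>z. 0 \<le> Im z \<longrightarrow>
      exp (- U z) = a * (cmod (exp (K * z) / (2 * K)))\<^sup>2 + b * (cmod (exp (- K * z)))\<^sup>2
        + 2 * Re (g * (exp (K * z) / (2 * K)) * cnj (exp (- K * z)))"
    by blast
  obtain \<gamma> where \<gamma>: "g = of_real (cmod g) * exp (\<i> * of_real \<gamma>)" by (rule complex_polar)
  have w: "exp (- U (Complex x y)) = a / (4 * k\<^sup>2) * exp (2 * k * x) + b * exp (- (2 * k * x)) + cmod g / k * cos (2 * k * y + \<gamma>)"
    if "0 \<le> y" for x y
  proof -
    let ?z = "Complex x y"
    have n1: "(cmod (exp (K * ?z) / (2 * K)))\<^sup>2 = exp (2 * k * x) / (4 * k\<^sup>2)"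
      using \<open>0 < k\<close> by (simp add: K_def norm_divide norm_mult power_divide power_mult_distrib flip: exp_double)
    have n2: "(cmod (exp (- K * ?z)))\<^sup>2 = exp (- (2 * k * x))"
      by (simp add: K_def flip: exp_double)
    have "K * ?z + cnj (- K * ?z) = \<i> * of_real (2 * k * y)" by (simp add: K_def complex_eq_iff)
    hence e: "exp (K * ?z) * cnj (exp (- K * ?z)) = exp (\<i> * of_real (2 * k * y))"
      by (metis exp_add exp_cnj)
    have "g * (exp (K * ?z) / (2 * K)) * cnj (exp (- K * ?z)) = g * (exp (K * ?z) * cnj (exp (- K * ?z))) / (2 * K)"
      by simp
    also have "\<dots> = g * exp (\<i> * of_real (2 * k * y)) / of_real (2 * k)"
      unfolding e by (simp only: K_def of_real_mult of_real_numeral times_divide_eq_left divide_divide_eq_left mult_ac)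
    finally have "2 * Re (g * (exp (K * ?z) / (2 * K)) * cnj (exp (- K * ?z))) = 2 * Re (g * exp (\<i> * of_real (2 * k * y)) / of_real (2 * k))"
      by (simp only:)
    also have "\<dots> = Re (g * exp (\<i> * of_real (2 * k * y))) / k"
      by (simp only: Re_divide_of_real)
    also have "\<dots> = cmod g / k * cos (2 * k * y + \<gamma>)"
      by (subst \<gamma>, subst Re_polar_exp) simp
    finally show ?thesis using form[rule_format, of ?z] that n1 n2 by simp
  qed
  have "cmod g / k * (- sin \<gamma> * (2 * k)) = \<kappa>"
    by (rule neumann_condition[OF w[of _ 0]]) (auto intro!: derivative_eq_intros)
  hence \<kappa>: "2 * cmod g * sin (- \<gamma>) = \<kappa>" using \<open>0 < k\<close> by simp
  define t where "t = 2 * cmod g"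
  have t0: "0 \<le> t" by (simp add: t_def)
  define l A where "l = 1 / (2 * k)" and "A = ln (k / a) / (2 * k)"
  have lpos: "0 < l" using \<open>0 < k\<close> by (simp add: l_def)
  have "U (Complex (l * x + A) (l * y)) + ln l
      = ln (2 * exp x / ((1 + t\<^sup>2) + 2 * t * exp x * cos (y - (- \<gamma>)) + exp (2 * x)))" if "0 \<le> y" for x y
  proof -
    have kx: "2 * k * (l * x + A) = x + ln (k / a)" and ky: "2 * k * (l * y) = y"
      using \<open>0 < k\<close> by (simp_all add: l_def A_def field_simps)
    have "exp (- U (Complex (l * x + A) (l * y)))
        = a / (4 * k\<^sup>2) * exp (x + ln (k / a)) + b * exp (- (x + ln (k / a))) + cmod g / k * cos (y + \<gamma>)"
      using w[of "l * y" "l * x + A"] that lpos by (simp only: kx ky) simp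
    also have "exp (x + ln (k / a)) = k / a * exp x" using ab \<open>0 < k\<close> by (simp add: exp_add)
    also have "exp (- (x + ln (k / a))) = a / k * exp (- x)"
      using ab \<open>0 < k\<close> by (simp add: exp_add exp_diff exp_minus field_simps)
    also have "a / (4 * k\<^sup>2) * (k / a * exp x) + b * (a / k * exp (- x)) + cmod g / k * cos (y + \<gamma>)
        = l * (exp x + 4 * (a * b) * exp (- x) + 2 * t * cos (y + \<gamma>)) / 2"
      using \<open>0 < k\<close> ab(1) by (simp add: l_def t_def field_simps power2_eq_square)
    also have "4 * (a * b) = 1 + t\<^sup>2" using ab(3) by (simp add: t_def power_mult_distrib)
    finally have "U (Complex (l * x + A) (l * y)) + ln l = ln (2 / (exp x + (1 + t\<^sup>2) * exp (- x) + 2 * t * cos (y + \<gamma>)))"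
      by (rule eq_ln_if_exp_minus_eq) (rule lpos)
    also have "2 / (exp x + (1 + t\<^sup>2) * exp (- x) + 2 * t * cos (y + \<gamma>))
        = 2 * exp x / ((exp x + (1 + t\<^sup>2) * exp (- x) + 2 * t * cos (y + \<gamma>)) * exp x)"
      by simp
    also have "(exp x + (1 + t\<^sup>2) * exp (- x) + 2 * t * cos (y + \<gamma>)) * exp x
        = (1 + t\<^sup>2) + 2 * t * exp x * cos (y - (- \<gamma>)) + exp (2 * x)"
      by (simp add: distrib_right exp_minus exp_double power2_eq_square)
    finally show ?thesis .
  qed
  thus ?thesis using lpos t0 \<kappa> by (intro exI[of _ l] conjI exI[of _ A] exI[of _ t] exI[of _ "- \<gamma>"]) (auto simp: t_def)
qed

end

section \<open>The classification\<close>

theorem theorem1p4: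
  fixes \<kappa> :: real and u :: "real \<times> real \<Rightarrow> real"
  assumes "liouville_neumann_solution \<kappa> u"
    and "bdd_above (u ` half_plane)"
  shows "\<exists>l>0. \<exists>a.
    (\<forall>(x1, x2)\<in>closed_half_plane. normalization l a u (x1, x2) =
        ln (2 / (1 + x1\<^sup>2 + (x2 + \<kappa>)\<^sup>2))) \<or>
    (\<exists>t\<ge>0. \<forall>(x1, x2)\<in>closed_half_plane. normalization l a u (x1, x2) =
        ln (2 * exp x2 /
            (sqrt (\<kappa>\<^sup>2 + t\<^sup>2 + 1) - \<kappa> + 2 * t * cos x1 * exp x2
             + (sqrt (\<kappa>\<^sup>2 + t\<^sup>2 + 1) + \<kappa>) * exp (2 * x2)))) \<or>
    (\<exists>t\<ge>0. \<exists>b. t * sin b = \<kappa> \<and>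
      (\<forall>(x1, x2)\<in>closed_half_plane. normalization l a u (x1, x2) =
        ln (2 * exp x1 /
            ((1 + t\<^sup>2) + 2 * t * exp x1 * cos (x2 - b) + exp (2 * x1)))))"
proof -
  define U where "U z = u (Re z, Im z)" for z
  obtain D E where "wirtinger_solution \<kappa> U D E"
    using liouville_neumann_solution_imp_wirtinger_solution[OF assms(1)] unfolding U_def by blast
  then interpret wirtinger_solution \<kappa> U D E .
  obtain M where "\<And>x. x \<in> half_plane \<Longrightarrow> u x \<le> M" using assms(2) by (auto simp: bdd_above_def)
  hence M: "U z \<le> M" if "0 < Im z" for z using that by (simp add: U_def half_plane_def)
  obtain c where c: "\<And>z. 0 < Im z \<Longrightarrow> of_real c = E z - (D z)\<^sup>2"
    using bounded_above_imp_coefficient_constant[OF M] by blast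
  have norm: "normalization l a u (x1, x2) = U (Complex (l * x1 + a) (l * x2)) + ln l" for l a x1 x2
    by (simp add: normalization_def U_def)
  have ball: "(\<forall>(x1, x2)\<in>closed_half_plane. Q x1 x2) \<longleftrightarrow> (\<forall>x1. \<forall>x2\<ge>0. Q x1 x2)" for Q
    by (auto simp: closed_half_plane_def)
  consider "c = 0" | "0 < c" | "c < 0" by linarith
  thus ?thesis
  proof cases
    case 1
    from classification_zero[OF c[unfolded 1]] show ?thesis unfolding ball norm by blast
  next
    case 2
    hence "c = (sqrt c)\<^sup>2" "0 < sqrt c" by simp_all
    from classification_positive[OF this(2)] c this(1) show ?thesis unfolding ball norm by metis
  next
    case 3
    hence "c = - (sqrt (- c))\<^sup>2" "0 < sqrt (- c)" by simp_all
    from classification_negative[OF this(2)] c this(1) show ?thesis unfolding ball norm by metis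
  qed
qed

end
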